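(* Let $B$ be a factorial affine $k$-domain with a nontrivial irreducible locally nilpotent derivation $\delta$, and let $A=\operatorname{Ker}\delta$ be noetherian. Suppose that $\delta(B)\cap A=\alpha^p\beta A$, where $p>0$, $\alpha\in A$ is a prime element, and $\beta\in A$ is coprime to $\alpha$. If $A$ is an affine $k$-domain, then the general closed fiber of the morphism $\pi:X=\operatorname{Spec}B\to Y=\operatorname{Spec}A$ (induced by $A\hookrightarrow B$) over $\Gamma=\operatorname{Spec}A/\alpha A$ consists of a disjoint union of $m$ affine lines, where $m\ge\deg_{\overline z}\overline g(\overline z)$ and $\overline g$ is the polynomial defined in the context.
   Context: $k$ is an algebraically closed field of characteristic $0$. An affine $k$-domain is a finitely generated $k$-algebra that is an integral domain; it is factorial if it is a UFD. A locally nilpotent derivation $\delta$ on $B$ is irreducible if $\delta(B)\subset bB$ with $b\in B$ implies $b\in B^*$. The ideal $\delta(B)\cap A$ of $A$ is the plinth ideal. A property holds for the general closed fiber of $\pi$ over $\Gamma$ if it holds for the fibers over all closed points of some nonempty open subset of $\Gamma$. An affine line is a copy of $\mathbb A^1_k$. Definition of $\overline g$: let $z\in B$ be such that $\delta(z)=\alpha^p\beta$. Then $z$ is transcendental over $A$. Let $I_1=A[z]\cap\alpha B$, $\overline A=A/\alpha A$, $K=Q(\overline A)$ (quotient field), identify $A[z]/\alpha A[z]$ with the polynomial ring $\overline A[\overline z]$, and let $\overline I_1$ be the image of $I_1$ in $\overline A[\overline z]$. The ideal $\overline I_1K[\overline z]$ of $K[\overline z]$ is a nonzero (principal) prime ideal.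 Let $g\in I_1$ be an element whose image $\overline g\in\overline A[\overline z]\subset K[\overline z]$ generates $\overline I_1K[\overline z]$ (the degree $\deg_{\overline z}\overline g$ does not depend on the choice of $g$). *)

theory Defs
  imports
    "HOL-Algebra.Algebraic_Closure"
    "HOL-Algebra.Chinese_Remainder"
    "HOL-Algebra.Generated_Rings"
begin

text \<open>
  A nonzero algebra over a field contains an isomorphic copy of that field, so an affine domain over
  a field is modelled as a ring together with a subfield.
\<close>

definition char_zero :: "('a, 'b) ring_scheme \<Rightarrow> bool"
  where "char_zero R \<longleftrightarrow> (\<forall>n::nat. n > 0 \<longrightarrow> [n] \<cdot>\<^bsub>R\<^esub> \<one>\<^bsub>R\<^esub> \<noteq> \<zero>\<^bsub>R\<^esub>)"

definition affine_domain :: "'a set \<Rightarrow> ('a, 'b) ring_scheme \<Rightarrow> bool"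
  where "affine_domain k R \<longleftrightarrow>
    domain R \<and> subfield k R \<and>
    (\<exists>S. finite S \<and> S \<subseteq> carrier R \<and> carrier R = generate_ring R (k \<union> S))"


subsection \<open>Locally nilpotent derivations\<close>

text \<open>Given the Leibniz rule, vanishing on \<open>k\<close> amounts to \<open>k\<close>-linearity.\<close>

definition locally_nilpotent_derivation ::
    "'a set \<Rightarrow> ('a, 'b) ring_scheme \<Rightarrow> ('a \<Rightarrow> 'a) \<Rightarrow> bool"
  where "locally_nilpotent_derivation k R \<delta> \<longleftrightarrow>
    \<delta> \<in> carrier R \<rightarrow> carrier R \<and>
    (\<forall>a\<in>carrier R. \<forall>b\<in>carrier R. \<delta> (a \<oplus>\<^bsub>R\<^esub> b) = \<delta> a \<oplus>\<^bsub>R\<^esub> \<delta> b) \<and>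
    (\<forall>a\<in>carrier R. \<forall>b\<in>carrier R.
        \<delta> (a \<otimes>\<^bsub>R\<^esub> b) = (a \<otimes>\<^bsub>R\<^esub> \<delta> b) \<oplus>\<^bsub>R\<^esub> (b \<otimes>\<^bsub>R\<^esub> \<delta> a)) \<and>
    (\<forall>c\<in>k. \<delta> c = \<zero>\<^bsub>R\<^esub>) \<and>
    (\<forall>b\<in>carrier R. \<exists>n. (\<delta> ^^ n) b = \<zero>\<^bsub>R\<^esub>)"

definition nontrivial_derivation :: "('a, 'b) ring_scheme \<Rightarrow> ('a \<Rightarrow> 'a) \<Rightarrow> bool"
  where "nontrivial_derivation R \<delta> \<longleftrightarrow> (\<exists>b\<in>carrier R. \<delta> b \<noteq> \<zero>\<^bsub>R\<^esub>)"

definition irreducible_derivation :: "('a, 'b) ring_scheme \<Rightarrow> ('a \<Rightarrow> 'a) \<Rightarrow> bool"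
  where "irreducible_derivation R \<delta> \<longleftrightarrow>
    (\<forall>b\<in>carrier R. \<delta> ` carrier R \<subseteq> PIdl\<^bsub>R\<^esub> b \<longrightarrow> b \<in> Units R)"

definition kernel_ring :: "('a, 'b) ring_scheme \<Rightarrow> ('a \<Rightarrow> 'a) \<Rightarrow> ('a, 'b) ring_scheme"
  where "kernel_ring R \<delta> = R \<lparr> carrier := {b \<in> carrier R. \<delta> b = \<zero>\<^bsub>R\<^esub>} \<rparr>"

definition plinth_ideal :: "('a, 'b) ring_scheme \<Rightarrow> ('a \<Rightarrow> 'a) \<Rightarrow> 'a set"
  where "plinth_ideal R \<delta> = \<delta> ` carrier R \<inter> carrier (kernel_ring R \<delta>)"


subsection \<open>Spectra and general closed points\<close>

definition Spec :: "('a, 'b) ring_scheme \<Rightarrow> 'a set set"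
  where "Spec R = {P. primeideal P R}"

definition zariski_closed :: "('a, 'b) ring_scheme \<Rightarrow> 'a set set \<Rightarrow> bool"
  where "zariski_closed R Z \<longleftrightarrow> (\<exists>E \<subseteq> carrier R. Z = {P \<in> Spec R. E \<subseteq> P})"

definition zariski_open :: "('a, 'b) ring_scheme \<Rightarrow> 'a set set \<Rightarrow> bool"
  where "zariski_open R U \<longleftrightarrow> U \<subseteq> Spec R \<and> zariski_closed R (Spec R - U)"

definition closed_points :: "('a, 'b) ring_scheme \<Rightarrow> 'a set set"
  where "closed_points R = {P \<in> Spec R. zariski_closed R {P}}"

definition for_general_closed_point ::
    "('a, 'b) ring_scheme \<Rightarrow> ('a set \<Rightarrow> bool) \<Rightarrow> bool"
  where "for_general_closed_point R \<P> \<longleftrightarrow>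
    (\<exists>U. zariski_open R U \<and> U \<noteq> {} \<and> (\<forall>y \<in> U \<inter> closed_points R. \<P> y))"


subsection \<open>Closed fibers and affine lines\<close>

text \<open>
  Let \<open>A\<close> be a subring of \<open>B\<close> and \<open>I\<close> an ideal of \<open>A\<close>. The closed immersion of \<open>Spec (A/I)\<close> in
  \<open>Spec A\<close> sends a prime of \<open>A/I\<close> to its preimage in \<open>A\<close>.
\<close>

definition quot_point :: "('a, 'b) ring_scheme \<Rightarrow> 'a set \<Rightarrow> 'a set set \<Rightarrow> 'a set"
  where "quot_point A I y = {a \<in> carrier A. I +>\<^bsub>A\<^esub> a \<in> y}"

text \<open>
  The residue field of a closed point \<open>M\<close> of \<open>Spec A\<close> is \<open>A/M\<close>, so the scheme-theoretic fiber of
  \<open>Spec B \<rightarrow> Spec A\<close> over \<open>M\<close> is the spectrum of \<open>B \<otimes> A/M = B/MB\<close>.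
\<close>

definition fiber_ideal :: "('a, 'b) ring_scheme \<Rightarrow> 'a set \<Rightarrow> 'a set"
  where "fiber_ideal B M = Idl\<^bsub>B\<^esub> M"

definition fiber_ring :: "('a, 'b) ring_scheme \<Rightarrow> 'a set \<Rightarrow> 'a set ring"
  where "fiber_ring B M = B Quot fiber_ideal B M"

text \<open>
  The disjoint union of \<open>m\<close> copies of the affine line \<open>Spec F[t]\<close> is the spectrum of the \<open>m\<close>-fold
  product of \<open>F[t]\<close>. Hence \<open>Spec R\<close>, for an \<open>F\<close>-algebra \<open>R\<close> with structure map \<open>\<sigma>\<close>, is isomorphic
  over \<open>F\<close> to such a union iff \<open>R\<close> is isomorphic to this product by a map that carries each \<open>\<sigma> c\<close>
  to the tuple of constants \<open>c\<close>.
\<close>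

definition disjoint_union_of_affine_lines ::
    "('f, 'g) ring_scheme \<Rightarrow> ('f \<Rightarrow> 'r) \<Rightarrow> ('r, 's) ring_scheme \<Rightarrow> nat \<Rightarrow> bool"
  where "disjoint_union_of_affine_lines F \<sigma> R m \<longleftrightarrow>
    (\<exists>\<phi> \<in> ring_iso R (RDirProd_list (replicate m (poly_ring F))).
        \<forall>c\<in>carrier F. \<phi> (\<sigma> c) = replicate m (ring.poly_of_const F c))"


subsection \<open>The polynomial obtained by reduction modulo a prime element\<close>

definition fraction_field ::
    "('a, 'b) ring_scheme \<Rightarrow> ('c, 'd) ring_scheme \<Rightarrow> ('a \<Rightarrow> 'c) \<Rightarrow> bool"
  where "fraction_field R K \<iota> \<longleftrightarrow>
    field K \<and> \<iota> \<in> ring_hom R K \<and> inj_on \<iota> (carrier R) \<and>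
    (\<forall>x\<in>carrier K. \<exists>a\<in>carrier R. \<exists>b\<in>carrier R - {\<zero>\<^bsub>R\<^esub>}. x = \<iota> a \<otimes>\<^bsub>K\<^esub> inv\<^bsub>K\<^esub> \<iota> b)"

text \<open>
  Polynomials are coefficient lists, highest degree first. The description below selects the
  polynomial over \<open>A\<close> with value \<open>f\<close> at \<open>z\<close>; it is unique when \<open>z\<close> is transcendental over \<open>A\<close>.
\<close>

definition poly_in ::
    "('a, 'b) ring_scheme \<Rightarrow> ('a, 'b) ring_scheme \<Rightarrow> 'a \<Rightarrow> 'a \<Rightarrow> 'a list"
  where "poly_in B A z f = (THE q. q \<in> carrier (poly_ring A) \<and> ring.eval B q z = f)"

text \<open>Reduction may kill leading coefficients, hence the normalization.\<close>

definition reduce_poly :: "('a, 'b) ring_scheme \<Rightarrow> 'a set \<Rightarrow> 'a list \<Rightarrow> 'a set list"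
  where "reduce_poly A I q = ring.normalize (A Quot I) (map (\<lambda>a. I +>\<^bsub>A\<^esub> a) q)"

text \<open>
  \<open>I1 B A \<alpha> z\<close> is the intersection of \<open>A[z]\<close> with \<open>\<alpha>B\<close>, and \<open>bar_poly B A \<alpha> z f\<close> is the image of
  an element \<open>f\<close> of \<open>A[z]\<close> in \<open>A[z]/\<alpha>A[z]\<close>, viewed as a polynomial over \<open>A/\<alpha>A\<close>.
\<close>

definition I1 :: "('a, 'b) ring_scheme \<Rightarrow> ('a, 'b) ring_scheme \<Rightarrow> 'a \<Rightarrow> 'a \<Rightarrow> 'a set"
  where "I1 B A \<alpha> z = ring.simple_extension B (carrier A) z \<inter> PIdl\<^bsub>B\<^esub> \<alpha>"

definition bar_poly ::
    "('a, 'b) ring_scheme \<Rightarrow> ('a, 'b) ring_scheme \<Rightarrow> 'a \<Rightarrow> 'a \<Rightarrow> 'a \<Rightarrow> 'a set list"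
  where "bar_poly B A \<alpha> z f = reduce_poly A (PIdl\<^bsub>A\<^esub> \<alpha>) (poly_in B A z f)"

text \<open>
  \<open>\<iota>\<close> embeds \<open>A/\<alpha>A\<close> in its fraction field \<open>K\<close>. The condition says that the image of \<open>g\<close> generates
  the extension to \<open>K[z]\<close> of the image of \<open>I1\<close>.
\<close>

definition I1_generator ::
    "('a, 'b) ring_scheme \<Rightarrow> ('a, 'b) ring_scheme \<Rightarrow> 'a \<Rightarrow> 'a \<Rightarrow>
     ('c, 'd) ring_scheme \<Rightarrow> ('a set \<Rightarrow> 'c) \<Rightarrow> 'a \<Rightarrow> bool"
  where "I1_generator B A \<alpha> z K \<iota> g \<longleftrightarrow>
    g \<in> I1 B A \<alpha> z \<and>
    Idl\<^bsub>poly_ring K\<^esub> ((\<lambda>f. map \<iota> (bar_poly B A \<alpha> z f)) ` I1 B A \<alpha> z)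
      = PIdl\<^bsub>poly_ring K\<^esub> (map \<iota> (bar_poly B A \<alpha> z g))"

end

theory Submission
  imports Defs
begin

text \<open>Irreducibility makes \<open>\<delta>\<close> induce a nonzero locally nilpotent derivation \<open>\<Delta>\<close> on
  \<open>R = B / \<alpha> B\<close>. Its kernel \<open>C\<close> contains \<open>H = A / \<alpha> A\<close> and has finite rank \<open>m\<close> over it: if \<open>t\<close> lifts a
  local slice of \<open>\<Delta>\<close>, then lifts of the products \<open>c t\<^sup>j\<close> lie in kernels of powers of \<open>\<delta>\<close>, whose rank
  over \<open>A\<close> grows linearly, and a relation over \<open>A\<close> that is not divisible by \<open>\<alpha>\<close> survives in \<open>R\<close>.
  After inverting one nonzero \<open>a \<in> H\<close>, the ring \<open>R\<close> becomes \<open>C[s]\<close> with \<open>C\<close> free of rank \<open>m\<close> over \<open>H\<close>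
  and generated by separable elements. Hence at a closed point with \<open>a \<noteq> 0\<close> the fibre is \<open>C\<^sub>0[s]\<close> for a
  reduced algebra \<open>C\<^sub>0\<close> of dimension \<open>m\<close> over the algebraically closed field, that is,
  \<open>m\<close> affine lines. Finally \<open>\<delta> z \<in> \<alpha> B\<close> puts the class of \<open>z\<close> in \<open>C\<close>, so it satisfies a nontrivial
  relation of degree at most \<open>m\<close> over \<open>H\<close>, which the generator of the ideal of relations divides.\<close>

section \<open>Horner evaluation\<close>

text \<open>The base \<open>H\<close> is in general smaller than the kernel of \<Delta>: an element
  \<open>b\<close> with \<open>\<delta> b\<close> in \<alpha>B need not agree modulo \<alpha> with
  an element of \<open>A\<close>. The degree of this gap is what produces several lines in one
  fibre. The class of \<open>z\<close> may generate only a part of the gap, so its degree bounds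
  \<open>m\<close> from below and need not equal it. The obstacle is to keep the fibre from
  degenerating: after dividing by \<open>MB\<close> the basis must stay independent and the slice
  transcendental. No localization is built for this. Inverting \<open>a\<close> is replaced by
  \<open>saturation\<close>, the set of elements that some power of \<open>a\<close> moves into the
  lattice, and \<open>genideal_subset_saturation\<close> bounds the ideal of the fibre from above by
  the saturated lattice with coefficients in the maximal ideal. Separability comes from
  characteristic 0: a relation whose derivative vanishes as well is replaced by its derivative, and
  \<open>a\<close> is chosen as a multiple of the value of the last derivative. Residue fields at
  closed points are \<open>k\<close> by Zariski's lemma, applied to the affine domain
  \<open>A\<close>.\<close>

text \<open>Coefficient lists are read lowest degree first here, so that evaluation and
  differentiation recurse on the head; \<open>eval_eq_horner\<close> links them to \<^const>\<open>ring.eval\<close>.\<close>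

primrec (in ring) horner :: "'a list \<Rightarrow> 'a \<Rightarrow> 'a" where
  "horner [] x = \<zero>"
| "horner (a # p) x = a \<oplus> x \<otimes> horner p x"

primrec (in ring) horner_deriv :: "'a list \<Rightarrow> 'a \<Rightarrow> 'a" where
  "horner_deriv [] x = \<zero>"
| "horner_deriv (a # p) x = horner p x \<oplus> x \<otimes> horner_deriv p x"

text \<open>The divided difference of the polynomial at \<open>x\<close> and \<open>y\<close>,
  written without division; on the diagonal it is the derivative.\<close>

primrec (in ring) horner_quot :: "'a list \<Rightarrow> 'a \<Rightarrow> 'a \<Rightarrow> 'a" where
  "horner_quot [] x y = \<zero>"
| "horner_quot (a # p) x y = horner p x \<oplus> y \<otimes> horner_quot p x y"

text \<open>The entry at position \<open>i\<close> is multiplied by \<open>n + i\<close>: with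
  \<open>n = 1\<close> on the tail of a list this is the formal derivative. The recursion needs a
  general \<open>n\<close>.\<close>

primrec (in ring) deriv_coeffs :: "nat \<Rightarrow> 'a list \<Rightarrow> 'a list" where
  "deriv_coeffs n [] = []"
| "deriv_coeffs n (a # p) = ([n] \<cdot> a) # deriv_coeffs (Suc n) p"

fun (in ring) list_add :: "'a list \<Rightarrow> 'a list \<Rightarrow> 'a list" where
  "list_add [] q = q"
| "list_add p [] = p"
| "list_add (a # p) (b # q) = (a \<oplus> b) # list_add p q"

lemma (in ring) length_deriv_coeffs [simp]: "length (deriv_coeffs n p) = length p"
  by (induct p arbitrary: n) auto

lemma (in ring) set_list_add:
  assumes "set p \<subseteq> H" "set q \<subseteq> H" "\<And>a b. a \<in> H \<Longrightarrow> b \<in> H \<Longrightarrow> a \<oplus> b \<in> H"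
  shows "set (list_add p q) \<subseteq> H"
  using assms(1,2) by (induct p q rule: list_add.induct) (auto simp: assms(3))

context cring
begin

lemma horner_closed [simp, intro]:
  "set p \<subseteq> carrier R \<Longrightarrow> x \<in> carrier R \<Longrightarrow> horner p x \<in> carrier R"
  by (induct p) auto

lemma horner_deriv_closed [simp, intro]:
  "set p \<subseteq> carrier R \<Longrightarrow> x \<in> carrier R \<Longrightarrow> horner_deriv p x \<in> carrier R"
  by (induct p) auto

lemma horner_quot_closed [simp, intro]:
  "set p \<subseteq> carrier R \<Longrightarrow> x \<in> carrier R \<Longrightarrow> y \<in> carrier R \<Longrightarrow> horner_quot p x y \<in> carrier R"
  by (induct p) auto

lemma horner_in_subring:
  assumes "subring H R" "set p \<subseteq> H" "x \<in> H"
  shows "horner p x \<in> H"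
  using assms(2) by (induct p) (auto simp: subringE[OF assms(1)] assms(3))

lemma deriv_coeffs_in_subring:
  assumes "subring H R" "set p \<subseteq> H"
  shows "set (deriv_coeffs n p) \<subseteq> H"
proof -
  have "[k] \<cdot> a \<in> H" if "a \<in> H" for a and k :: nat
    by (induct k) (use that subringE[OF assms(1)] in auto)
  then show ?thesis
    using assms(2) by (induct p arbitrary: n) auto
qed

lemma horner_append:
  assumes "set p \<subseteq> carrier R" "set q \<subseteq> carrier R" "x \<in> carrier R"
  shows "horner (p @ q) x = horner p x \<oplus> x [^] length p \<otimes> horner q x"
  using assms
proof (induct p)
  case (Cons a p)
  then have [simp]: "a \<in> carrier R" "set p \<subseteq> carrier R" by auto
  have "horner ((a # p) @ q) x = a \<oplus> x \<otimes> (horner p x \<oplus> x [^] length p \<otimes> horner q x)"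
    using Cons by simp
  also have "\<dots> = (a \<oplus> x \<otimes> horner p x) \<oplus> (x [^] length p \<otimes> x) \<otimes> horner q x"
    using Cons.prems by (simp add: r_distr a_assoc m_ac)
  finally show ?case using Cons.prems by simp
qed auto

lemma eval_eq_horner:
  assumes "set p \<subseteq> carrier R" "x \<in> carrier R"
  shows "eval p x = horner (rev p) x"
  using assms
  by (induct p) (auto simp: horner_append m_comm a_comm)

lemma horner_list_add:
  assumes "set p \<subseteq> carrier R" "set q \<subseteq> carrier R" "x \<in> carrier R"
  shows "horner (list_add p q) x = horner p x \<oplus> horner q x"
  using assms
proof (induct p q rule: list_add.induct)
  case (3 a p b q)
  then have [simp]: "a \<in> carrier R" "b \<in> carrier R" "horner p x \<in> carrier R" "horner q x \<in> carrier R" by auto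
  have "horner (list_add (a # p) (b # q)) x = (a \<oplus> b) \<oplus> x \<otimes> (horner p x \<oplus> horner q x)"
    using 3 by simp
  also have "\<dots> = (a \<oplus> x \<otimes> horner p x) \<oplus> (b \<oplus> x \<otimes> horner q x)"
    using 3(4) by (simp add: r_distr a_ac)
  finally show ?case by simp
qed auto

lemma horner_smult:
  assumes "set p \<subseteq> carrier R" "c \<in> carrier R" "x \<in> carrier R"
  shows "horner (map ((\<otimes>) c) p) x = c \<otimes> horner p x"
  using assms by (induct p) (auto simp: r_distr m_ac)

lemma horner_zeros:
  assumes "set p \<subseteq> {\<zero>}" "x \<in> carrier R"
  shows "horner p x = \<zero>"
  using assms by (induct p) auto

lemma horner_combine:
  assumes "set p \<subseteq> carrier R" "x \<in> carrier R"
  shows "horner p x = combine p (map (\<lambda>i. x [^] i) [0..<length p])"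
  using assms
proof (induct p rule: rev_induct)
  case (snoc a p)
  have *: "set (map (\<lambda>i. x [^] i) [0..<length p]) \<subseteq> carrier R" for p :: "'a list"
    using snoc.prems by auto
  from snoc show ?case
    using combine_append[of p "map (\<lambda>i. x [^] i) [0..<length p]" "[a]" "[x [^] length p]"] *
    by (simp add: horner_append m_comm)
qed auto

lemma horner_deriv_coeffs:
  assumes "set p \<subseteq> carrier R" "x \<in> carrier R"
  shows "horner (deriv_coeffs n p) x = [n] \<cdot> horner p x \<oplus> x \<otimes> horner_deriv p x"
  using assms
proof (induct p arbitrary: n)
  case (Cons a p)
  then have [simp]: "a \<in> carrier R" "set p \<subseteq> carrier R" "x \<in> carrier R" by auto
  have "horner (deriv_coeffs n (a # p)) x =
      [n] \<cdot> a \<oplus> x \<otimes> (([n] \<cdot> horner p x \<oplus> horner p x) \<oplus> x \<otimes> horner_deriv p x)"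
    using Cons by simp
  also have "\<dots> = ([n] \<cdot> a \<oplus> [n] \<cdot> (x \<otimes> horner p x)) \<oplus> x \<otimes> (horner p x \<oplus> x \<otimes> horner_deriv p x)"
    by (simp add: r_distr a_ac add_pow_rdistr)
  also have "\<dots> = [n] \<cdot> (a \<oplus> x \<otimes> horner p x) \<oplus> x \<otimes> (horner p x \<oplus> x \<otimes> horner_deriv p x)"
    by (simp add: add.nat_pow_distrib)
  finally show ?case by simp
qed auto

lemma horner_deriv_coeffs_1:
  assumes "set (a # p) \<subseteq> carrier R" "x \<in> carrier R"
  shows "horner (deriv_coeffs 1 p) x = horner_deriv (a # p) x"
  using horner_deriv_coeffs[of p x 1] assms by simp

lemma horner_diff:
  assumes "set p \<subseteq> carrier R" "x \<in> carrier R" "y \<in> carrier R"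
  shows "horner p x \<ominus> horner p y = (x \<ominus> y) \<otimes> horner_quot p x y"
  using assms
proof (induct p)
  case (Cons a p)
  then have [simp]: "a \<in> carrier R" "set p \<subseteq> carrier R" "x \<in> carrier R" "y \<in> carrier R" by auto
  have 1: "horner p x \<in> carrier R" "horner p y \<in> carrier R" by auto
  have "horner (a # p) x \<ominus> horner (a # p) y = x \<otimes> horner p x \<ominus> y \<otimes> horner p y"
    using 1 by (simp add: minus_eq minus_add a_ac r_neg1 r_neg2)
  also have "\<dots> = (x \<ominus> y) \<otimes> horner p x \<oplus> y \<otimes> (horner p x \<ominus> horner p y)"
    using 1 by (simp add: minus_eq l_distr r_distr a_ac r_neg1 r_neg2 l_minus r_minus)
  also have "\<dots> = (x \<ominus> y) \<otimes> horner p x \<oplus> y \<otimes> ((x \<ominus> y) \<otimes> horner_quot p x y)"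
    using Cons by simp
  also have "\<dots> = (x \<ominus> y) \<otimes> horner_quot (a # p) x y"
    by (simp add: r_distr m_ac)
  finally show ?case .
qed auto

text \<open>Multiplication by \<open>x\<close> and by \<open>y\<close> agree on the multiples of
  \<open>v\<close>, hence so do all polynomials in them, and the divided difference takes its
  diagonal value, the derivative. With \<open>y\<close> a constant this computes with an eigenvector
  \<open>v\<close>.\<close>

lemma horner_eigen:
  assumes p: "set p \<subseteq> carrier R" and [simp]: "x \<in> carrier R" "y \<in> carrier R" "v \<in> carrier R"
    and e: "x \<otimes> v = y \<otimes> v"
  shows "horner p x \<otimes> v = horner p y \<otimes> v"
    and "horner_deriv p x \<otimes> v = horner_deriv p y \<otimes> v"
    and "horner_quot p x y \<otimes> v = horner_deriv p y \<otimes> v"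
proof -
  have "horner p x \<otimes> v = horner p y \<otimes> v \<and> horner_deriv p x \<otimes> v = horner_deriv p y \<otimes> v
     \<and> horner_quot p x y \<otimes> v = horner_deriv p y \<otimes> v"
    using p
  proof (induct p)
    case (Cons a p)
    then have [simp]: "a \<in> carrier R" "set p \<subseteq> carrier R" by auto
    have swap: "(x \<otimes> w) \<otimes> v = y \<otimes> (w \<otimes> v)" if "w \<in> carrier R" for w
      using that e by (metis assms(2-4) m_assoc m_lcomm m_closed)
    have IH: "horner p x \<otimes> v = horner p y \<otimes> v" "horner_deriv p x \<otimes> v = horner_deriv p y \<otimes> v"
      "horner_quot p x y \<otimes> v = horner_deriv p y \<otimes> v"
      using Cons by auto
    show ?case
      by (simp add: l_distr swap IH) (simp add: m_assoc IH)
  qed auto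
  then show "horner p x \<otimes> v = horner p y \<otimes> v"
    and "horner_deriv p x \<otimes> v = horner_deriv p y \<otimes> v"
    and "horner_quot p x y \<otimes> v = horner_deriv p y \<otimes> v" by auto
qed

lemma combine_l_mult_right:
  assumes "set ks \<subseteq> carrier R" "set us \<subseteq> carrier R" "c \<in> carrier R"
  shows "combine ks (map ((\<otimes>) c) us) = c \<otimes> combine ks us"
  using assms by (induct ks us rule: combine.induct) (auto simp: r_distr m_ac)

end

context ring_hom_cring
begin

lemma horner_hom:
  assumes "set p \<subseteq> carrier R" "x \<in> carrier R"
  shows "h (R.horner p x) = S.horner (map h p) (h x)"
  using assms by (induct p) auto

lemma horner_deriv_hom:
  assumes "set p \<subseteq> carrier R" "x \<in> carrier R"
  shows "h (R.horner_deriv p x) = S.horner_deriv (map h p) (h x)"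
  using assms by (induct p) (auto simp: horner_hom)

text \<open>Mapping coefficients may produce leading zeros, so \<open>map h p\<close> need not be a
  polynomial in the normalized sense of the library. Since \<open>eval\<close> does not see the
  difference, the facts about normalized images can be brought in.\<close>

lemma map_eval_hom:
  assumes "x \<in> carrier S"
  shows "(\<lambda>p. S.eval (map h p) x) \<in> ring_hom (poly_ring R) S"
proof -
  have H: "ring_hom_ring R S h"
    by (simp add: R.ring_axioms S.ring_axioms ring_hom_ringI2 homh)
  have sub: "set p \<subseteq> carrier R" if "p \<in> carrier (poly_ring R)" for p
    using that R.polynomial_incl by (simp add: univ_poly_carrier[symmetric])
  have sub': "set (map h p) \<subseteq> carrier S" if "p \<in> carrier (poly_ring R)" for p
    using sub[OF that] by auto
  show ?thesis
  proof (rule ring_hom_memI)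
    fix p assume "p \<in> carrier (poly_ring R)"
    then show "S.eval (map h p) x \<in> carrier S"
      using assms S.eval_in_carrier sub' by blast
  next
    fix p q assume p: "p \<in> carrier (poly_ring R)" and q: "q \<in> carrier (poly_ring R)"
    have "S.eval (map h (R.poly_mult p q)) x = S.eval (S.normalize (map h (R.poly_mult p q))) x"
      using R.poly_mult_in_carrier[OF sub[OF p] sub[OF q]] assms
      by (intro S.eval_normalize[symmetric]) auto
    also have "\<dots> = S.eval (map h p) x \<otimes>\<^bsub>S\<^esub> S.eval (map h q) x"
      using ring_hom_ring.poly_mult_hom'[OF H sub[OF p] sub[OF q]] S.eval_poly_mult[OF sub'[OF p] sub'[OF q] assms] by simp
    finally show "S.eval (map h (p \<otimes>\<^bsub>poly_ring R\<^esub> q)) x = S.eval (map h p) x \<otimes>\<^bsub>S\<^esub> S.eval (map h q) x"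
      by (simp add: univ_poly_mult)
    have "S.eval (map h (R.poly_add p q)) x = S.eval (S.normalize (map h (R.poly_add p q))) x"
      using R.poly_add_in_carrier[OF sub[OF p] sub[OF q]] assms
      by (intro S.eval_normalize[symmetric]) auto
    also have "\<dots> = S.eval (map h p) x \<oplus>\<^bsub>S\<^esub> S.eval (map h q) x"
      using ring_hom_ring.poly_add_hom'[OF H sub[OF p] sub[OF q]] S.eval_poly_add[OF sub'[OF p] sub'[OF q] assms] by simp
    finally show "S.eval (map h (p \<oplus>\<^bsub>poly_ring R\<^esub> q)) x = S.eval (map h p) x \<oplus>\<^bsub>S\<^esub> S.eval (map h q) x"
      by (simp add: univ_poly_add)
  next
    show "S.eval (map h \<one>\<^bsub>poly_ring R\<^esub>) x = \<one>\<^bsub>S\<^esub>"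
      using assms by (simp add: univ_poly_one)
  qed
qed

end

section \<open>Products of polynomial rings\<close>

lemma RDirProd_list_Cons_ops:
  assumes "a \<in> carrier R" "b \<in> carrier R"
    and "as \<in> carrier (RDirProd_list Rs)" "bs \<in> carrier (RDirProd_list Rs)"
  shows "(a # as) \<otimes>\<^bsub>RDirProd_list (R # Rs)\<^esub> (b # bs)
           = (a \<otimes>\<^bsub>R\<^esub> b) # (as \<otimes>\<^bsub>RDirProd_list Rs\<^esub> bs)"
    and "(a # as) \<oplus>\<^bsub>RDirProd_list (R # Rs)\<^esub> (b # bs)
           = (a \<oplus>\<^bsub>R\<^esub> b) # (as \<oplus>\<^bsub>RDirProd_list Rs\<^esub> bs)"
proof -
  have c: "(a, as) \<in> carrier (RDirProd R (RDirProd_list Rs))" "(b, bs) \<in> carrier (RDirProd R (RDirProd_list Rs))"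
    using assms by (auto simp: RDirProd_carrier)
  show "(a # as) \<otimes>\<^bsub>RDirProd_list (R # Rs)\<^esub> (b # bs) = (a \<otimes>\<^bsub>R\<^esub> b) # (as \<otimes>\<^bsub>RDirProd_list Rs\<^esub> bs)"
    using ring_hom_mult[OF RDirProd_list_hom1 c] by (simp add: RDirProd_def DirProd_def monoid.defs)
  show "(a # as) \<oplus>\<^bsub>RDirProd_list (R # Rs)\<^esub> (b # bs) = (a \<oplus>\<^bsub>R\<^esub> b) # (as \<oplus>\<^bsub>RDirProd_list Rs\<^esub> bs)"
    using ring_hom_add[OF RDirProd_list_hom1 c] by (simp add: RDirProd_def DirProd_def monoid.defs)
qed

lemma RDirProd_list_replicate_carrier:
  "as \<in> carrier (RDirProd_list (replicate n R)) \<longleftrightarrow> length as = n \<and> set as \<subseteq> carrier R"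
proof
  assume "as \<in> carrier (RDirProd_list (replicate n R))"
  from RDirProd_list_carrier_mem[OF this] show "length as = n \<and> set as \<subseteq> carrier R"
    by (auto simp: in_set_conv_nth)
qed (auto intro!: RDirProd_list_carrier_memI simp: subset_iff)

lemma RDirProd_list_replicate_ops:
  assumes "as \<in> carrier (RDirProd_list (replicate n R))" "bs \<in> carrier (RDirProd_list (replicate n R))"
  shows "as \<otimes>\<^bsub>RDirProd_list (replicate n R)\<^esub> bs = map2 (monoid.mult R) as bs"
    and "as \<oplus>\<^bsub>RDirProd_list (replicate n R)\<^esub> bs = map2 (ring.add R) as bs"
proof -
  have "as \<otimes>\<^bsub>RDirProd_list (replicate n R)\<^esub> bs = map2 (monoid.mult R) as bs
      \<and> as \<oplus>\<^bsub>RDirProd_list (replicate n R)\<^esub> bs = map2 (ring.add R) as bs"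
    using assms
  proof (induct n arbitrary: as bs)
    case 0
    then show ?case by (simp add: monoid.defs)
  next
    case (Suc n)
    then obtain a as' b bs' where [simp]: "as = a # as'" "bs = b # bs'"
      unfolding RDirProd_list_replicate_carrier length_Suc_conv by auto
    have c: "as' \<in> carrier (RDirProd_list (replicate n R))" "bs' \<in> carrier (RDirProd_list (replicate n R))"
        "a \<in> carrier R" "b \<in> carrier R"
      using Suc.prems unfolding RDirProd_list_replicate_carrier by auto
    show ?case
      using RDirProd_list_Cons_ops[OF c(3,4,1,2)] Suc.hyps[OF c(1,2)] by simp
  qed
  then show "as \<otimes>\<^bsub>RDirProd_list (replicate n R)\<^esub> bs = map2 (monoid.mult R) as bs"
    and "as \<oplus>\<^bsub>RDirProd_list (replicate n R)\<^esub> bs = map2 (ring.add R) as bs" by auto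
qed

lemma RDirProd_list_replicate_one:
  "\<one>\<^bsub>RDirProd_list (replicate n R)\<^esub> = replicate n \<one>\<^bsub>R\<^esub>"
  "\<zero>\<^bsub>RDirProd_list (replicate n R)\<^esub> = replicate n \<zero>\<^bsub>R\<^esub>"
  unfolding RDirProd_list_one RDirProd_list_zero by (induct n) auto

section \<open>Orthogonal idempotents\<close>

context cring
begin

definition orthogonal_list :: "'a list \<Rightarrow> bool" where
  "orthogonal_list us \<longleftrightarrow> set us \<subseteq> carrier R \<and> distinct us \<and> (\<forall>u\<in>set us. u \<otimes> u = u)
     \<and> (\<forall>u\<in>set us. \<forall>v\<in>set us. u \<noteq> v \<longrightarrow> u \<otimes> v = \<zero>)"

lemma combine_mult_zero:
  assumes "set ks \<subseteq> carrier R" "set us \<subseteq> carrier R" "v \<in> carrier R" "\<And>u. u \<in> set us \<Longrightarrow> u \<otimes> v = \<zero>"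
  shows "combine ks us \<otimes> v = \<zero>"
  using assms by (induct ks us rule: combine.induct) (auto simp: l_distr m_assoc)

lemma combine_orthogonal_nth:
  assumes "orthogonal_list us" "set ks \<subseteq> carrier R" "length ks = length us" "i < length us"
  shows "combine ks us \<otimes> us ! i = ks ! i \<otimes> us ! i"
  using assms(3,1,2,4)
proof (induct ks us arbitrary: i rule: list_induct2)
  case (Cons k ks u us)
  then have [simp]: "k \<in> carrier R" "u \<in> carrier R" "set ks \<subseteq> carrier R" "set us \<subseteq> carrier R" "u \<notin> set us" "u \<otimes> u = u"
    and o: "orthogonal_list us" by (auto simp: orthogonal_list_def)
  show ?case
  proof (cases i)
    case 0
    have "combine ks us \<otimes> u = \<zero>"
      using Cons.prems by (intro combine_mult_zero) (auto simp: orthogonal_list_def)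
    with 0 show ?thesis by (simp add: l_distr m_assoc)
  next
    case (Suc j)
    then have j: "us ! j \<in> set us" "j < length us" using Cons.prems by auto
    then have [simp]: "us ! j \<in> carrier R" using \<open>set us \<subseteq> carrier R\<close> by blast
    have "u \<otimes> us ! j = \<zero>"
      using Cons.prems j(1) \<open>u \<notin> set us\<close> unfolding orthogonal_list_def by (metis list.set_intros)
    moreover have "ks ! j \<in> carrier R"
      using \<open>set ks \<subseteq> carrier R\<close> j(2) Cons.hyps(1) by (metis nth_mem subsetD)
    ultimately show ?thesis
      using Suc Cons.hyps(2)[OF o _ j(2)] by (simp add: l_distr m_assoc)
  qed
qed auto

lemma combine_orthogonal_mult:
  assumes "orthogonal_list us" "set ks \<subseteq> carrier R" "set ls \<subseteq> carrier R" "length ks = length us" "length ls = length us"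
  shows "combine ks us \<otimes> combine ls us = combine (map2 (\<otimes>) ks ls) us"
  using assms(4) assms(5)[symmetric] assms(1-3)
proof (induct ks us ls rule: list_induct3)
  case (Cons k ks u us l ls)
  then have [simp]: "k \<in> carrier R" "l \<in> carrier R" "u \<in> carrier R" "set ks \<subseteq> carrier R" "set ls \<subseteq> carrier R" "set us \<subseteq> carrier R"
      "u \<otimes> u = u"
    and o: "orthogonal_list us" by (auto simp: orthogonal_list_def)
  have z: "combine ks us \<otimes> u = \<zero>" "combine ls us \<otimes> u = \<zero>"
    using Cons.prems by (intro combine_mult_zero; auto simp: orthogonal_list_def)+
  have "(k \<otimes> u \<oplus> combine ks us) \<otimes> (l \<otimes> u \<oplus> combine ls us)
      = (k \<otimes> l) \<otimes> (u \<otimes> u) \<oplus> (k \<otimes> (combine ls us \<otimes> u) \<oplus> (l \<otimes> (combine ks us \<otimes> u) \<oplus> combine ks us \<otimes> combine ls us))"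
    by (simp add: l_distr r_distr m_ac a_ac del: \<open>u \<otimes> u = u\<close>)
  moreover have "combine (map2 (\<otimes>) ks ls) us = combine ks us \<otimes> combine ls us"
    using Cons.hyps o by simp
  ultimately show ?case by (simp add: z)
qed auto

text \<open>If \<open>u\<close> were a combination of the other idempotents, multiplication by
  \<open>u\<close> would give \<open>u = u \<otimes> u = \<zero>\<close>.\<close>

lemma orthogonal_list_independent:
  assumes K: "subfield K R" and "orthogonal_list us" "\<zero> \<notin> set us"
  shows "independent K us"
  using assms(2,3)
proof (induct us)
  case (Cons u us)
  then have o: "orthogonal_list us" and [simp]: "u \<in> carrier R" "set us \<subseteq> carrier R" "u \<otimes> u = u" "u \<noteq> \<zero>"
    by (auto simp: orthogonal_list_def)
  have "u \<notin> Span K us"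
  proof
    assume "u \<in> Span K us"
    then obtain ks where ks: "set ks \<subseteq> K" "u = combine ks us"
      using Span_mem_iff_length_version[OF K] by auto
    moreover have "combine ks us \<otimes> u = \<zero>"
      using Cons.prems ks subfieldE(3)[OF K] by (intro combine_mult_zero) (auto simp: orthogonal_list_def)
    ultimately show False using \<open>u \<otimes> u = u\<close> \<open>u \<noteq> \<zero>\<close> by simp
  qed
  then show ?case using Cons o by (auto intro: li_Cons)
qed auto

lemma horner_quot_in_subring:
  assumes "subring H R" "set p \<subseteq> H" "x \<in> H" "y \<in> H"
  shows "horner_quot p x y \<in> H"
  using assms(2) by (induct p) (auto simp: subringE[OF assms(1)] assms horner_in_subring)

end

section \<open>Separable algebras over an algebraically closed field\<close>

locale closed_field_hom = S?: cring S + k: algebraically_closed k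
  for S :: "('r, 's) ring_scheme" (structure) and k :: "('f, 'g) ring_scheme" +
  fixes \<sigma> :: "'f \<Rightarrow> 'r"
  assumes hom: "\<sigma> \<in> ring_hom k S"
begin

sublocale \<sigma>: ring_hom_cring k S \<sigma>
  by unfold_locales (rule hom)

lemma \<sigma>_cancel:
  assumes "c \<in> carrier k" "x \<in> carrier S" "\<sigma> c \<otimes> x = \<zero>" "x \<noteq> \<zero>"
  shows "c = \<zero>\<^bsub>k\<^esub>"
proof (rule ccontr)
  assume "c \<noteq> \<zero>\<^bsub>k\<^esub>"
  then have u: "c \<in> Units k" using assms(1) k.field_Units by auto
  have "x = \<sigma> (inv\<^bsub>k\<^esub> c \<otimes>\<^bsub>k\<^esub> c) \<otimes> x"
    unfolding k.Units_l_inv[OF u] using assms by simp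
  also have "\<dots> = \<sigma> (inv\<^bsub>k\<^esub> c) \<otimes> (\<sigma> c \<otimes> x)"
    using u assms(1,2) by (subst \<sigma>.hom_mult) (simp_all add: m_assoc)
  also have "\<dots> = \<zero>"
    using u assms(3) by simp
  finally show False using assms(4) by simp
qed

abbreviation "poly_at \<equiv> \<lambda>x p. eval (map \<sigma> p) x"

text \<open>Roots of \<open>p\<close> are split off one at a time: either the cofactor still
  annihilates \<open>v\<close>, or it carries \<open>v\<close> to an eigenvector for the root. The
  eigenvector is asked for among the multiples of \<open>v\<close>: with \<open>v\<close> an
  idempotent this confines it to one component, with \<open>v = 1\<close> in a field it makes
  \<open>f\<close> itself a scalar.\<close>

lemma exists_eigenvector:
  assumes f: "f \<in> carrier S"
  shows "\<lbrakk> p \<in> carrier (poly_ring k); p \<noteq> []; v \<in> carrier S; v \<noteq> \<zero>; poly_at f p \<otimes> v = \<zero> \<rbrakk> \<Longrightarrow>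
    \<exists>c\<in>carrier k. \<exists>w\<in>carrier S. w \<otimes> v \<noteq> \<zero> \<and> f \<otimes> (w \<otimes> v) = \<sigma> c \<otimes> (w \<otimes> v)"
proof (induct "length p" arbitrary: p rule: less_induct)
  case less
  note evh = \<sigma>.map_eval_hom[OF f]
  show ?case
  proof (cases "degree p = 0")
    case True
    with less.prems(2) obtain a where p: "p = [a]" by (cases p) auto
    then have "a \<in> carrier k" "a \<noteq> \<zero>\<^bsub>k\<^esub>"
      using less.prems(1) by (auto simp: univ_poly_carrier[symmetric] polynomial_def)
    moreover have "poly_at f p = \<sigma> a"
      using p f \<open>a \<in> carrier k\<close> by simp
    ultimately show ?thesis
      using \<sigma>_cancel[of a v] less.prems by simp
  next
    case False
    then have "size (k.roots p) \<noteq> 0"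
      using k.roots_over_carrier[OF less.prems(1)] by (simp add: k.splitted_def)
    then have "k.roots p \<noteq> {#}" by auto
    from k.not_empty_rootsE[OF less.prems(1) this] obtain a where
      a: "a \<in> carrier k" "[\<one>\<^bsub>k\<^esub>, \<ominus>\<^bsub>k\<^esub> a] \<in> carrier (poly_ring k)" "[\<one>\<^bsub>k\<^esub>, \<ominus>\<^bsub>k\<^esub> a] pdivides\<^bsub>k\<^esub> p"
      by metis
    then obtain r where r: "r \<in> carrier (poly_ring k)" "p = [\<one>\<^bsub>k\<^esub>, \<ominus>\<^bsub>k\<^esub> a] \<otimes>\<^bsub>poly_ring k\<^esub> r"
      unfolding pdivides_def factor_def by auto
    have rn: "r \<noteq> []"
      using r(2) less.prems(2) k.poly_mult_zero(2)[of "[\<one>\<^bsub>k\<^esub>, \<ominus>\<^bsub>k\<^esub> a]"] a(1) by (auto simp: univ_poly_mult)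
    have "degree p = degree [\<one>\<^bsub>k\<^esub>, \<ominus>\<^bsub>k\<^esub> a] + degree r"
      using k.poly_mult_degree_eq[OF k.carrier_is_subring, of "[\<one>\<^bsub>k\<^esub>, \<ominus>\<^bsub>k\<^esub> a]" r] a(2) r rn
      by (simp add: univ_poly_mult univ_poly_carrier)
    then have len: "length r < length p" using rn by (cases r) auto
    have rc: "poly_at f r \<in> carrier S" using ring_hom_closed[OF evh r(1)] .
    have "poly_at f [\<one>\<^bsub>k\<^esub>, \<ominus>\<^bsub>k\<^esub> a] = f \<oplus> \<ominus> \<sigma> a"
      using a(1) f by simp
    then have fac: "poly_at f p = (f \<ominus> \<sigma> a) \<otimes> poly_at f r"
      using ring_hom_mult[OF evh a(2) r(1)] r(2) by (simp add: minus_eq)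
    show ?thesis
    proof (cases "poly_at f r \<otimes> v = \<zero>")
      case True
      then show ?thesis using less.hyps[OF len r(1) rn less.prems(3,4)] by blast
    next
      case nz: False
      have "(f \<ominus> \<sigma> a) \<otimes> (poly_at f r \<otimes> v) = \<zero>"
        using less.prems fac f a rc by (simp add: m_assoc)
      then have "f \<otimes> (poly_at f r \<otimes> v) = \<sigma> a \<otimes> (poly_at f r \<otimes> v)"
        using f a rc less.prems(3)
        by (metis \<sigma>.hom_closed l_distr m_closed minus_eq l_minus r_right_minus_eq S.a_inv_closed)
      then show ?thesis using a(1) rc nz by blast
    qed
  qed
qed

end

text \<open>\<open>C\<close> is a finite-dimensional \<open>k\<close>-algebra with basis \<open>es\<close>, and \<open>S\<close> is a polynomial ring in
  \<open>s\<close> over \<open>C\<close>. The basis elements are separable over \<open>k\<close>, which forces \<open>C\<close> to be a power of \<open>k\<close>.\<close>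

locale separable_fibre = closed_field_hom S k \<sigma>
  for S :: "('r, 's) ring_scheme" (structure) and k :: "('f, 'g) ring_scheme" and \<sigma> :: "'f \<Rightarrow> 'r" +
  fixes C :: "'r set" and es :: "'r list" and s :: 'r
  assumes one_neq: "\<one> \<noteq> \<zero>"
    and C_subring: "subring C S"
    and C_span: "C = Span (\<sigma> ` carrier k) es"
    and es_indep: "independent (\<sigma> ` carrier k) es"
    and s_closed: "s \<in> carrier S"
    and gen: "x \<in> carrier S \<Longrightarrow> \<exists>ws. set ws \<subseteq> C \<and> x = horner ws s"
    and free: "set ws \<subseteq> C \<Longrightarrow> horner ws s = \<zero> \<Longrightarrow> set ws \<subseteq> {\<zero>}"
    and separable: "e \<in> set es \<Longrightarrow> \<exists>hs. set hs \<subseteq> carrier k \<and> horner (map \<sigma> hs) e = \<zero>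
           \<and> horner_deriv (map \<sigma> hs) e \<in> Units S"
begin

lemmas [simp] = s_closed

abbreviation "K \<equiv> \<sigma> ` carrier k"

lemma K_subfield: "subfield K S"
  using ring_hom_ring.img_is_subfield[OF _ k.carrier_is_subfield one_neq]
    ring_hom_ringI2[OF k.ring_axioms S.ring_axioms hom] by blast

lemma C_carrier: "C \<subseteq> carrier S"
  using subringE(1)[OF C_subring] .

lemma es_carrier: "set es \<subseteq> carrier S"
  using independent_in_carrier[OF es_indep] .

lemma es_C: "set es \<subseteq> C"
  using Span_base_incl[OF K_subfield es_carrier] C_span by simp

lemma \<sigma>_C: assumes "c \<in> carrier k" shows "\<sigma> c \<in> C"
proof -
  have "\<sigma> c \<otimes> \<one> \<in> Span K es"
    using Span_smult_closed[OF K_subfield es_carrier] subringE(3)[OF C_subring] assms C_span by blast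
  then show ?thesis using C_span assms by simp
qed

text \<open>Zero is excluded so that the members are independent over \<open>K\<close>; this bounds
  the cardinality and makes a largest system exist.\<close>

definition "orth E \<longleftrightarrow> finite E \<and> E \<subseteq> C - {\<zero>} \<and> (\<forall>u\<in>E. u \<otimes> u = u)
     \<and> (\<forall>u\<in>E. \<forall>v\<in>E. u \<noteq> v \<longrightarrow> u \<otimes> v = \<zero>)"

lemma orth_list:
  assumes "orth (set us)" "distinct us"
  shows "orthogonal_list us" "\<zero> \<notin> set us"
  using assms C_carrier unfolding orth_def orthogonal_list_def by auto

lemma dim_C: "dimension (length es) K C"
  using dimensionI[OF K_subfield es_indep] C_span by simp

lemma orth_card: assumes "orth E" shows "card E \<le> length es"
proof -
  obtain us where us: "set us = E" "distinct us"
    using finite_distinct_list assms unfolding orth_def by metis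
  have "independent K us"
    using orthogonal_list_independent[OF K_subfield orth_list] us assms by auto
  then have "length us \<le> length es"
    using independent_length_le_dimension[OF K_subfield dim_C] us(1) assms by (auto simp: orth_def)
  then show ?thesis using us distinct_card by force
qed

end

context separable_fibre
begin

text \<open>The Peirce splitting of \<open>e\<close> along an idempotent below it. The larger system
  will contradict maximality.\<close>

lemma orth_split:
  assumes E: "orth E" and e: "e \<in> E" and u: "u \<in> C" "u \<otimes> u = u" "u \<otimes> e = u" "u \<noteq> \<zero>" "u \<noteq> e"
  shows "orth (insert u (insert (e \<ominus> u) (E - {e})))" "card (insert u (insert (e \<ominus> u) (E - {e}))) = Suc (card E)"
proof -
  define v where "v = e \<ominus> u"
  have [simp]: "u \<in> carrier S" "e \<in> carrier S" and eC: "e \<in> C" and ee: "e \<otimes> e = e"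
    using u(1) e E C_carrier by (auto simp: orth_def)
  have ue: "e \<otimes> u = u" using u(3) by (simp add: m_comm)
  have vC: "v \<in> C" using eC u(1) subringE[OF C_subring] by (simp add: v_def minus_eq)
  have [simp]: "v \<in> carrier S" by (simp add: v_def)
  have uv: "u \<otimes> v = \<zero>" "v \<otimes> u = \<zero>" "v \<otimes> v = v" "v \<otimes> e = v"
    unfolding v_def minus_eq by (simp_all add: l_distr r_distr l_minus r_minus ue u ee r_neg l_neg)
  have v0: "v \<noteq> \<zero>" using u(5) by (simp add: v_def r_right_minus_eq)
  have other: "w \<otimes> u = \<zero> \<and> u \<otimes> w = \<zero> \<and> w \<otimes> v = \<zero> \<and> v \<otimes> w = \<zero>" if w: "w \<in> E - {e}" for w
  proof -
    have [simp]: "w \<in> carrier S" and we: "e \<otimes> w = \<zero>" using w e E C_carrier by (auto simp: orth_def)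
    have "u \<otimes> w = (u \<otimes> e) \<otimes> w" using u by simp
    then have 1: "u \<otimes> w = \<zero>" using we by (simp add: m_assoc)
    have "v \<otimes> w = (v \<otimes> e) \<otimes> w" using uv by simp
    then have 2: "v \<otimes> w = \<zero>" using we by (simp add: m_assoc)
    from 1 2 show ?thesis by (simp add: m_comm)
  qed
  have "u \<notin> E - {e}" "v \<notin> E - {e}" "u \<noteq> v"
    using other u(2,4) uv v0 by force+
  then have nin: "u \<notin> insert v (E - {e})" "v \<notin> E - {e}" by auto
  have fin: "finite E" using E by (simp add: orth_def)
  have "card (insert u (insert v (E - {e}))) = Suc (Suc (card (E - {e})))"
    using nin fin by simp
  then show "card (insert u (insert (e \<ominus> u) (E - {e}))) = Suc (card E)"
    using card_Suc_Diff1[OF fin e] by (simp add: v_def)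
  have "orth (insert u (insert v (E - {e})))"
    unfolding orth_def using E fin u vC v0 uv other
    by (auto simp: orth_def)
  then show "orth (insert u (insert (e \<ominus> u) (E - {e})))" by (simp add: v_def)
qed

text \<open>A system of maximal cardinality is complete, since one minus its sum could be added, and
  each member is primitive. Primitivity makes a basis element \<open>f\<close> act on
  \<open>e\<close> as a scalar: an eigenvalue \<open>c\<close> of \<open>f\<close> on
  \<open>e\<close> yields an idempotent below \<open>e\<close> on which \<open>f\<close> equals
  \<open>c\<close>, and this must be all of \<open>e\<close>. The idempotent is the Lagrange factor
  h(f)/(f - c) divided by h'(c), for the separable relation h, multiplied by
  \<open>e\<close>.\<close>

lemma exists_split_idempotents:
  "\<exists>us. orthogonal_list us \<and> \<zero> \<notin> set us \<and> set us \<subseteq> C \<and> combine (replicate (length us) \<one>) us = \<one>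
     \<and> (\<forall>f\<in>set es. \<forall>e\<in>set us. \<exists>c\<in>carrier k. f \<otimes> e = \<sigma> c \<otimes> e)"
proof -
  define N where "N = card ` {E. orth E}"
  have "finite N" unfolding N_def
    by (rule finite_subset[of _ "{..length es}"]) (use orth_card in auto)
  moreover have "orth {}" by (simp add: orth_def)
  then have "N \<noteq> {}" by (auto simp: N_def)
  ultimately have "Max N \<in> N" "\<And>n. n \<in> N \<Longrightarrow> n \<le> Max N" by auto
  then obtain E where E: "orth E" and max: "\<And>E'. orth E' \<Longrightarrow> card E' \<le> card E"
    by (auto simp: N_def)
  obtain us where us: "set us = E" "distinct us"
    using finite_distinct_list E unfolding orth_def by metis
  have ol: "orthogonal_list us" "\<zero> \<notin> set us" using orth_list us E by auto
  have usC: "set us \<subseteq> C" using us E by (auto simp: orth_def)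
  have usc [simp]: "set us \<subseteq> carrier S" using usC C_carrier by auto
  have us_el: "e \<in> carrier S" if "e \<in> set us" for e using that usc by blast
  have [simp]: "set (replicate n \<one>) \<subseteq> carrier S" for n by auto
  have one: "combine (replicate (length us) \<one>) us = \<one>"
  proof (rule ccontr)
    assume neq: "combine (replicate (length us) \<one>) us \<noteq> \<one>"
    define t where "t = combine (replicate (length us) \<one>) us"
    have tc [simp]: "t \<in> carrier S" by (simp add: t_def)
    have tC: "t \<in> C"
    proof -
      have "combine (replicate (length vs) \<one>) vs \<in> C" if "set vs \<subseteq> C" for vs
        using that subringE[OF C_subring] C_carrier by (induct vs) (auto simp: subset_iff)
      then show ?thesis using usC by (simp add: t_def)
    qed
    define u where "u = \<one> \<ominus> t"
    have uc [simp]: "u \<in> carrier S" by (simp add: u_def)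
    have uC: "u \<in> C" using tC subringE[OF C_subring] by (simp add: u_def minus_eq)
    have u0: "u \<noteq> \<zero>" using neq by (simp add: u_def t_def[symmetric] r_right_minus_eq)
    have uz: "e \<otimes> u = \<zero>" "u \<otimes> e = \<zero>" if e: "e \<in> E" for e
    proof -
      have [simp]: "e \<in> carrier S" using e us us_el by auto
      obtain i where i: "i < length us" "e = us ! i" using e us by (metis in_set_conv_nth)
      have "t \<otimes> e = e"
        using combine_orthogonal_nth[OF ol(1) _ _ i(1), of "replicate (length us) \<one>"] i \<open>e \<in> carrier S\<close> by (simp add: t_def)
      then show "u \<otimes> e = \<zero>" by (simp add: u_def minus_eq l_distr l_minus r_neg)
      then show "e \<otimes> u = \<zero>" by (simp add: m_comm)
    qed
    have "t \<otimes> u = \<zero>" unfolding t_def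
      by (rule combine_mult_zero) (use uz us us_el in auto)
    then have uu: "u \<otimes> u = u"
    proof -
      assume z: "t \<otimes> u = \<zero>"
      have "u \<otimes> u = (\<one> \<ominus> t) \<otimes> u" by (simp add: u_def)
      also have "\<dots> = u" using z by (simp add: minus_eq l_distr l_minus)
      finally show ?thesis .
    qed
    have "u \<notin> E" using uz(1)[of u] uu u0 by auto
    moreover have "orth (insert u E)"
      using E uC u0 uu uz by (auto simp: orth_def)
    ultimately show False using max[of "insert u E"] E by (auto simp: orth_def)
  qed
  have "\<exists>c\<in>carrier k. f \<otimes> e = \<sigma> c \<otimes> e" if f: "f \<in> set es" and e: "e \<in> E" for f e
  proof -
    have fC: "f \<in> C" and fc [simp]: "f \<in> carrier S" using f es_C es_carrier by auto
    have eC: "e \<in> C" and ec [simp]: "e \<in> carrier S" and e0: "e \<noteq> \<zero>" and ee: "e \<otimes> e = e"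
      using e E C_carrier by (auto simp: orth_def)
    obtain hs where hs: "set hs \<subseteq> carrier k" "horner (map \<sigma> hs) f = \<zero>" "horner_deriv (map \<sigma> hs) f \<in> Units S"
      using separable[OF f] by blast
    have hc [simp]: "set (map \<sigma> hs) \<subseteq> carrier S" using hs(1) by auto
    define p where "p = k.normalize (rev hs)"
    have p: "p \<in> carrier (poly_ring k)"
      using k.normalize_gives_polynomial[of "rev hs"] hs(1) by (simp add: p_def univ_poly_carrier)
    obtain n where hz: "rev hs = replicate n \<zero>\<^bsub>k\<^esub> @ p"
      unfolding p_def using k.normalize_def'[of "rev hs"] by metis
    have pc: "set p \<subseteq> carrier k" using p k.polynomial_incl by (simp add: univ_poly_carrier[symmetric])
    then have pc': "set (map \<sigma> p) \<subseteq> carrier S" by auto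
    have "poly_at f p = eval (map \<sigma> (rev hs)) f"
      unfolding hz using eval_replicate[OF pc' fc, of n] by simp
    also have "\<dots> = \<zero>"
      using eval_eq_horner[of "map \<sigma> (rev hs)" f] hs hc by (simp add: rev_map)
    finally have pz: "poly_at f p = \<zero>" .
    have "p \<noteq> []"
    proof
      assume "p = []"
      then have "set (rev hs) \<subseteq> {\<zero>\<^bsub>k\<^esub>}" using hz by auto
      then have "set hs \<subseteq> {\<zero>\<^bsub>k\<^esub>}" by simp
      then have "horner_deriv (map \<sigma> hs) f = \<zero>"
      proof (induct hs)
        case (Cons a hs)
        have "set (map \<sigma> hs) \<subseteq> {\<zero>}" using Cons.prems by auto
        then show ?case using Cons horner_zeros[of "map \<sigma> hs" f] by simp
      qed simp
      then have "\<zero> \<in> Units S" using hs(3) by simp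
      then show False using one_neq by (metis Units_r_inv Units_inv_closed l_null)
    qed
    obtain c w where c: "c \<in> carrier k" and w: "w \<in> carrier S" "w \<otimes> e \<noteq> \<zero>" "f \<otimes> (w \<otimes> e) = \<sigma> c \<otimes> (w \<otimes> e)"
      using exists_eigenvector[OF fc p \<open>p \<noteq> []\<close> ec e0] pz by auto
    define x where "x = w \<otimes> e"
    have x: "x \<in> carrier S" "x \<noteq> \<zero>" "f \<otimes> x = \<sigma> c \<otimes> x" "e \<otimes> x = x"
      using w ee m_lcomm[of e w e] by (auto simp: x_def)
    note [simp] = x(1) c
    have \<sigma>h: "horner (map \<sigma> hs) (\<sigma> c) = \<sigma> (k.horner hs c)"
      "horner_deriv (map \<sigma> hs) (\<sigma> c) = \<sigma> (k.horner_deriv hs c)"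
      using \<sigma>.horner_hom[OF hs(1) c] \<sigma>.horner_deriv_hom[OF hs(1) c] by auto
    have kc [simp]: "k.horner hs c \<in> carrier k" "k.horner_deriv hs c \<in> carrier k" using hs(1) by auto
    have "\<sigma> (k.horner hs c) \<otimes> x = \<zero>"
      using horner_eigen(1)[OF hc fc _ x(1,3)] hs(2) \<sigma>h by simp
    then have root: "k.horner hs c = \<zero>\<^bsub>k\<^esub>" using \<sigma>_cancel[OF kc(1) x(1) _ x(2)] by blast
    \<comment> \<open>As h vanishes at \<open>f\<close> and at \<open>c\<close>, this divided
      difference is annihilated by f - c. By \<open>horner_eigen\<close> it acts on
      \<open>x\<close>, and on itself, as the scalar \<open>d\<close>, the derivative of h at
      \<open>c\<close>.\<close>
    define G where "G = horner_quot (map \<sigma> hs) f (\<sigma> c)"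
    have GC: "G \<in> C" unfolding G_def
      by (rule horner_quot_in_subring[OF C_subring]) (use hs(1) fC \<sigma>_C in auto)
    then have [simp]: "G \<in> carrier S" using C_carrier by auto
    define d where "d = k.horner_deriv hs c"
    have [simp]: "d \<in> carrier k" by (simp add: d_def)
    have fG: "(f \<ominus> \<sigma> c) \<otimes> G = \<zero>"
      using horner_diff[OF hc fc, of "\<sigma> c"] \<sigma>h root hs(2) by (simp add: G_def minus_eq)
    have fG': "f \<otimes> G = \<sigma> c \<otimes> G"
      using fG by (simp add: minus_eq l_distr l_minus) (metis \<open>G \<in> carrier S\<close> c fc \<sigma>.hom_closed m_closed minus_eq r_right_minus_eq)
    have Gx: "G \<otimes> x = \<sigma> d \<otimes> x"
      using horner_eigen(3)[OF hc fc _ x(1,3)] \<sigma>h by (simp add: G_def d_def)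
    have GG: "G \<otimes> G = \<sigma> d \<otimes> G"
      using horner_eigen(3)[OF hc fc _ \<open>G \<in> carrier S\<close> fG'] \<sigma>h by (simp add: G_def d_def)
    \<comment> \<open>Separability enters here: if \<open>d\<close> were zero, the unit
      \<open>horner_deriv (map \<sigma> hs) f\<close> would annihilate \<open>x\<close>.\<close>
    have d0: "d \<noteq> \<zero>\<^bsub>k\<^esub>"
    proof
      assume "d = \<zero>\<^bsub>k\<^esub>"
      then have "horner_deriv (map \<sigma> hs) f \<otimes> x = \<zero>"
        using horner_eigen(2)[OF hc fc _ x(1,3)] \<sigma>h by (simp add: d_def)
      then show False using hs(3) x by (metis Units_closed Units_inv_closed Units_l_inv l_one m_assoc r_null)
    qed
    then have dU: "d \<in> Units k" using k.field_Units by auto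
    define i where "i = inv\<^bsub>k\<^esub> d"
    have [simp]: "i \<in> carrier k" using dU by (simp add: i_def)
    have "\<sigma> i \<otimes> \<sigma> d = \<sigma> (i \<otimes>\<^bsub>k\<^esub> d)" by simp
    then have id: "\<sigma> i \<otimes> \<sigma> d = \<one>" using dU by (simp add: i_def)
    \<comment> \<open>\<open>G\<close> divided by \<open>d\<close> projects onto the part where
      \<open>f\<close> equals \<open>c\<close>; the factor \<open>e\<close> keeps it below
      \<open>e\<close>. It is nonzero because it fixes \<open>x\<close>.\<close>
    define u where "u = \<sigma> i \<otimes> (G \<otimes> e)"
    have uC: "u \<in> C" using GC eC \<sigma>_C subringE[OF C_subring] by (simp add: u_def)
    have ue: "u \<otimes> e = u" using ee by (simp add: u_def m_assoc)
    have "u \<otimes> u = \<sigma> i \<otimes> (\<sigma> i \<otimes> ((G \<otimes> G) \<otimes> (e \<otimes> e)))"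
      by (simp add: u_def m_ac del: ee)
    also have "\<dots> = (\<sigma> i \<otimes> \<sigma> d) \<otimes> u" by (simp add: u_def GG ee m_ac)
    finally have uu: "u \<otimes> u = u" using id by (simp add: u_def)
    have "u \<otimes> x = \<sigma> i \<otimes> (G \<otimes> (e \<otimes> x))" by (simp add: u_def m_assoc)
    also have "\<dots> = (\<sigma> i \<otimes> \<sigma> d) \<otimes> x" by (simp add: x(4) Gx m_assoc)
    finally have "u \<otimes> x = x" using id by simp
    then have u0: "u \<noteq> \<zero>" using x by auto
    have "u = e"
    proof (rule ccontr)
      assume "u \<noteq> e"
      from orth_split[OF E e uC uu ue u0 this] max show False by (metis Suc_n_not_le_n)
    qed
    moreover have "f \<otimes> u = \<sigma> c \<otimes> u"
    proof -
      have "f \<otimes> u = \<sigma> i \<otimes> ((f \<otimes> G) \<otimes> e)" by (simp add: u_def m_ac)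
      also have "\<dots> = \<sigma> c \<otimes> u" by (simp add: fG' u_def m_ac)
      finally show ?thesis .
    qed
    ultimately show ?thesis using c by auto
  qed
  then show ?thesis using ol usC one us by blast
qed

text \<open>The tuple of polynomials p_i is sent to the sum of the p_i(s) u_i over the split
  idempotents u_i. Orthogonality makes this multiplicative, completeness makes it unital, and the
  required isomorphism is its inverse.\<close>

theorem disjoint_union_of_lines:
  "disjoint_union_of_affine_lines k \<sigma> S (length es)"
proof -
  obtain us where ol: "orthogonal_list us" "\<zero> \<notin> set us" and usC: "set us \<subseteq> C"
    and one: "combine (replicate (length us) \<one>) us = \<one>"
    and eig: "\<And>f e. f \<in> set es \<Longrightarrow> e \<in> set us \<Longrightarrow> \<exists>c\<in>carrier k. f \<otimes> e = \<sigma> c \<otimes> e"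
    using exists_split_idempotents by blast
  have usc [simp]: "set us \<subseteq> carrier S" using usC C_carrier by auto
  have us_el: "e \<in> carrier S" if "e \<in> set us" for e using that usc by blast
  have [simp]: "set (replicate n \<one>) \<subseteq> carrier S" for n by auto
  have ind: "independent K us" using orthogonal_list_independent[OF K_subfield ol] .
  have eigC: "\<exists>c\<in>carrier k. x \<otimes> e = \<sigma> c \<otimes> e" if x: "x \<in> C" and e: "e \<in> set us" for x e
  proof -
    have [simp]: "e \<in> carrier S" using e us_el by auto
    obtain ks where ks: "set ks \<subseteq> K" "x = combine ks es"
      using x C_span Span_mem_iff_length_version[OF K_subfield es_carrier] by auto
    have "\<exists>c\<in>carrier k. combine ks fs \<otimes> e = \<sigma> c \<otimes> e" if "set fs \<subseteq> set es" for fs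
      using ks(1) that
    proof (induct ks fs rule: combine.induct)
      case (1 a ks f fs)
      obtain a' where a': "a = \<sigma> a'" "a' \<in> carrier k" using 1 by auto
      obtain c where c: "c \<in> carrier k" "combine ks fs \<otimes> e = \<sigma> c \<otimes> e" using 1 by auto
      obtain b where b: "b \<in> carrier k" "f \<otimes> e = \<sigma> b \<otimes> e" using eig[of f e] e 1 by auto
      have [simp]: "f \<in> carrier S" "combine ks fs \<in> carrier S"
        using 1(2,3) es_carrier by (auto intro!: combine_in_carrier)
      have "combine (a # ks) (f # fs) \<otimes> e = \<sigma> a' \<otimes> (f \<otimes> e) \<oplus> combine ks fs \<otimes> e"
        using a' by (simp add: l_distr m_assoc)
      also have "\<dots> = \<sigma> (a' \<otimes>\<^bsub>k\<^esub> b \<oplus>\<^bsub>k\<^esub> c) \<otimes> e"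
        using a' b c by (simp add: l_distr m_assoc)
      finally show ?case using a' b c by blast
    qed (auto intro!: bexI[of _ "\<zero>\<^bsub>k\<^esub>"])
    then show ?thesis using ks by blast
  qed
  \<comment> \<open>Multiplying \<open>x\<close> into the decomposition of 1 gives its coordinates,
    because \<open>x\<close> acts on each idempotent as a constant.\<close>
  have expand: "\<exists>cs. set cs \<subseteq> carrier k \<and> length cs = length us \<and> x = combine (map \<sigma> cs) us" if x: "x \<in> C" for x
  proof -
    have [simp]: "x \<in> carrier S" using x C_carrier by auto
    have "\<exists>cs. set cs \<subseteq> carrier k \<and> length cs = length vs \<and> combine (replicate (length vs) \<one>) vs \<otimes> x = combine (map \<sigma> cs) vs"
      if "set vs \<subseteq> set us" for vs
      using that
    proof (induct vs)
      case (Cons v vs)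
      obtain c where c: "c \<in> carrier k" "x \<otimes> v = \<sigma> c \<otimes> v" using eigC[OF x, of v] Cons by auto
      obtain cs where cs: "set cs \<subseteq> carrier k" "length cs = length vs" "combine (replicate (length vs) \<one>) vs \<otimes> x = combine (map \<sigma> cs) vs"
        using Cons by auto
      have [simp]: "v \<in> carrier S" "set vs \<subseteq> carrier S" using Cons us_el by auto
      have "combine (replicate (length (v # vs)) \<one>) (v # vs) \<otimes> x = combine (map \<sigma> (c # cs)) (v # vs)"
        using c cs m_comm[of v x] by (simp add: l_distr)
      then show ?case using c cs by (intro exI[of _ "c # cs"]) auto
    qed simp
    then show ?thesis using one by fastforce
  qed
  \<comment> \<open>Both lists are bases of \<open>C\<close>, which turns the number of idempotents
    into \<open>length es\<close>.\<close>
  have "Span K us = C"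
  proof
    show "Span K us \<subseteq> C"
    proof
      fix x assume "x \<in> Span K us"
      then obtain ks where ks: "set ks \<subseteq> K" "x = combine ks us"
        using Span_mem_iff_length_version[OF K_subfield usc] by auto
      have "set ks \<subseteq> C" using ks(1) \<sigma>_C by auto
      then have "combine ks us \<in> C" using usC
        by (induct ks us rule: combine.induct) (use subringE[OF C_subring] in auto)
      then show "x \<in> C" using ks by simp
    qed
    show "C \<subseteq> Span K us"
    proof
      fix x assume "x \<in> C"
      from expand[OF this] obtain cs where cs: "set cs \<subseteq> carrier k" "length cs = length us" "x = combine (map \<sigma> cs) us" by blast
      then have "set (map \<sigma> cs) \<subseteq> K" "length (map \<sigma> cs) = length us" by auto
      then show "x \<in> Span K us"
        unfolding Span_mem_iff_length_version[OF K_subfield usc] using cs(3) by blast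
    qed
  qed
  then have len: "length us = length es"
    using dimension_is_inj[OF K_subfield dimensionI[OF K_subfield ind] dim_C] by simp
  define P where "P = RDirProd_list (replicate (length us) (poly_ring k))"
  define \<psi> where "\<psi> ps = combine (map (poly_at s) ps) us" for ps
  note evh = \<sigma>.map_eval_hom[OF s_closed]
  have P_carrier: "ps \<in> carrier P \<longleftrightarrow> length ps = length us \<and> set ps \<subseteq> carrier (poly_ring k)" for ps
    unfolding P_def by (rule RDirProd_list_replicate_carrier)
  interpret Pr: ring "poly_ring k" using k.univ_poly_is_ring[OF k.carrier_is_subring] .
  have Pring: "ring P" unfolding P_def
    by (rule RDirProd_list_is_ring) (simp add: Pr.ring_axioms)
  interpret P: ring P by (rule Pring)
  have evc: "set (map (poly_at s) ps) \<subseteq> carrier S" if "ps \<in> carrier P" for ps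
    using that ring_hom_closed[OF evh] by (auto simp: P_carrier)
  have hom\<psi>: "\<psi> \<in> ring_hom P S"
  proof (rule ring_hom_memI)
    fix ps assume ps: "ps \<in> carrier P"
    show "\<psi> ps \<in> carrier S" using evc[OF ps] by (auto simp: \<psi>_def)
    fix qs assume qs: "qs \<in> carrier P"
    have l: "length ps = length us" "length qs = length us" using ps qs by (auto simp: P_carrier)
    have m2: "map (poly_at s) (map2 f ps qs) = map2 g (map (poly_at s) ps) (map (poly_at s) qs)"
      if "\<And>p q. p \<in> carrier (poly_ring k) \<Longrightarrow> q \<in> carrier (poly_ring k) \<Longrightarrow> poly_at s (f p q) = g (poly_at s p) (poly_at s q)" for f g
      using that ps qs unfolding P_carrier
      by (intro nth_equalityI) (auto simp: subset_iff)
    show "\<psi> (ps \<otimes>\<^bsub>P\<^esub> qs) = \<psi> ps \<otimes> \<psi> qs"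
      using RDirProd_list_replicate_ops(1)[OF ps[unfolded P_def] qs[unfolded P_def]]
        combine_orthogonal_mult[OF ol(1) evc[OF ps] evc[OF qs]] l
        m2[of "monoid.mult (poly_ring k)" "(\<otimes>)"] ring_hom_mult[OF evh]
      by (simp add: \<psi>_def P_def)
    show "\<psi> (ps \<oplus>\<^bsub>P\<^esub> qs) = \<psi> ps \<oplus> \<psi> qs"
      using RDirProd_list_replicate_ops(2)[OF ps[unfolded P_def] qs[unfolded P_def]]
        combine_add[OF _ _ evc[OF ps] evc[OF qs] usc] l
        m2[of "ring.add (poly_ring k)" "(\<oplus>)"] ring_hom_add[OF evh]
      by (simp add: \<psi>_def P_def)
  next
    show "\<psi> \<one>\<^bsub>P\<^esub> = \<one>"
      using ring_hom_one[OF evh] one by (simp add: \<psi>_def P_def RDirProd_list_replicate_one)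
  qed
  interpret \<psi>: ring_hom_ring P S \<psi>
    by (rule ring_hom_ringI2[OF Pring S.ring_axioms hom\<psi>])
  have surj: "\<psi> ` carrier P = carrier S"
  proof
    show "\<psi> ` carrier P \<subseteq> carrier S" by auto
    show "carrier S \<subseteq> \<psi> ` carrier P"
    proof
      fix x assume "x \<in> carrier S"
      then obtain ws where ws: "set ws \<subseteq> C" "x = horner ws s" using gen by blast
      have constC: "\<exists>ps\<in>carrier P. \<psi> ps = c" if c: "c \<in> C" for c
      proof -
        obtain cs where cs: "set cs \<subseteq> carrier k" "length cs = length us" "c = combine (map \<sigma> cs) us"
          using expand[OF c] by blast
        have pc: "k.poly_of_const a \<in> carrier (poly_ring k)" if "a \<in> carrier k" for a
          using that by (simp add: k.poly_of_const_def univ_poly_carrier[symmetric] polynomial_def)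
        have "poly_at s (k.poly_of_const a) = \<sigma> a" if "a \<in> carrier k" for a
          using that by (simp add: k.poly_of_const_def)
        then have "map (poly_at s) (map k.poly_of_const cs) = map \<sigma> cs"
          using cs(1) by auto
        then have "\<psi> (map k.poly_of_const cs) = c" unfolding \<psi>_def using cs(3) by (simp only:)
        moreover have "map k.poly_of_const cs \<in> carrier P" using cs(1,2) pc by (auto simp: P_carrier)
        ultimately show ?thesis by blast
      qed
      have "s = combine (replicate (length us) s) us"
        using combine_r_distr[of "replicate (length us) \<one>" us s] one by (simp add: map_replicate)
      moreover have "poly_at s (X\<^bsub>k\<^esub>) = s" by (simp add: var_def)
      ultimately have sP: "\<psi> (replicate (length us) (X\<^bsub>k\<^esub>)) = s" by (simp add: \<psi>_def map_replicate)
      have sP': "replicate (length us) (X\<^bsub>k\<^esub>) \<in> carrier P"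
        using k.var_closed(1)[OF k.carrier_is_subring] by (auto simp: P_carrier)
      have "\<exists>ps\<in>carrier P. \<psi> ps = horner ws s" using ws(1)
      proof (induct ws)
        case Nil
        then show ?case using \<psi>.hom_zero by (intro bexI[of _ "\<zero>\<^bsub>P\<^esub>"]) auto
      next
        case (Cons w ws)
        then obtain ps qs where p: "ps \<in> carrier P" "\<psi> ps = horner ws s" "qs \<in> carrier P" "\<psi> qs = w"
          using constC[of w] by auto
        have "\<psi> (qs \<oplus>\<^bsub>P\<^esub> (replicate (length us) (X\<^bsub>k\<^esub>)) \<otimes>\<^bsub>P\<^esub> ps) = horner (w # ws) s"
          using p sP sP' by simp
        then show ?case using p sP' by blast
      qed
      then show "x \<in> \<psi> ` carrier P" using ws(2) by (metis imageI)
    qed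
  qed
  have inj: "inj_on \<psi> (carrier P)"
  proof (rule \<psi>.trivial_ker_imp_inj)
    have "ps = \<zero>\<^bsub>P\<^esub>" if ps: "ps \<in> carrier P" and z: "\<psi> ps = \<zero>" for ps
    proof -
      \<comment> \<open>Multiplication by the idempotent at \<open>i\<close> isolates the polynomial
        at \<open>i\<close>; freeness of \<open>s\<close> over \<open>C\<close> then kills each of
        its coefficients.\<close>
      have "ps ! i = []" if i: "i < length us" for i
      proof -
        define p where "p = ps ! i"
        have ui: "us ! i \<in> set us" using i by simp
        then have uc [simp]: "us ! i \<in> carrier S" and uC: "us ! i \<in> C" and u0: "us ! i \<noteq> \<zero>" using us_el usC ol(2) by auto
        have pP: "p \<in> carrier (poly_ring k)" using ps i by (auto simp: P_carrier p_def subset_iff)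
        have pc: "set p \<subseteq> carrier k" using pP k.polynomial_incl by (simp add: univ_poly_carrier[symmetric])
        then have pc' [simp]: "set (map \<sigma> p) \<subseteq> carrier S" by auto
        have "poly_at s p \<otimes> us ! i = \<zero>"
          using combine_orthogonal_nth[OF ol(1) evc[OF ps] _ i] ps i z by (simp add: \<psi>_def P_carrier p_def)
        then have "us ! i \<otimes> horner (rev (map \<sigma> p)) s = \<zero>"
          using eval_eq_horner[OF pc' s_closed] eval_in_carrier[OF pc' s_closed] by (simp add: m_comm)
        then have "horner (map ((\<otimes>) (us ! i)) (rev (map \<sigma> p))) s = \<zero>"
          using horner_smult[of "rev (map \<sigma> p)" "us ! i" s] pc' by simp
        moreover have "set (map ((\<otimes>) (us ! i)) (rev (map \<sigma> p))) \<subseteq> C"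
          using uC pc \<sigma>_C subringE(6)[OF C_subring] by auto
        ultimately have "set (map ((\<otimes>) (us ! i)) (rev (map \<sigma> p))) \<subseteq> {\<zero>}" using free by blast
        then have uz: "us ! i \<otimes> \<sigma> c = \<zero>" if "c \<in> set p" for c
          using that by (simp add: image_subset_iff)
        have "\<sigma> c \<otimes> us ! i = \<zero>" if "c \<in> set p" for c
          using uz[OF that] that pc m_comm[of "\<sigma> c" "us ! i"] by auto
        then have "c = \<zero>\<^bsub>k\<^esub>" if "c \<in> set p" for c
          using that pc \<sigma>_cancel[of c "us ! i"] u0 by auto
        then have "p = []"
          using pP by (cases p) (auto simp: univ_poly_carrier[symmetric] polynomial_def)
        then show ?thesis by (simp add: p_def)
      qed
      then have "ps = replicate (length us) []"
        using ps by (intro replicate_eqI) (auto simp: P_carrier in_set_conv_nth)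
      then show ?thesis
        by (simp add: P_def RDirProd_list_replicate_one univ_poly_zero)
    qed
    then show "a_kernel P S \<psi> = {\<zero>\<^bsub>P\<^esub>}"
      unfolding a_kernel_def' using P.zero_closed \<psi>.hom_zero by blast
  qed
  have iso: "\<psi> \<in> ring_iso P S"
    using inj surj hom\<psi> by (simp add: ring_iso_def bij_betw_def)
  define \<phi> where "\<phi> = inv_into (carrier P) \<psi>"
  have "\<phi> \<in> ring_iso S P" unfolding \<phi>_def by (rule ring_iso_set_sym[OF Pring iso])
  moreover have "\<phi> (\<sigma> c) = replicate (length us) (k.poly_of_const c)" if c: "c \<in> carrier k" for c
  proof -
    have 1: "k.poly_of_const c \<in> carrier (poly_ring k)"
      using c by (simp add: k.poly_of_const_def univ_poly_carrier[symmetric] polynomial_def)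
    have "poly_at s (k.poly_of_const c) = \<sigma> c" using c by (simp add: k.poly_of_const_def)
    then have "\<psi> (replicate (length us) (k.poly_of_const c)) = \<sigma> c"
      using combine_r_distr[of "replicate (length us) \<one>" us "\<sigma> c"] one c by (simp add: \<psi>_def map_replicate)
    moreover have "replicate (length us) (k.poly_of_const c) \<in> carrier P"
      using 1 by (auto simp: P_carrier)
    ultimately show ?thesis
      unfolding \<phi>_def using inv_into_f_f[OF inj] by metis
  qed
  ultimately show ?thesis
    unfolding disjoint_union_of_affine_lines_def P_def len by blast
qed

end

section \<open>Locally nilpotent derivations of domains\<close>

text \<open>Defined through relations: over a subring that is not a field an element may lie outside
  the span of the others and still be related to them, so the inductive \<open>independent\<close>
  of the library would be too weak.\<close>

definition (in ring) indep_over :: "'a set \<Rightarrow> 'a list \<Rightarrow> bool" where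
  "indep_over H us \<longleftrightarrow> set us \<subseteq> carrier R \<and>
     (\<forall>as. set as \<subseteq> H \<and> length as = length us \<and> combine as us = \<zero> \<longrightarrow> set as \<subseteq> {\<zero>})"

text \<open>Serves both \<open>B\<close> with \<delta> and its reduction modulo \<alpha>, so no
  ground field appears; characteristic 0 is asked of the ring itself.\<close>

locale lnd_domain = domain R for R (structure) +
  fixes D :: "'a \<Rightarrow> 'a"
  assumes D_closed [simp, intro]: "x \<in> carrier R \<Longrightarrow> D x \<in> carrier R"
    and D_add: "x \<in> carrier R \<Longrightarrow> y \<in> carrier R \<Longrightarrow> D (x \<oplus> y) = D x \<oplus> D y"
    and D_mult: "x \<in> carrier R \<Longrightarrow> y \<in> carrier R \<Longrightarrow> D (x \<otimes> y) = x \<otimes> D y \<oplus> y \<otimes> D x"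
    and D_nilpotent: "x \<in> carrier R \<Longrightarrow> \<exists>n. (D ^^ n) x = \<zero>"
    and char0: "0 < (n::nat) \<Longrightarrow> [n] \<cdot> \<one> \<noteq> \<zero>"
begin

lemma natmult_eq_zero:
  assumes "0 < (n::nat)" "x \<in> carrier R" "[n] \<cdot> x = \<zero>"
  shows "x = \<zero>"
proof -
  have "([n] \<cdot> \<one>) \<otimes> x = \<zero>"
    using assms add_pow_ldistr[of \<one> x n] by simp
  then show ?thesis using char0[OF assms(1)] assms(2) by (simp add: integral_iff)
qed

lemma deriv_coeffs_zero:
  assumes "set p \<subseteq> carrier R" "0 < n" "set (deriv_coeffs n p) \<subseteq> {\<zero>}"
  shows "set p \<subseteq> {\<zero>}"
  using assms by (induct p arbitrary: n) (auto dest: natmult_eq_zero)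

lemma D_zero [simp]: "D \<zero> = \<zero>"
  using D_add[of \<zero> \<zero>] by (metis D_closed add.l_cancel_one' l_zero zero_closed)

lemma D_one [simp]: "D \<one> = \<zero>"
  using D_mult[of \<one> \<one>] by (metis D_closed add.l_cancel_one' l_one one_closed)

lemma D_minus: assumes "x \<in> carrier R" shows "D (\<ominus> x) = \<ominus> D x"
proof -
  have "D (\<ominus> x) \<oplus> D x = \<zero>"
    using D_add[of "\<ominus> x" x] assms by (simp add: l_neg)
  then show ?thesis using assms by (metis D_closed a_inv_closed minus_equality)
qed

definition Ker :: "'a set" where "Ker = {x \<in> carrier R. D x = \<zero>}"

lemma KerD [dest]: "x \<in> Ker \<Longrightarrow> x \<in> carrier R" "x \<in> Ker \<Longrightarrow> D x = \<zero>"
  by (auto simp: Ker_def)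

lemma Ker_carrier: "Ker \<subseteq> carrier R"
  by (auto simp: Ker_def)

lemma Ker_subring: "subring Ker R"
  by (rule subringI) (auto simp: Ker_def D_minus D_add D_mult)

lemma Dn_closed [simp, intro]: "x \<in> carrier R \<Longrightarrow> (D ^^ n) x \<in> carrier R"
  by (induct n) auto

lemma Dn_add: "x \<in> carrier R \<Longrightarrow> y \<in> carrier R \<Longrightarrow> (D ^^ n) (x \<oplus> y) = (D ^^ n) x \<oplus> (D ^^ n) y"
  by (induct n) (auto simp: D_add)

lemma Dn_minus: "x \<in> carrier R \<Longrightarrow> (D ^^ n) (\<ominus> x) = \<ominus> (D ^^ n) x"
  by (induct n) (auto simp: D_minus)

lemma Dn_zero [simp]: "(D ^^ n) \<zero> = \<zero>"
  by (induct n) auto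

lemma Dn_Ker_mult: "c \<in> Ker \<Longrightarrow> x \<in> carrier R \<Longrightarrow> (D ^^ n) (c \<otimes> x) = c \<otimes> (D ^^ n) x"
  by (induct n) (auto simp: D_mult Ker_def)

lemma Dn_Suc: "(D ^^ Suc n) x = (D ^^ n) (D x)"
  by (simp add: funpow_swap1)

lemma Dn_mono:
  assumes "(D ^^ a) x = \<zero>" "a \<le> b"
  shows "(D ^^ b) x = \<zero>"
proof -
  have "(D ^^ b) x = (D ^^ (b - a)) ((D ^^ a) x)"
    using assms(2) by (metis comp_apply funpow_add le_add_diff_inverse2)
  then show ?thesis using assms(1) by simp
qed

text \<open>The Leibniz rule splits \<open>D (x \<otimes> y)\<close> into two products whose total
  exponent has dropped by one. For positive \<open>a\<close> and \<open>b\<close> the exponent is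
  one above the sharp value; it avoids a subtraction and suffices for the growth estimate.\<close>

lemma Dn_mult_zero:
  assumes "x \<in> carrier R" "y \<in> carrier R" "(D ^^ a) x = \<zero>" "(D ^^ b) y = \<zero>"
  shows "(D ^^ (a + b)) (x \<otimes> y) = \<zero>"
  using assms
proof (induct "a + b" arbitrary: a b x y)
  case (Suc n)
  show ?case
  proof (cases "a = 0 \<or> b = 0")
    case True
    then show ?thesis using Suc.prems by auto
  next
    case False
    then obtain a' b' where ab: "a = Suc a'" "b = Suc b'" by (metis not0_implies_Suc)
    have 1: "(D ^^ (a + b')) (x \<otimes> D y) = \<zero>"
      using Suc.hyps(1)[of a b' x "D y"] Suc.hyps(2) Suc.prems ab by (simp add: Dn_Suc del: funpow.simps)
    have 2: "(D ^^ (b + a')) (y \<otimes> D x) = \<zero>"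
      using Suc.hyps(1)[of b a' y "D x"] Suc.hyps(2) Suc.prems ab by (simp add: Dn_Suc del: funpow.simps)
    have e: "a + b = Suc (a + b')" "b + a' = a + b'" using ab by auto
    have "(D ^^ (a + b)) (x \<otimes> y) = (D ^^ (a + b')) (D (x \<otimes> y))"
      unfolding e(1) by (rule Dn_Suc)
    then have "(D ^^ (a + b)) (x \<otimes> y) = (D ^^ (a + b')) (x \<otimes> D y) \<oplus> (D ^^ (b + a')) (y \<otimes> D x)"
      using Suc.prems unfolding e(2) by (simp add: D_mult Dn_add)
    then show ?thesis using 1 2 by simp
  qed
qed auto

text \<open>Only the top term of the iterated Leibniz rule survives. The integer is a binomial
  coefficient, and the sum \<open>n + m\<close> is Pascal's rule; only its positivity is recorded,
  which in characteristic 0 makes it cancellable.\<close>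

lemma Dn_mult_lead:
  assumes "x \<in> carrier R" "y \<in> carrier R" "(D ^^ Suc a) x = \<zero>" "(D ^^ Suc b) y = \<zero>"
  shows "\<exists>n::nat. 0 < n \<and> (D ^^ (a + b)) (x \<otimes> y) = [n] \<cdot> ((D ^^ a) x \<otimes> (D ^^ b) y)"
  using assms
proof (induct "a + b" arbitrary: a b x y rule: less_induct)
  case less
  consider "a = 0" | "b = 0" | a' b' where "a = Suc a'" "b = Suc b'" by (metis not0_implies_Suc)
  then show ?case
  proof cases
    case 1
    then have "x \<in> Ker" using less.prems by (simp add: Ker_def)
    then show ?thesis using 1 less.prems Dn_Ker_mult[of x y b]
      by (intro exI[of _ 1]) auto
  next
    case 2
    then have "y \<in> Ker" using less.prems by (simp add: Ker_def)
    then show ?thesis using 2 less.prems Dn_Ker_mult[of y x a] m_comm[of x y] m_comm[of "(D ^^ a) x" y]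
      by (intro exI[of _ 1]) auto
  next
    case 3
    obtain n :: nat where n: "n > 0" "(D ^^ (a + b')) (x \<otimes> D y) = [n] \<cdot> ((D ^^ a) x \<otimes> (D ^^ b') (D y))"
      using less.hyps[of a b' x "D y"] less.prems 3 by (auto simp: Dn_Suc simp del: funpow.simps)
    obtain m :: nat where m: "m > 0" "(D ^^ (b + a')) (y \<otimes> D x) = [m] \<cdot> ((D ^^ b) y \<otimes> (D ^^ a') (D x))"
      using less.hyps[of b a' y "D x"] less.prems 3 by (auto simp: Dn_Suc simp del: funpow.simps)
    have e: "a + b = Suc (a + b')" "b + a' = a + b'" using 3 by auto
    have "(D ^^ (a + b)) (x \<otimes> y) = (D ^^ (a + b')) (D (x \<otimes> y))"
      unfolding e(1) by (rule Dn_Suc)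
    then have "(D ^^ (a + b)) (x \<otimes> y) = (D ^^ (a + b')) (x \<otimes> D y) \<oplus> (D ^^ (b + a')) (y \<otimes> D x)"
      using less.prems unfolding e(2) by (simp add: D_mult Dn_add)
    also have "\<dots> = [n] \<cdot> ((D ^^ a) x \<otimes> (D ^^ b) y) \<oplus> [m] \<cdot> ((D ^^ a) x \<otimes> (D ^^ b) y)"
      using n(2) m(2) less.prems 3 m_comm[of "(D ^^ b) y" "(D ^^ a) x"] by (simp add: Dn_Suc del: funpow.simps)
    also have "\<dots> = [(n + m)] \<cdot> ((D ^^ a) x \<otimes> (D ^^ b) y)"
      using less.prems by (simp add: add.nat_pow_mult)
    finally show ?thesis using n(1) by (intro exI[of _ "n + m"]) simp
  qed
qed

lemma exists_degree:
  assumes "x \<in> carrier R" "x \<noteq> \<zero>"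
  obtains a where "(D ^^ a) x \<noteq> \<zero>" "(D ^^ Suc a) x = \<zero>"
proof -
  define m where "m = (LEAST n. (D ^^ n) x = \<zero>)"
  have m: "(D ^^ m) x = \<zero>" unfolding m_def by (rule LeastI_ex[OF D_nilpotent[OF assms(1)]])
  then obtain a where a: "m = Suc a" using assms(2) by (cases m) auto
  then have "(D ^^ a) x \<noteq> \<zero>" using not_less_Least[of a "\<lambda>n. (D ^^ n) x = \<zero>"] by (auto simp: m_def)
  then show thesis using that m a by blast
qed

text \<open>By \<open>Dn_mult_lead\<close> nilpotency degrees add under multiplication, so a product
  of degree 0 has factors of degree 0. This carries divisibility from the whole ring to the
  kernel.\<close>

lemma Ker_factorially_closed:
  assumes "x \<in> carrier R" "y \<in> carrier R" "x \<noteq> \<zero>" "y \<noteq> \<zero>" "D (x \<otimes> y) = \<zero>"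
  shows "D x = \<zero>"
proof -
  obtain a where a: "(D ^^ a) x \<noteq> \<zero>" "(D ^^ Suc a) x = \<zero>" using exists_degree assms by blast
  obtain b where b: "(D ^^ b) y \<noteq> \<zero>" "(D ^^ Suc b) y = \<zero>" using exists_degree assms by blast
  obtain n :: nat where n: "n > 0" "(D ^^ (a + b)) (x \<otimes> y) = [n] \<cdot> ((D ^^ a) x \<otimes> (D ^^ b) y)"
    using Dn_mult_lead[OF assms(1,2) a(2) b(2)] by blast
  have "(D ^^ a) x \<otimes> (D ^^ b) y \<noteq> \<zero>" using a b assms by (simp add: integral_iff)
  then have "(D ^^ (a + b)) (x \<otimes> y) \<noteq> \<zero>"
    using n assms natmult_eq_zero by auto
  then have "a + b = 0"
    using Dn_mono[of 1 "x \<otimes> y" "a + b"] assms(5) by (cases "a + b") auto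
  then show ?thesis using a by simp
qed

lemma D_horner:
  assumes "set cs \<subseteq> Ker" "s \<in> carrier R"
  shows "D (horner cs s) = horner_deriv cs s \<otimes> D s"
  using assms(1)
proof (induct cs)
  case (Cons c cs)
  have cs: "set cs \<subseteq> carrier R" using Cons Ker_carrier by auto
  have "D (horner (c # cs) s) = s \<otimes> (horner_deriv cs s \<otimes> D s) \<oplus> horner cs s \<otimes> D s"
    using Cons cs assms by (auto simp: D_add D_mult Ker_def)
  also have "\<dots> = horner_deriv (c # cs) s \<otimes> D s"
    using cs assms by (simp add: l_distr m_assoc a_comm)
  finally show ?case .
qed (use assms in auto)

text \<open>Applying \<open>D\<close> to a relation gives the value of its formal derivative times
  \<open>D s\<close>; cancelling \<open>D s\<close> leaves a shorter relation, whose coefficients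
  vanish by induction. Characteristic 0 then leaves only the constant term, which vanishes
  too.\<close>

lemma transcendental_over_Ker:
  assumes s: "s \<in> carrier R" "D s \<noteq> \<zero>"
  shows "set cs \<subseteq> Ker \<Longrightarrow> horner cs s = \<zero> \<Longrightarrow> set cs \<subseteq> {\<zero>}"
proof (induct "length cs" arbitrary: cs rule: less_induct)
  case less
  show ?case
  proof (cases cs)
    case (Cons c p)
    have cc: "set (c # p) \<subseteq> carrier R" using less.prems Ker_carrier Cons by auto
    have "horner_deriv cs s \<otimes> D s = \<zero>"
      using D_horner[OF less.prems(1) s(1)] less.prems(2) by simp
    then have "horner (deriv_coeffs 1 p) s = \<zero>"
      using s cc by (simp only: horner_deriv_coeffs_1[OF cc s(1)] Cons) (simp add: integral_iff)
    moreover have "set (deriv_coeffs 1 p) \<subseteq> Ker"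
      using less.prems Cons by (intro deriv_coeffs_in_subring[OF Ker_subring]) auto
    ultimately have "set (deriv_coeffs 1 p) \<subseteq> {\<zero>}"
      using less.hyps[of "deriv_coeffs 1 p"] Cons by simp
    then have p0: "set p \<subseteq> {\<zero>}" using deriv_coeffs_zero[of p 1] cc by simp
    then have "c = \<zero>" using less.prems(2) Cons horner_zeros[OF p0 s(1)] cc s by simp
    then show ?thesis using p0 Cons by simp
  qed simp
qed

text \<open>The element in question is n! times the n-th power of \<open>D s\<close>; only the
  properties used in \<open>slice_expansion\<close> are recorded.\<close>

lemma power_lead:
  assumes s: "s \<in> carrier R" "D s \<noteq> \<zero>" "D (D s) = \<zero>"
  shows "(D ^^ n) (s [^] n) \<in> Ker - {\<zero>} \<and> (D ^^ Suc n) (s [^] n) = \<zero>"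
proof (induct n)
  case 0
  then show ?case by (simp add: Ker_def)
next
  case (Suc n)
  have sn: "s [^] n \<in> carrier R" using s by simp
  have 1: "(D ^^ Suc 1) s = \<zero>" using s by simp
  obtain m :: nat where m: "m > 0" "(D ^^ (n + 1)) (s [^] n \<otimes> s) = [m] \<cdot> ((D ^^ n) (s [^] n) \<otimes> (D ^^ 1) s)"
    using Dn_mult_lead[OF sn s(1) _ 1, of n] Suc by blast
  have z: "(D ^^ (Suc n + 2)) (s [^] n \<otimes> s) = \<zero>"
    using Dn_mult_zero[OF sn s(1), of "Suc n" 2] Suc 1 by (simp add: numeral_2_eq_2)
  have "(D ^^ n) (s [^] n) \<otimes> D s \<noteq> \<zero>" using Suc s by (auto simp: integral_iff Ker_def)
  then have nz: "(D ^^ Suc n) (s [^] Suc n) \<noteq> \<zero>"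
    using m natmult_eq_zero[OF m(1)] s by auto
  have "D ([m] \<cdot> ((D ^^ n) (s [^] n) \<otimes> D s)) = \<zero>"
  proof -
    have "(D ^^ n) (s [^] n) \<otimes> D s \<in> Ker" using Suc s subringE(6)[OF Ker_subring] by (auto simp: Ker_def)
    then have "[m] \<cdot> ((D ^^ n) (s [^] n) \<otimes> D s) \<in> Ker"
      by (induct m) (use subringE[OF Ker_subring] in auto)
    then show ?thesis by auto
  qed
  then have "(D ^^ Suc (Suc n)) (s [^] Suc n) = \<zero>" using m(2) by simp
  with nz show ?case using s by (auto simp: Ker_def)
qed

text \<open>The local slice theorem with cleared denominators: once \<open>D s\<close> is inverted,
  the ring is polynomial in \<open>s\<close> over the kernel. The induction on the nilpotency of
  \<open>r\<close> cancels the top power of \<open>s\<close>.\<close>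

lemma slice_expansion:
  assumes s: "s \<in> carrier R" "D s \<noteq> \<zero>" "D (D s) = \<zero>" and r: "r \<in> carrier R"
  shows "\<exists>q\<in>Ker - {\<zero>}. \<exists>cs. set cs \<subseteq> Ker \<and> q \<otimes> r = horner cs s"
proof -
  have "(D ^^ n) r = \<zero> \<Longrightarrow> \<exists>q\<in>Ker - {\<zero>}. \<exists>cs. set cs \<subseteq> Ker \<and> q \<otimes> r = horner cs s" for n
    using r
  proof (induct n arbitrary: r)
    case 0
    then show ?case
      by (intro bexI[of _ \<one>] exI[of _ "[]"]) (auto simp: Ker_def)
  next
    case (Suc n)
    define c where "c = (D ^^ n) r"
    define e where "e = (D ^^ n) (s [^] n)"
    have c: "c \<in> Ker" using Suc by (simp add: c_def Ker_def)
    have e: "e \<in> Ker - {\<zero>}" using power_lead[OF s, of n] by (simp add: e_def)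
    have [simp]: "c \<in> carrier R" "e \<in> carrier R" "r \<in> carrier R" "s \<in> carrier R" using c e Suc s by auto
    \<comment> \<open>\<open>c\<close> and \<open>e\<close> are the top derivatives of
      \<open>r\<close> and of \<open>s [^] n\<close>, so this cross difference is killed by
      \<open>D ^^ n\<close>.\<close>
    define r' where "r' = e \<otimes> r \<ominus> c \<otimes> s [^] n"
    have [simp]: "r' \<in> carrier R" by (simp add: r'_def)
    have "(D ^^ n) r' = e \<otimes> c \<ominus> c \<otimes> e"
      using c e by (simp add: r'_def minus_eq Dn_add Dn_minus Dn_Ker_mult) (simp add: c_def e_def)
    then have "(D ^^ n) r' = \<zero>" by (simp add: m_comm minus_eq r_neg)
    then obtain q cs where q: "q \<in> Ker - {\<zero>}" and cs: "set cs \<subseteq> Ker" "q \<otimes> r' = horner cs s"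
      using Suc.hyps[of r'] by auto
    have [simp]: "q \<in> carrier R" using q by auto
    \<comment> \<open>Puts \<open>q \<otimes> c\<close> back at position \<open>n\<close>, the
      multiple of \<open>s [^] n\<close> that was subtracted.\<close>
    define ds where "ds = list_add cs (replicate n \<zero> @ [q \<otimes> c])"
    have 0: "\<zero> \<in> Ker" "q \<otimes> c \<in> Ker" using subringE[OF Ker_subring] q c by auto
    have "set ds \<subseteq> Ker" unfolding ds_def
      by (rule set_list_add) (use 0 cs subringE(7)[OF Ker_subring] in auto)
    moreover have "(q \<otimes> e) \<otimes> r = horner ds s"
    proof -
      have "horner (replicate n \<zero>) s = \<zero>" by (rule horner_zeros) auto
      then have "horner (replicate n \<zero> @ [q \<otimes> c]) s = s [^] n \<otimes> (q \<otimes> c)"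
        using horner_append[of "replicate n \<zero>" "[q \<otimes> c]" s]
        by (simp add: subset_iff)
      moreover have "horner ds s = horner cs s \<oplus> horner (replicate n \<zero> @ [q \<otimes> c]) s"
        unfolding ds_def using cs Ker_carrier by (intro horner_list_add) auto
      ultimately have "horner ds s = q \<otimes> r' \<oplus> s [^] n \<otimes> (q \<otimes> c)" using cs by simp
      also have "\<dots> = q \<otimes> (r' \<oplus> c \<otimes> s [^] n)" by (simp add: r_distr m_ac)
      also have "r' \<oplus> c \<otimes> s [^] n = e \<otimes> r" by (simp add: r'_def minus_eq a_assoc l_neg)
      finally show ?thesis by (simp add: m_assoc)
    qed
    moreover have "q \<otimes> e \<in> Ker - {\<zero>}"
      using q e subringE(6)[OF Ker_subring] by (auto simp: integral_iff)
    ultimately show ?case by blast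
  qed
  then show ?thesis using D_nilpotent[OF r] by blast
qed

text \<open>Gaussian elimination, with the functional \<open>D ^^ n\<close> playing the role of the last coordinate.\<close>

lemma nilpotent_dependent:
  assumes "set us \<subseteq> carrier R" "\<And>u. u \<in> set us \<Longrightarrow> (D ^^ n) u = \<zero>" "n < length us"
  shows "\<exists>as. set as \<subseteq> Ker \<and> length as = length us \<and> combine as us = \<zero> \<and> \<not> set as \<subseteq> {\<zero>}"
  using assms
proof (induct n arbitrary: us)
  case 0
  then have us: "set us \<subseteq> {\<zero>}" by auto
  have "combine (replicate (length us) \<one>) us = \<zero>"
    using us by (induct us) auto
  then show ?case using 0
    by (intro exI[of _ "replicate (length us) \<one>"]) (auto simp: Ker_def)
next
  case (Suc n)
  show ?case
  proof (cases "\<forall>u\<in>set us. (D ^^ n) u = \<zero>")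
    case True
    then show ?thesis using Suc by auto
  next
    case False
    then obtain x where x: "x \<in> set us" "(D ^^ n) x \<noteq> \<zero>" by blast
    then obtain us1 us2 where us: "us = us1 @ x # us2" by (meson split_list)
    define v where "v = (D ^^ n)"
    have vK: "v u \<in> Ker" if "u \<in> set us" for u using Suc that by (auto simp: v_def Ker_def)
    have c [simp]: "set us1 \<subseteq> carrier R" "set us2 \<subseteq> carrier R" "x \<in> carrier R" "v x \<in> carrier R"
      using Suc us by (auto simp: v_def)
    \<comment> \<open>Elimination with pivot \<open>x\<close>: \<open>f u\<close> is the combination
      of \<open>u\<close> and \<open>x\<close> on which \<open>D ^^ n\<close> vanishes.\<close>
    define f where "f u = v x \<otimes> u \<ominus> v u \<otimes> x" for u
    have f: "f u \<in> carrier R \<and> (D ^^ n) (f u) = \<zero>" if u: "u \<in> set (us1 @ us2)" for u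
    proof -
      have "u \<in> set us" using u us by auto
      then have [simp]: "u \<in> carrier R" using Suc.prems(1) by blast
      then have [simp]: "v u \<in> carrier R" by (simp add: v_def)
      have "(D ^^ n) (f u) = v x \<otimes> v u \<ominus> v u \<otimes> v x"
        using vK[of u] vK[of x] u us by (simp add: f_def minus_eq Dn_add Dn_minus Dn_Ker_mult) (simp add: v_def)
      then show ?thesis by (simp add: m_comm minus_eq r_neg f_def)
    qed
    obtain as where as: "set as \<subseteq> Ker" "length as = length us1 + length us2"
      "combine as (map f (us1 @ us2)) = \<zero>" "\<not> set as \<subseteq> {\<zero>}"
      using Suc.hyps[of "map f (us1 @ us2)"] f Suc.prems(3) us by auto
    have asc: "set as \<subseteq> carrier R" using as Ker_carrier by auto
    have lin: "combine bs (map f ws) = v x \<otimes> combine bs ws \<ominus> combine bs (map v ws) \<otimes> x"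
      if "set bs \<subseteq> carrier R" "set ws \<subseteq> carrier R" for bs ws
      using that
    proof (induct bs ws rule: combine.induct)
      case (1 b bs w ws)
      then have [simp]: "b \<in> carrier R" "w \<in> carrier R" "v w \<in> carrier R" "combine bs ws \<in> carrier R"
          "combine bs (map v ws) \<in> carrier R"
        by (auto simp: v_def subset_iff intro!: combine_in_carrier)
      have "combine (b # bs) (map f (w # ws)) =
          b \<otimes> (v x \<otimes> w \<ominus> v w \<otimes> x) \<oplus> (v x \<otimes> combine bs ws \<ominus> combine bs (map v ws) \<otimes> x)"
        using 1 by (simp add: f_def[of w])
      also have "\<dots> = v x \<otimes> (b \<otimes> w \<oplus> combine bs ws) \<ominus> (b \<otimes> v w \<oplus> combine bs (map v ws)) \<otimes> x"
        by (simp add: minus_eq l_distr r_distr l_minus r_minus minus_add m_ac a_ac)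
      finally show ?case by simp
    qed (auto simp: minus_eq)
    define as1 where "as1 = take (length us1) as"
    define as2 where "as2 = drop (length us1) as"
    have as12: "as = as1 @ as2" "length as1 = length us1" "length as2 = length us2"
      using as(2) by (auto simp: as1_def as2_def)
    have asc12 [simp]: "set as1 \<subseteq> carrier R" "set as2 \<subseteq> carrier R" using asc as12(1) by auto
    define t where "t = combine as (map v (us1 @ us2))"
    have tK: "t \<in> Ker"
    proof -
      have cK: "combine bs ws \<in> Ker" if "set bs \<subseteq> Ker" "set ws \<subseteq> Ker" for bs ws
        using that by (induct bs ws rule: combine.induct) (use subringE[OF Ker_subring] in auto)
      have "set (map v (us1 @ us2)) \<subseteq> Ker" using vK us by auto
      then show ?thesis unfolding t_def by (rule cK[OF as(1)])
    qed
    have [simp]: "t \<in> carrier R" using tK by auto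
    have split: "combine as (us1 @ us2) = combine as1 us1 \<oplus> combine as2 us2"
      using combine_append[of as1 us1 as2 us2] as12 by simp
    \<comment> \<open>The relation among the \<open>f u\<close> rewritten for the original list; all
      multiples of the pivot collect in its coefficient \<open>\<ominus> t\<close>.\<close>
    define bs where "bs = map ((\<otimes>) (v x)) as1 @ (\<ominus> t) # map ((\<otimes>) (v x)) as2"
    have [simp]: "combine as1 us1 \<in> carrier R" "combine as2 us2 \<in> carrier R" by auto
    have mc: "set (map ((\<otimes>) (v x)) as1) \<subseteq> carrier R" "set (map ((\<otimes>) (v x)) as2) \<subseteq> carrier R"
      using asc12 c(4) by (auto simp del: asc12 simp: subset_iff)
    have "combine bs us = combine (map ((\<otimes>) (v x)) as1) us1 \<oplus> combine ((\<ominus> t) # map ((\<otimes>) (v x)) as2) (x # us2)"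
      unfolding bs_def us using as12 mc by (intro combine_append[symmetric]) auto
    also have "\<dots> = v x \<otimes> combine as1 us1 \<oplus> ((\<ominus> t) \<otimes> x \<oplus> v x \<otimes> combine as2 us2)"
      using combine_r_distr[of as1 us1 "v x"] combine_r_distr[of as2 us2 "v x"] by simp
    also have "\<dots> = v x \<otimes> combine as (us1 @ us2) \<ominus> t \<otimes> x"
      by (simp add: split minus_eq r_distr l_minus a_ac)
    also have "\<dots> = \<zero>" using lin[OF asc, of "us1 @ us2"] as(3) by (simp add: t_def)
    finally have "combine bs us = \<zero>" .
    moreover have "set bs \<subseteq> Ker"
      using as(1) as12(1) vK[of x] x subringE[OF Ker_subring] tK by (auto simp: bs_def)
    moreover have "length bs = length us" using as12 us by (simp add: bs_def)
    moreover have "\<not> set bs \<subseteq> {\<zero>}"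
    proof
      assume z: "set bs \<subseteq> {\<zero>}"
      obtain a where a: "a \<in> set as" "a \<noteq> \<zero>" using as(4) by auto
      then have "v x \<otimes> a \<in> set bs" using as12(1) by (auto simp: bs_def)
      then have "v x \<otimes> a = \<zero>" using z by auto
      then show False using a asc x(2) c(4) by (auto simp: integral_iff v_def subset_iff)
    qed
    ultimately show ?thesis by blast
  qed
qed

end

section \<open>Linear spans and common denominators over a subring\<close>

context cring
begin

text \<open>The coefficients range over an arbitrary set, because later they come from the base ring
  and also from an ideal \<open>N\<close> of it.\<close>

definition lin_span :: "'a list \<Rightarrow> 'a set \<Rightarrow> 'a set" where
  "lin_span es H = {combine as es | as. set as \<subseteq> H \<and> length as = length es}"

lemma combine_uminus:
  assumes "set as \<subseteq> carrier R" "set us \<subseteq> carrier R"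
  shows "combine (map (\<lambda>x. \<ominus> x) as) us = \<ominus> combine as us"
  using assms
proof (induct as us rule: combine.induct)
  case (1 a as u us)
  then have "a \<in> carrier R" "u \<in> carrier R" "combine as us \<in> carrier R" by auto
  then show ?case using 1 by (simp add: l_minus minus_add a_comm)
qed auto

lemma indep_over_unique:
  assumes H: "subring H R" and i: "indep_over H us"
    and "set as \<subseteq> H" "set bs \<subseteq> H" "length as = length us" "length bs = length us"
    and eq: "combine as us = combine bs us"
  shows "as = bs"
proof -
  have c: "set us \<subseteq> carrier R" "set as \<subseteq> carrier R" "set bs \<subseteq> carrier R"
    using i assms subringE(1)[OF H] by (auto simp: indep_over_def)
  have mc: "set (map (\<lambda>x. \<ominus> x) bs) \<subseteq> carrier R" using c(3) by auto
  have bc: "combine bs us \<in> carrier R" using c by auto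
  have "combine (map2 (\<oplus>) as (map (\<lambda>x. \<ominus> x) bs)) us = \<zero>"
    using combine_add[of as us "map (\<lambda>x. \<ominus> x) bs"] combine_uminus[OF c(3,1)] c mc assms bc by (simp add: r_neg)
  moreover have "set (map2 (\<oplus>) as (map (\<lambda>x. \<ominus> x) bs)) \<subseteq> H"
  proof
    fix t assume "t \<in> set (map2 (\<oplus>) as (map (\<lambda>x. \<ominus> x) bs))"
    then obtain x y where xy: "(x, y) \<in> set (zip as (map (\<lambda>x. \<ominus> x) bs))" "t = x \<oplus> y" by auto
    have "x \<in> H" using set_zip_leftD[OF xy(1)] assms(3) by auto
    moreover have "y \<in> H" using set_zip_rightD[OF xy(1)] assms(4) subringE(5)[OF H] by auto
    ultimately show "t \<in> H" using xy(2) subringE(7)[OF H] by simp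
  qed
  moreover have "length (map2 (\<oplus>) as (map (\<lambda>x. \<ominus> x) bs)) = length us" using assms by simp
  ultimately have z: "set (map2 (\<oplus>) as (map (\<lambda>x. \<ominus> x) bs)) \<subseteq> {\<zero>}" using i unfolding indep_over_def by blast
  show ?thesis
  proof (rule nth_equalityI)
    show "length as = length bs" using assms by simp
    fix i assume i: "i < length as"
    then have ab: "as ! i \<in> carrier R" "bs ! i \<in> carrier R" using c assms by (auto simp: subset_iff)
    have "map2 (\<oplus>) as (map (\<lambda>x. \<ominus> x) bs) ! i \<in> set (map2 (\<oplus>) as (map (\<lambda>x. \<ominus> x) bs))"
      using i assms by (intro nth_mem) simp
    then have "as ! i \<oplus> \<ominus> bs ! i = \<zero>" using z i assms by auto
    then show "as ! i = bs ! i" using ab r_right_minus_eq[of "as ! i" "bs ! i"] by (simp add: minus_eq)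
  qed
qed

lemma lin_span_smult:
  assumes es: "set es \<subseteq> carrier R" and N: "N \<subseteq> carrier R" and b: "b \<in> carrier R" "\<And>y. y \<in> N \<Longrightarrow> b \<otimes> y \<in> N"
    and v: "v \<in> lin_span es N"
  shows "b \<otimes> v \<in> lin_span es N"
proof -
  obtain as where as: "set as \<subseteq> N" "length as = length es" "v = combine as es"
    using v by (auto simp: lin_span_def)
  then have "b \<otimes> v = combine (map ((\<otimes>) b) as) es"
    using es N b by (subst combine_r_distr[symmetric]) auto
  then show ?thesis using as b unfolding lin_span_def
    by (intro CollectI exI[of _ "map ((\<otimes>) b) as"]) auto
qed

lemma lin_span_add:
  assumes es: "set es \<subseteq> carrier R" and N: "N \<subseteq> carrier R" "\<And>x y. x \<in> N \<Longrightarrow> y \<in> N \<Longrightarrow> x \<oplus> y \<in> N"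
    and "u \<in> lin_span es N" "v \<in> lin_span es N"
  shows "u \<oplus> v \<in> lin_span es N"
proof -
  obtain as bs where ab: "set as \<subseteq> N" "length as = length es" "u = combine as es"
    "set bs \<subseteq> N" "length bs = length es" "v = combine bs es" using assms by (auto simp: lin_span_def)
  have "u \<oplus> v = combine (map2 (\<oplus>) as bs) es"
    using combine_add[of as es bs] ab N(1) es by auto
  moreover have "set (map2 (\<oplus>) as bs) \<subseteq> N"
  proof
    fix t assume "t \<in> set (map2 (\<oplus>) as bs)"
    then obtain x y where xy: "(x, y) \<in> set (zip as bs)" "t = x \<oplus> y" by auto
    then have "x \<in> N" "y \<in> N" using set_zip_leftD[OF xy(1)] set_zip_rightD[OF xy(1)] ab by auto
    then show "t \<in> N" using xy N(2) by simp
  qed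
  moreover have "length (map2 (\<oplus>) as bs) = length es" using ab by simp
  ultimately show ?thesis unfolding lin_span_def by blast
qed

end

text \<open>The product of the individual solutions works. Genericity conditions are phrased so as
  to persist under nonzero multiples, which lets a single element serve all of them.\<close>

lemma (in domain) common_multiple:
  assumes H: "subring H R" and "finite I" "\<And>i. i \<in> I \<Longrightarrow> \<exists>a\<in>H - {\<zero>}. P i a"
    and mul: "\<And>i a b. i \<in> I \<Longrightarrow> P i a \<Longrightarrow> a \<in> H - {\<zero>} \<Longrightarrow> b \<in> H - {\<zero>} \<Longrightarrow> P i (b \<otimes> a)"
  shows "\<exists>a\<in>H - {\<zero>}. \<forall>i\<in>I. P i a"
  using assms(2-)
proof (induct I)
  case empty
  then show ?case using subringE(3)[OF H] one_not_zero by auto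
next
  case (insert i I)
  obtain a where a: "a \<in> H - {\<zero>}" "\<forall>j\<in>I. P j a" using insert by auto
  obtain b where b: "b \<in> H - {\<zero>}" "P i b" using insert.prems(1)[of i] by blast
  have c: "a \<in> carrier R" "b \<in> carrier R" using a b subringE(1)[OF H] by auto
  then have "a \<otimes> b \<in> H - {\<zero>}" using a b subringE(6)[OF H] by (auto simp: integral_iff)
  moreover have "P i (a \<otimes> b)" using insert a b by blast
  moreover have "a \<otimes> b = b \<otimes> a" using c by (rule m_comm)
  then have "P j (a \<otimes> b)" if "j \<in> I" for j
    using insert.prems(2)[of j a b] a b that by simp
  ultimately show ?case by blast
qed

section \<open>A base ring over which the kernel has finite rank\<close>

locale lnd_family = lnd_domain R D for R (structure) and D +
  fixes H :: "'a set"
  assumes H_subring: "subring H R"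
    and H_Ker: "H \<subseteq> Ker"
    and nontrivial: "\<exists>x\<in>carrier R. D x \<noteq> \<zero>"
    and finite_rank: "\<exists>r. \<forall>us. set us \<subseteq> Ker \<and> indep_over H us \<longrightarrow> length us \<le> r"
begin

lemmas H_props = subringE(2,3,5,6,7)[OF H_subring]

lemma H_carrier: "H \<subseteq> carrier R" using subringE(1)[OF H_subring] .

text \<open>The degree of the fraction field of \<open>Ker\<close> over that of \<open>H\<close>,
  expressed by independent lists so that no fraction field has to be formed. It becomes the number
  of lines.\<close>

definition "rank = Max {length us | us. set us \<subseteq> Ker \<and> indep_over H us}"

lemma rank_set: "finite {length us | us. set us \<subseteq> Ker \<and> indep_over H us}"
  "{length us | us. set us \<subseteq> Ker \<and> indep_over H us} \<noteq> {}"
proof -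
  obtain r where r: "\<And>us. set us \<subseteq> Ker \<and> indep_over H us \<Longrightarrow> length us \<le> r"
    using finite_rank by blast
  then have "{length us | us. set us \<subseteq> Ker \<and> indep_over H us} \<subseteq> {..r}" by blast
  then show "finite {length us | us. set us \<subseteq> Ker \<and> indep_over H us}"
    using finite_subset[OF _ finite_atMost] by blast
  have "indep_over H []" by (simp add: indep_over_def)
  then show "{length us | us. set us \<subseteq> Ker \<and> indep_over H us} \<noteq> {}"
    by (metis (mono_tags, lifting) empty_Collect_eq empty_set empty_subsetI)
qed

lemma exists_basis:
  obtains es where "set es \<subseteq> Ker" "indep_over H es" "length es = rank"
proof -
  have "rank \<in> {length us | us. set us \<subseteq> Ker \<and> indep_over H us}"
    unfolding rank_def by (rule Max_in[OF rank_set])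
  then show thesis using that by auto
qed

lemma dependent_relation:
  assumes "set us \<subseteq> Ker" "rank < length us"
  obtains as where "set as \<subseteq> H" "length as = length us" "combine as us = \<zero>" "\<not> set as \<subseteq> {\<zero>}"
proof -
  have "\<not> indep_over H us"
  proof
    assume "indep_over H us"
    then have "length us \<in> {length us | us. set us \<subseteq> Ker \<and> indep_over H us}" using assms(1) by blast
    from Max_ge[OF rank_set(1) this] show False using assms(2) by (simp add: rank_def)
  qed
  then show thesis using that assms(1) Ker_carrier unfolding indep_over_def by blast
qed

text \<open>Maximality of \<open>rank\<close> is applied to the powers of \<open>y\<close> with
  exponents 0 to \<open>rank\<close>. The length is recorded because it becomes the degree bound for
  the reduced polynomial.\<close>

lemma algebraic_relation:
  assumes y: "y \<in> Ker"
  obtains hs where "set hs \<subseteq> H" "length hs = Suc rank" "horner hs y = \<zero>" "\<not> set hs \<subseteq> {\<zero>}"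
proof -
  define us where "us = map (\<lambda>i. y [^] i) [0..<Suc rank]"
  have "y [^] (i::nat) \<in> Ker" for i
    by (induct i) (use y subringE[OF Ker_subring] in auto)
  then have "set us \<subseteq> Ker" unfolding us_def by auto
  moreover have len: "length us = Suc rank" by (simp add: us_def)
  ultimately obtain hs where hs: "set hs \<subseteq> H" "length hs = length us" "combine hs us = \<zero>" "\<not> set hs \<subseteq> {\<zero>}"
    using dependent_relation[of us] by (metis lessI)
  have "horner hs y = combine hs us"
    using horner_combine[of hs y] hs len H_carrier y unfolding us_def by auto
  then show thesis using that hs len by simp
qed

text \<open>The lowest nonzero coefficient of an algebraic relation is a multiple of
  \<open>y\<close>, once zero coefficients below it are removed by cancelling \<open>y\<close>.
  Denominators from the kernel can thus be traded for denominators from \<open>H\<close>.\<close>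

lemma divides_base:
  assumes y: "y \<in> Ker" "y \<noteq> \<zero>"
  shows "\<exists>c\<in>Ker. c \<otimes> y \<in> H - {\<zero>}"
proof -
  obtain hs where hs: "set hs \<subseteq> H" "horner hs y = \<zero>" "\<not> set hs \<subseteq> {\<zero>}"
    using algebraic_relation[OF y(1)] by metis
  then show ?thesis
  proof (induct hs)
    case (Cons h hs)
    have c: "set hs \<subseteq> carrier R" "h \<in> carrier R" "y \<in> carrier R" using Cons H_carrier y by auto
    have hK: "horner hs y \<in> Ker"
      using horner_in_subring[OF Ker_subring, of hs y] Cons H_Ker y by auto
    show ?case
    proof (cases "h = \<zero>")
      case True
      then have "y \<otimes> horner hs y = \<zero>" using Cons.prems c by simp
      then show ?thesis using Cons True c y by (auto simp: integral_iff)
    next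
      case False
      have e: "h \<oplus> y \<otimes> horner hs y = \<zero>" using Cons by simp
      then have "(\<ominus> horner hs y) \<otimes> y = h"
        using c by (metis horner_closed l_minus m_closed m_comm minus_equality minus_minus a_inv_closed a_comm)
      moreover have "\<ominus> horner hs y \<in> Ker" using hK subringE(5)[OF Ker_subring] by auto
      ultimately show ?thesis using False Cons by auto
    qed
  qed auto
qed

text \<open>If the derivative of a relation vanishes at \<open>y\<close> too, it is itself a shorter
  relation, nontrivial in characteristic 0. The descent ends at a relation with \<open>y\<close> as
  a simple root.\<close>

lemma separable_relation:
  assumes y: "y \<in> Ker"
  shows "\<exists>hs. set hs \<subseteq> H \<and> horner hs y = \<zero> \<and> horner_deriv hs y \<noteq> \<zero>"
proof -
  obtain hs where hs: "set hs \<subseteq> H" "horner hs y = \<zero>" "\<not> set hs \<subseteq> {\<zero>}"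
    using algebraic_relation[OF y(1)] by metis
  then show ?thesis
  proof (induct "length hs" arbitrary: hs rule: less_induct)
    case less
    then obtain h p where p: "hs = h # p" by (cases hs) auto
    have c: "set (h # p) \<subseteq> carrier R" "y \<in> carrier R" using less p H_carrier y by auto
    show ?case
    proof (cases "horner_deriv hs y = \<zero>")
      case True
      have 1: "set (deriv_coeffs 1 p) \<subseteq> H"
        using less p by (intro deriv_coeffs_in_subring[OF H_subring]) auto
      have 2: "horner (deriv_coeffs 1 p) y = \<zero>"
        using True horner_deriv_coeffs_1[OF c] p by simp
      have 3: "\<not> set (deriv_coeffs 1 p) \<subseteq> {\<zero>}"
      proof
        assume "set (deriv_coeffs 1 p) \<subseteq> {\<zero>}"
        then have pz: "set p \<subseteq> {\<zero>}" using deriv_coeffs_zero[of p 1] c by simp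
        then have "h = \<zero>" using less(3) p horner_zeros[OF pz c(2)] c by simp
        then show False using pz less p by auto
      qed
      show ?thesis using less.hyps[OF _ 1 2 3] p by simp
    next
      case False
      then show ?thesis using less by blast
    qed
  qed
qed

text \<open>Adjoining \<open>c\<close> exceeds the maximal length, and in the resulting relation the
  coefficient of \<open>c\<close> cannot vanish because \<open>es\<close> is independent.\<close>

lemma Ker_in_span:
  assumes es: "set es \<subseteq> Ker" "indep_over H es" "length es = rank" and c: "c \<in> Ker"
  shows "\<exists>a\<in>H - {\<zero>}. a \<otimes> c \<in> lin_span es H"
proof -
  obtain as where as: "set as \<subseteq> H" "length as = Suc (length es)" "combine as (c # es) = \<zero>" "\<not> set as \<subseteq> {\<zero>}"
    using dependent_relation[of "c # es"] es c by auto
  then obtain a bs where ab: "as = a # bs" by (cases as) auto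
  have cc: "a \<in> carrier R" "c \<in> carrier R" "set bs \<subseteq> carrier R" "set es \<subseteq> carrier R"
    using as ab c es Ker_carrier H_carrier by auto
  have e: "a \<otimes> c \<oplus> combine bs es = \<zero>" using as ab by simp
  have "a \<noteq> \<zero>"
  proof
    assume "a = \<zero>"
    then have "combine bs es = \<zero>" using e cc by simp
    then have "set bs \<subseteq> {\<zero>}" using es(2) as ab by (auto simp: indep_over_def)
    then show False using as ab \<open>a = \<zero>\<close> by auto
  qed
  moreover have "a \<otimes> c = combine (map (\<lambda>x. \<ominus> x) bs) es"
    using e cc combine_uminus[OF cc(3,4)] by (metis combine_in_carrier m_closed minus_equality)
  moreover have "set (map (\<lambda>x. \<ominus> x) bs) \<subseteq> H" using as ab H_props by auto
  ultimately show ?thesis using as ab unfolding lin_span_def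
    by (intro bexI[of _ a]) (auto intro!: exI[of _ "map (\<lambda>x. \<ominus> x) bs"])
qed

lemma exists_slice:
  obtains s where "s \<in> carrier R" "D s \<noteq> \<zero>" "D (D s) = \<zero>"
proof -
  obtain x where x: "x \<in> carrier R" "D x \<noteq> \<zero>" using nontrivial by blast
  obtain a where a: "(D ^^ a) (D x) \<noteq> \<zero>" "(D ^^ Suc a) (D x) = \<zero>"
    using exists_degree[of "D x"] x by blast
  have "(D ^^ a) (D x) = D ((D ^^ a) x)" by (metis Dn_Suc funpow.simps(2) comp_apply)
  then show thesis using that[of "(D ^^ a) x"] a x by auto
qed

end

text \<open>The lattice of polynomials in \<open>s\<close> with coefficients in the \<open>H\<close>-span of \<open>es\<close> becomes the whole
  ring after inverting \<open>a\<close>, and \<open>a\<close> also inverts the derivatives of relations for the \<open>es\<close>.\<close>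

locale lnd_lattice = lnd_family R D H for R (structure) and D and H +
  fixes Y :: "'a set" and es :: "'a list" and s a :: 'a
  assumes Y_carrier: "Y \<subseteq> carrier R"
    and generated: "carrier R = generate_ring R (H \<union> Y)"
    and es_Ker: "set es \<subseteq> Ker"
    and es_indep: "indep_over H es"
    and s_closed: "s \<in> carrier R"
    and Ds: "D s \<noteq> \<zero>"
    and a_H: "a \<in> H"
    and a_nonzero: "a \<noteq> \<zero>"
    and a_one: "a \<in> lin_span es H"
    and a_gen: "x \<in> Y \<Longrightarrow> \<exists>cs. set cs \<subseteq> Ker \<and> a \<otimes> x = horner cs s
                  \<and> (\<forall>c\<in>set cs. \<forall>e\<in>set es. (a \<otimes> c) \<otimes> e \<in> lin_span es H)"
    and a_mult: "e \<in> set es \<Longrightarrow> e' \<in> set es \<Longrightarrow> (a \<otimes> e) \<otimes> e' \<in> lin_span es H"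
    and a_sep: "e \<in> set es \<Longrightarrow> \<exists>hs. set hs \<subseteq> H \<and> horner hs e = \<zero>
                  \<and> (\<exists>c\<in>carrier R. c \<otimes> horner_deriv hs e = a)"

context lnd_family
begin

text \<open>\<open>a\<close> is a product of four denominators: \<open>a1\<close> for products of
  basis elements with each other and with the coefficients of the generators, \<open>a2\<close> for
  the unit element, \<open>a3\<close> for expanding the generators in \<open>s\<close>,
  \<open>a4\<close> for the values of the derivatives. A multiple of a good denominator is again
  good.\<close>

lemma exists_lattice:
  assumes Y: "Y \<subseteq> carrier R" "finite Y" "carrier R = generate_ring R (H \<union> Y)"
  shows "\<exists>es s a. lnd_lattice R D H Y es s a \<and> length es = rank"
proof -
  obtain es where es: "set es \<subseteq> Ker" "indep_over H es" "length es = rank" by (rule exists_basis)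
  obtain s where s: "s \<in> carrier R" "D s \<noteq> \<zero>" "D (D s) = \<zero>" by (rule exists_slice)
  have esc: "set es \<subseteq> carrier R" using es Ker_carrier by auto
  have smul: "b \<otimes> v \<in> lin_span es H" if "b \<in> H" "v \<in> lin_span es H" for b v
    using lin_span_smult[of es H b v] H_props(4) H_carrier esc that by auto
  have "\<exists>a\<in>H - {\<zero>}. \<exists>cs. set cs \<subseteq> Ker \<and> a \<otimes> x = horner cs s" if x: "x \<in> Y" for x
  proof -
    obtain q cs where q: "q \<in> Ker - {\<zero>}" "set cs \<subseteq> Ker" "q \<otimes> x = horner cs s"
      using slice_expansion[OF s, of x] Y x by blast
    obtain c where c: "c \<in> Ker" "c \<otimes> q \<in> H - {\<zero>}" using divides_base[of q] q by auto
    have "set cs \<subseteq> carrier R" "c \<in> carrier R" "q \<in> carrier R" "x \<in> carrier R" using q c Ker_carrier x Y by auto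
    then have "(c \<otimes> q) \<otimes> x = horner (map ((\<otimes>) c) cs) s"
      using q s horner_smult by (simp add: m_assoc)
    moreover have "set (map ((\<otimes>) c) cs) \<subseteq> Ker" using q c subringE(6)[OF Ker_subring] by auto
    ultimately show ?thesis using c by blast
  qed
  then obtain ax cx where ax: "\<And>x. x \<in> Y \<Longrightarrow> ax x \<in> H - {\<zero>}"
    and cx: "\<And>x. x \<in> Y \<Longrightarrow> set (cx x) \<subseteq> Ker \<and> ax x \<otimes> x = horner (cx x) s" by metis
  define G where "G = (\<Union>x\<in>Y. set (cx x)) \<union> set es"
  have G: "G \<subseteq> Ker" "finite G" using cx es Y by (auto simp: G_def)
  \<comment> \<open>The quantifier over \<open>b\<close> builds in the stability under multiples
    that \<open>common_multiple\<close> asks for.\<close>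
  have "\<exists>a\<in>H - {\<zero>}. \<forall>(g, e)\<in>G \<times> set es. \<forall>b\<in>H. ((b \<otimes> a) \<otimes> g) \<otimes> e \<in> lin_span es H"
  proof (rule common_multiple[OF H_subring])
    fix i assume "i \<in> G \<times> set es"
    then obtain g e where i: "i = (g, e)" "g \<in> Ker" "e \<in> Ker" using G es by auto
    then have c: "g \<in> carrier R" "e \<in> carrier R" by auto
    obtain a where a: "a \<in> H - {\<zero>}" "a \<otimes> (g \<otimes> e) \<in> lin_span es H"
      using Ker_in_span[OF es, of "g \<otimes> e"] i subringE(6)[OF Ker_subring] by blast
    have "((b \<otimes> a) \<otimes> g) \<otimes> e = b \<otimes> (a \<otimes> (g \<otimes> e))" if "b \<in> H" for b
      using a that c H_carrier by (auto simp: m_assoc subset_iff)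
    then have "\<forall>b\<in>H. ((b \<otimes> a) \<otimes> g) \<otimes> e \<in> lin_span es H"
      using a(2) smul by simp
    then show "\<exists>a\<in>H - {\<zero>}. case i of (g, e) \<Rightarrow> \<forall>b\<in>H. ((b \<otimes> a) \<otimes> g) \<otimes> e \<in> lin_span es H"
      unfolding i(1) prod.case using a(1) by blast
  next
    fix i a b assume i: "case i of (g, e) \<Rightarrow> \<forall>b\<in>H. ((b \<otimes> a) \<otimes> g) \<otimes> e \<in> lin_span es H"
      and ab: "a \<in> H - {\<zero>}" "b \<in> H - {\<zero>}"
    obtain g e where ge: "i = (g, e)" by (cases i)
    have "((b' \<otimes> (b \<otimes> a)) \<otimes> g) \<otimes> e \<in> lin_span es H" if b': "b' \<in> H" for b'
    proof -
      have "b' \<otimes> (b \<otimes> a) = (b' \<otimes> b) \<otimes> a"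
        using ab b' H_carrier by (auto simp: m_assoc subset_iff)
      then show ?thesis using i H_props(4)[OF b', of b] ab unfolding ge prod.case by simp
    qed
    then show "case i of (g, e) \<Rightarrow> \<forall>b'\<in>H. ((b' \<otimes> (b \<otimes> a)) \<otimes> g) \<otimes> e \<in> lin_span es H"
      unfolding ge prod.case by blast
  qed (use G in auto)
  then obtain a1 where a1: "a1 \<in> H - {\<zero>}" "\<And>g e b. g \<in> G \<Longrightarrow> e \<in> set es \<Longrightarrow> b \<in> H \<Longrightarrow> ((b \<otimes> a1) \<otimes> g) \<otimes> e \<in> lin_span es H"
    by blast
  obtain a2 where a2: "a2 \<in> H - {\<zero>}" "a2 \<otimes> \<one> \<in> lin_span es H"
    using Ker_in_span[OF es, of \<one>] subringE(3)[OF Ker_subring] by blast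
  have "\<exists>a\<in>H - {\<zero>}. \<forall>x\<in>Y. \<exists>b\<in>H. a = b \<otimes> ax x"
  proof (rule common_multiple[OF H_subring])
    fix x assume "x \<in> Y" then show "\<exists>a\<in>H - {\<zero>}. \<exists>b\<in>H. a = b \<otimes> ax x"
      using ax[of x] H_props(2) H_carrier by (intro bexI[of _ "ax x"] bexI[of _ \<one>]) auto
  next
    fix x a b assume "x \<in> Y" "\<exists>b\<in>H. a = b \<otimes> ax x" "b \<in> H - {\<zero>}"
    then obtain c where "c \<in> H" "a = c \<otimes> ax x" by blast
    then have "b \<otimes> a = (b \<otimes> c) \<otimes> ax x" "b \<otimes> c \<in> H"
      using \<open>b \<in> H - {\<zero>}\<close> ax[OF \<open>x \<in> Y\<close>] H_carrier H_props(4) by (auto simp: m_assoc subset_iff)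
    then show "\<exists>c\<in>H. b \<otimes> a = c \<otimes> ax x" by blast
  qed (use Y in auto)
  then obtain a3 where a3: "a3 \<in> H - {\<zero>}" "\<And>x. x \<in> Y \<Longrightarrow> \<exists>b\<in>H. a3 = b \<otimes> ax x" by blast
  have "\<exists>a\<in>H - {\<zero>}. \<forall>e\<in>set es. \<exists>hs. set hs \<subseteq> H \<and> horner hs e = \<zero> \<and> (\<exists>c\<in>carrier R. c \<otimes> horner_deriv hs e = a)"
  proof (rule common_multiple[OF H_subring])
    fix e assume e: "e \<in> set es"
    then have eK: "e \<in> Ker" using es by auto
    obtain hs where hs: "set hs \<subseteq> H" "horner hs e = \<zero>" "horner_deriv hs e \<noteq> \<zero>"
      using separable_relation[OF eK] by blast
    have "horner_deriv hs e \<in> Ker" using hs(1)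
    proof (induct hs)
      case (Cons h hs)
      then show ?case using horner_in_subring[OF Ker_subring, of hs e] eK H_Ker subringE(6,7)[OF Ker_subring] by auto
    qed (use subringE(2)[OF Ker_subring] in auto)
    then obtain c where "c \<in> Ker" "c \<otimes> horner_deriv hs e \<in> H - {\<zero>}" using divides_base hs by blast
    then show "\<exists>a\<in>H - {\<zero>}. \<exists>hs. set hs \<subseteq> H \<and> horner hs e = \<zero> \<and> (\<exists>c\<in>carrier R. c \<otimes> horner_deriv hs e = a)"
      using hs by blast
  next
    fix e a b assume e: "e \<in> set es" and b: "b \<in> H - {\<zero>}"
      and "\<exists>hs. set hs \<subseteq> H \<and> horner hs e = \<zero> \<and> (\<exists>c\<in>carrier R. c \<otimes> horner_deriv hs e = a)"
    then obtain hs c where hs: "set hs \<subseteq> H" "horner hs e = \<zero>" "c \<in> carrier R" "c \<otimes> horner_deriv hs e = a" by blast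
    have "set hs \<subseteq> carrier R" "e \<in> carrier R" "b \<in> carrier R" using hs H_carrier e esc b by auto
    then have "(b \<otimes> c) \<otimes> horner_deriv hs e = b \<otimes> a" "b \<otimes> c \<in> carrier R" using hs by (auto simp: m_assoc)
    then show "\<exists>hs. set hs \<subseteq> H \<and> horner hs e = \<zero> \<and> (\<exists>c\<in>carrier R. c \<otimes> horner_deriv hs e = b \<otimes> a)"
      using hs by blast
  qed auto
  then obtain a4 where a4: "a4 \<in> H - {\<zero>}" "\<And>e. e \<in> set es \<Longrightarrow> \<exists>hs. set hs \<subseteq> H \<and> horner hs e = \<zero> \<and> (\<exists>c\<in>carrier R. c \<otimes> horner_deriv hs e = a4)" by blast
  have cc [simp]: "a1 \<in> carrier R" "a2 \<in> carrier R" "a3 \<in> carrier R" "a4 \<in> carrier R"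
    using a1 a2 a3 a4 H_carrier by auto
  define a where "a = a1 \<otimes> (a2 \<otimes> (a3 \<otimes> a4))"
  have aH: "a \<in> H" "a \<noteq> \<zero>" using a1 a2 a3 a4 H_props(4) by (auto simp: a_def integral_iff)
  have A1: "a = (a2 \<otimes> (a3 \<otimes> a4)) \<otimes> a1" "a = (a1 \<otimes> (a3 \<otimes> a4)) \<otimes> a2" "a = (a1 \<otimes> (a2 \<otimes> a4)) \<otimes> a3"
    "a = (a1 \<otimes> (a2 \<otimes> a3)) \<otimes> a4"
    by (simp_all add: a_def m_ac)
  have mH: "a2 \<otimes> (a3 \<otimes> a4) \<in> H" "a1 \<otimes> (a3 \<otimes> a4) \<in> H" "a1 \<otimes> (a2 \<otimes> a4) \<in> H" "a1 \<otimes> (a2 \<otimes> a3) \<in> H"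
    using a1 a2 a3 a4 H_props(4) by auto
  have "lnd_lattice R D H Y es s a"
  proof (unfold_locales)
    show "a \<in> lin_span es H" using a2 smul[OF mH(2)] A1(2) by simp
    fix x assume x: "x \<in> Y"
    obtain b where b: "b \<in> H" "a3 = b \<otimes> ax x" using a3 x by blast
    \<comment> \<open>The cofactor of \<open>ax x\<close> in \<open>a\<close>: the expansion of
      \<open>a \<otimes> x\<close> is the one of \<open>ax x \<otimes> x\<close> scaled by
      \<open>c\<close>.\<close>
    define c where "c = (a1 \<otimes> (a2 \<otimes> a4)) \<otimes> b"
    have c: "c \<in> H" "c \<in> carrier R" using b mH H_props(4) H_carrier by (auto simp: c_def)
    have axc: "ax x \<in> carrier R" "x \<in> carrier R" "b \<in> carrier R" using ax[OF x] H_carrier x Y b by auto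
    have "a = c \<otimes> ax x" unfolding A1(3) c_def using b axc by (simp add: m_assoc)
    then have "a \<otimes> x = c \<otimes> horner (cx x) s" using cx[OF x] c axc by (simp add: m_assoc)
    moreover have cxc: "set (cx x) \<subseteq> carrier R" using cx[OF x] Ker_carrier by auto
    ultimately have 1: "a \<otimes> x = horner (map ((\<otimes>) c) (cx x)) s" using c s by (simp add: horner_smult)
    have 2: "set (map ((\<otimes>) c) (cx x)) \<subseteq> Ker" using cx[OF x] c H_Ker subringE(6)[OF Ker_subring] by auto
    have "(a \<otimes> d) \<otimes> e \<in> lin_span es H" if d: "d \<in> set (map ((\<otimes>) c) (cx x))" and e: "e \<in> set es" for d e
    proof -
      obtain g where g: "g \<in> set (cx x)" "d = c \<otimes> g" using d by auto
      have [simp]: "g \<in> carrier R" "e \<in> carrier R" "c \<in> carrier R" using g cxc e esc c by auto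
      have "(a \<otimes> d) \<otimes> e = c \<otimes> (((a2 \<otimes> (a3 \<otimes> a4)) \<otimes> a1 \<otimes> g) \<otimes> e)"
        by (simp add: g A1(1) m_ac)
      then show ?thesis using smul[OF c(1)] a1(2)[of g e, OF _ e mH(1)] g x by (auto simp: G_def)
    qed
    then show "\<exists>cs. set cs \<subseteq> Ker \<and> a \<otimes> x = horner cs s \<and> (\<forall>c\<in>set cs. \<forall>e\<in>set es. (a \<otimes> c) \<otimes> e \<in> lin_span es H)"
      using 1 2 by blast
  next
    fix e e' assume "e \<in> set es" "e' \<in> set es"
    then show "(a \<otimes> e) \<otimes> e' \<in> lin_span es H" using a1(2)[of e e', OF _ _ mH(1)] A1(1) by (simp add: G_def)
  next
    fix e assume e: "e \<in> set es"
    obtain hs c where hs: "set hs \<subseteq> H" "horner hs e = \<zero>" "c \<in> carrier R" "c \<otimes> horner_deriv hs e = a4" using a4 e by blast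
    have "set hs \<subseteq> carrier R" "e \<in> carrier R" using hs H_carrier e esc by auto
    then have "(a1 \<otimes> (a2 \<otimes> a3) \<otimes> c) \<otimes> horner_deriv hs e = a" using hs A1(4) by (simp add: m_assoc)
    then show "\<exists>hs. set hs \<subseteq> H \<and> horner hs e = \<zero> \<and> (\<exists>c\<in>carrier R. c \<otimes> horner_deriv hs e = a)"
      using hs by (metis cc(1-3) m_closed)
  qed (use Y es s aH in auto)
  then show ?thesis using es(3) by blast
qed

end

section \<open>The lattice with coefficients in an ideal of the base, and its saturation\<close>

context lnd_lattice
begin

lemma es_carrier: "set es \<subseteq> carrier R"
  using es_Ker Ker_carrier by auto

lemma a_carrier [simp]: "a \<in> carrier R"
  using a_H H_carrier by auto

lemmas [simp] = s_closed

lemma a_pow_H: "a [^] (n::nat) \<in> H"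
  by (induct n) (use a_H H_props in auto)

text \<open>Spelled out because \<open>H\<close> is only a subset of the carrier here. The case
  \<open>N = H\<close> describes the whole ring, a maximal ideal describes a fibre.\<close>

definition "H_ideal N \<longleftrightarrow> N \<subseteq> H \<and> \<zero> \<in> N \<and> (\<forall>x\<in>N. \<forall>y\<in>N. x \<oplus> y \<in> N) \<and> (\<forall>x\<in>H. \<forall>y\<in>N. x \<otimes> y \<in> N)"

definition "poly_lattice N = {horner ws s | ws. set ws \<subseteq> lin_span es N}"

text \<open>A substitute for localization: the elements of the ring that come to lie in the lattice
  with coefficients in \<open>N\<close> once \<open>a\<close> is inverted.\<close>

definition "saturation N = {x \<in> carrier R. \<exists>n::nat. a [^] n \<otimes> x \<in> poly_lattice N}"

lemma H_ideal_H: "H_ideal H"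
  using H_props by (auto simp: H_ideal_def)

lemma span_Ker:
  assumes "H_ideal N" shows "lin_span es N \<subseteq> Ker"
proof -
  have "combine as us \<in> Ker" if "set as \<subseteq> Ker" "set us \<subseteq> Ker" for as us
    using that by (induct as us rule: combine.induct) (use subringE[OF Ker_subring] in auto)
  moreover have "N \<subseteq> Ker" using assms H_Ker by (auto simp: H_ideal_def)
  ultimately show ?thesis using es_Ker by (auto simp: lin_span_def)
qed

lemma span_zero:
  assumes "H_ideal N" shows "\<zero> \<in> lin_span es N"
proof -
  have "combine (replicate (length es) \<zero>) es = \<zero>" using combine_replicate[OF es_carrier] .
  moreover have "set (replicate (length es) \<zero>) \<subseteq> N" using assms by (auto simp: H_ideal_def)
  ultimately show ?thesis unfolding lin_span_def by (metis (mono_tags, lifting) CollectI length_replicate)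
qed

lemma span_add:
  assumes N: "H_ideal N" and "u \<in> lin_span es N" "v \<in> lin_span es N" shows "u \<oplus> v \<in> lin_span es N"
  using lin_span_add[OF es_carrier, of N u v] assms H_carrier by (auto simp: H_ideal_def)

lemma span_smult:
  assumes N: "H_ideal N" and "b \<in> H" "v \<in> lin_span es N" shows "b \<otimes> v \<in> lin_span es N"
  using lin_span_smult[OF es_carrier, of N b v] assms H_carrier by (auto simp: H_ideal_def)

lemma span_ideal_mult:
  assumes N: "H_ideal N" and n: "n \<in> N" and u: "u \<in> lin_span es H" shows "n \<otimes> u \<in> lin_span es N"
proof -
  obtain as where as: "set as \<subseteq> H" "length as = length es" "u = combine as es"
    using u by (auto simp: lin_span_def)
  have c: "n \<in> carrier R" "set as \<subseteq> carrier R" using as n N H_carrier by (auto simp: H_ideal_def)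
  have "n \<otimes> u = combine (map ((\<otimes>) n) as) es"
    unfolding as(3) by (rule combine_r_distr) (use c es_carrier in auto)
  moreover have "set (map ((\<otimes>) n) as) \<subseteq> N"
  proof
    fix t assume "t \<in> set (map ((\<otimes>) n) as)"
    then obtain x where x: "x \<in> set as" "t = n \<otimes> x" by auto
    then have "t = x \<otimes> n" using c m_comm by auto
    then show "t \<in> N" using x as n N by (auto simp: H_ideal_def)
  qed
  moreover have "length (map ((\<otimes>) n) as) = length es" using as by simp
  ultimately show ?thesis unfolding lin_span_def by blast
qed

lemma span_gen_mult:
  assumes N: "H_ideal N" and g: "g \<in> carrier R" "\<And>e. e \<in> set es \<Longrightarrow> (a \<otimes> g) \<otimes> e \<in> lin_span es H"
    and v: "v \<in> lin_span es N"
  shows "(a \<otimes> g) \<otimes> v \<in> lin_span es N"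
proof -
  obtain ns where ns: "set ns \<subseteq> N" "v = combine ns es" using v by (auto simp: lin_span_def)
  have Nc: "N \<subseteq> carrier R" using N H_carrier by (auto simp: H_ideal_def)
  have "(a \<otimes> g) \<otimes> combine ns fs \<in> lin_span es N" if "set fs \<subseteq> set es" for fs
    using ns(1) that
  proof (induct ns fs rule: combine.induct)
    case (1 n ns f fs)
    have c: "n \<in> carrier R" "f \<in> carrier R" "set ns \<subseteq> carrier R" "set fs \<subseteq> carrier R"
      using 1 Nc es_carrier by auto
    then have c': "combine ns fs \<in> carrier R" by auto
    have "(a \<otimes> g) \<otimes> combine (n # ns) (f # fs) = n \<otimes> ((a \<otimes> g) \<otimes> f) \<oplus> (a \<otimes> g) \<otimes> combine ns fs"
      using c c' g by (simp add: r_distr m_ac)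
    moreover have "n \<otimes> ((a \<otimes> g) \<otimes> f) \<in> lin_span es N"
      using 1 g by (intro span_ideal_mult[OF N]) auto
    ultimately show ?case using 1 span_add[OF N] by simp
  qed (use g span_zero[OF N] in auto)
  then show ?thesis using ns by simp
qed

lemma span_coeffs_carrier: "H_ideal N \<Longrightarrow> set ws \<subseteq> lin_span es N \<Longrightarrow> set ws \<subseteq> carrier R"
  using span_Ker Ker_carrier by blast

lemma lattice_carrier: "H_ideal N \<Longrightarrow> poly_lattice N \<subseteq> carrier R"
  using span_coeffs_carrier by (auto simp: poly_lattice_def)

lemma lattice_add:
  assumes N: "H_ideal N" and "x \<in> poly_lattice N" "y \<in> poly_lattice N" shows "x \<oplus> y \<in> poly_lattice N"
proof -
  obtain us vs where uv: "set us \<subseteq> lin_span es N" "x = horner us s" "set vs \<subseteq> lin_span es N" "y = horner vs s"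
    using assms by (auto simp: poly_lattice_def)
  have "x \<oplus> y = horner (list_add us vs) s"
    using uv span_coeffs_carrier[OF N] by (simp add: horner_list_add)
  moreover have "set (list_add us vs) \<subseteq> lin_span es N"
    by (rule set_list_add) (use uv span_add[OF N] in auto)
  ultimately show ?thesis unfolding poly_lattice_def by blast
qed

lemma lattice_zero: "\<zero> \<in> poly_lattice N"
  unfolding poly_lattice_def by (auto intro!: exI[of _ "[]"])

lemma lattice_map:
  assumes N: "H_ideal N" and b: "b \<in> carrier R" "\<And>v. v \<in> lin_span es N \<Longrightarrow> b \<otimes> v \<in> lin_span es N"
    and x: "x \<in> poly_lattice N"
  shows "b \<otimes> x \<in> poly_lattice N"
proof -
  obtain us where us: "set us \<subseteq> lin_span es N" "x = horner us s" using x by (auto simp: poly_lattice_def)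
  have "b \<otimes> x = horner (map ((\<otimes>) b) us) s"
    using us span_coeffs_carrier[OF N] b by (simp add: horner_smult)
  moreover have "set (map ((\<otimes>) b) us) \<subseteq> lin_span es N" using us b by auto
  ultimately show ?thesis unfolding poly_lattice_def by blast
qed

lemma lattice_smult:
  assumes N: "H_ideal N" and "b \<in> H" "x \<in> poly_lattice N" shows "b \<otimes> x \<in> poly_lattice N"
  using lattice_map[OF N _ span_smult[OF N]] assms H_carrier by blast

lemma lattice_s:
  assumes N: "H_ideal N" and "x \<in> poly_lattice N" shows "s \<otimes> x \<in> poly_lattice N"
proof -
  obtain us where us: "set us \<subseteq> lin_span es N" "x = horner us s" using assms by (auto simp: poly_lattice_def)
  have "s \<otimes> x = horner (\<zero> # us) s" using us span_coeffs_carrier[OF N] by simp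
  then show ?thesis using us span_zero[OF N] unfolding poly_lattice_def
    by (intro CollectI exI[of _ "\<zero> # us"]) auto
qed

lemma lattice_gen:
  assumes N: "H_ideal N" and cs: "set cs \<subseteq> Ker" "\<And>c e. c \<in> set cs \<Longrightarrow> e \<in> set es \<Longrightarrow> (a \<otimes> c) \<otimes> e \<in> lin_span es H"
    and x: "x \<in> poly_lattice N"
  shows "a \<otimes> (horner cs s \<otimes> x) \<in> poly_lattice N"
  using cs
proof (induct cs)
  case Nil
  have "x \<in> carrier R" using x lattice_carrier[OF N] by auto
  then show ?case using lattice_zero by simp
next
  case (Cons c cs)
  have [simp]: "x \<in> carrier R" "c \<in> carrier R" "horner cs s \<in> carrier R"
    using x lattice_carrier[OF N] Cons Ker_carrier by auto
  have "a \<otimes> (horner (c # cs) s \<otimes> x) = (a \<otimes> c) \<otimes> x \<oplus> s \<otimes> (a \<otimes> (horner cs s \<otimes> x))"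
    by (simp add: l_distr r_distr m_ac)
  moreover have "(a \<otimes> c) \<otimes> x \<in> poly_lattice N"
    using Cons by (intro lattice_map[OF N _ _ x] span_gen_mult[OF N]) auto
  moreover have "s \<otimes> (a \<otimes> (horner cs s \<otimes> x)) \<in> poly_lattice N"
    using Cons by (intro lattice_s[OF N]) auto
  ultimately show ?case using lattice_add[OF N] by simp
qed

lemma saturation_add:
  assumes N: "H_ideal N" and "x \<in> saturation N" "y \<in> saturation N" shows "x \<oplus> y \<in> saturation N"
proof -
  obtain n m :: nat where nm: "a [^] n \<otimes> x \<in> poly_lattice N" "a [^] m \<otimes> y \<in> poly_lattice N" and [simp]: "x \<in> carrier R" "y \<in> carrier R"
    using assms by (auto simp: saturation_def)
  have "a [^] (n + m) \<otimes> (x \<oplus> y) = a [^] m \<otimes> (a [^] n \<otimes> x) \<oplus> a [^] n \<otimes> (a [^] m \<otimes> y)"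
    by (simp add: nat_pow_mult[symmetric] r_distr m_ac)
  moreover have "a [^] m \<otimes> (a [^] n \<otimes> x) \<oplus> a [^] n \<otimes> (a [^] m \<otimes> y) \<in> poly_lattice N"
    by (rule lattice_add[OF N lattice_smult[OF N a_pow_H nm(1)] lattice_smult[OF N a_pow_H nm(2)]])
  ultimately have "a [^] (n + m) \<otimes> (x \<oplus> y) \<in> poly_lattice N" by simp
  then show ?thesis unfolding saturation_def by auto
qed

lemma saturation_smult:
  assumes N: "H_ideal N" and "b \<in> H" "x \<in> saturation N" shows "b \<otimes> x \<in> saturation N"
proof -
  obtain n :: nat where n: "a [^] n \<otimes> x \<in> poly_lattice N" and [simp]: "x \<in> carrier R" "b \<in> carrier R"
    using assms H_carrier by (auto simp: saturation_def)
  have "a [^] n \<otimes> (b \<otimes> x) = b \<otimes> (a [^] n \<otimes> x)" by (simp add: m_ac)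
  then have "a [^] n \<otimes> (b \<otimes> x) \<in> poly_lattice N" using lattice_smult[OF N assms(2) n] by simp
  then show ?thesis unfolding saturation_def by auto
qed

lemma saturation_gen:
  assumes N: "H_ideal N" and y: "y \<in> Y" and x: "x \<in> saturation N" shows "y \<otimes> x \<in> saturation N"
proof -
  obtain n :: nat where n: "a [^] n \<otimes> x \<in> poly_lattice N" and [simp]: "x \<in> carrier R" "y \<in> carrier R"
    using x y Y_carrier by (auto simp: saturation_def)
  obtain cs where cs: "set cs \<subseteq> Ker" "a \<otimes> y = horner cs s"
    "\<And>c e. c \<in> set cs \<Longrightarrow> e \<in> set es \<Longrightarrow> (a \<otimes> c) \<otimes> e \<in> lin_span es H"
    using a_gen[OF y] by blast
  have "a \<otimes> (horner cs s \<otimes> (a [^] n \<otimes> x)) \<in> poly_lattice N" by (rule lattice_gen[OF N cs(1,3) n])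
  \<comment> \<open>Two extra factors \<open>a\<close>: one expands \<open>y\<close> in powers of
    \<open>s\<close>, the other clears the products of its coefficients with the basis.\<close>
  moreover have "a [^] Suc (Suc n) \<otimes> (y \<otimes> x) = a \<otimes> ((a \<otimes> y) \<otimes> (a [^] n \<otimes> x))"
    by (simp add: m_ac)
  ultimately have "a [^] Suc (Suc n) \<otimes> (y \<otimes> x) \<in> poly_lattice N" using cs(2) by simp
  moreover have "y \<otimes> x \<in> carrier R" by simp
  ultimately show ?thesis unfolding saturation_def by blast
qed

text \<open>The multipliers of the saturation form a subring that contains \<open>H\<close> and the
  generators \<open>Y\<close>, hence everything.\<close>

lemma saturation_mult:
  assumes N: "H_ideal N" and r: "r \<in> carrier R" and x: "x \<in> saturation N" shows "r \<otimes> x \<in> saturation N"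
proof -
  have sc: "saturation N \<subseteq> carrier R" by (auto simp: saturation_def)
  define E where "E = {r \<in> carrier R. \<forall>x\<in>saturation N. r \<otimes> x \<in> saturation N}"
  have "subring E R"
  proof (rule subringI)
    show "E \<subseteq> carrier R" by (auto simp: E_def)
    show "\<one> \<in> E" using sc by (auto simp: E_def)
  next
    fix h assume h: "h \<in> E"
    have "(\<ominus> h) \<otimes> x \<in> saturation N" if x: "x \<in> saturation N" for x
    proof -
      have c: "x \<in> carrier R" "h \<in> carrier R" using x sc h by (auto simp: E_def)
      have "\<ominus> \<one> \<in> H" using H_props by auto
      then have "(\<ominus> \<one>) \<otimes> (h \<otimes> x) \<in> saturation N" using saturation_smult[OF N, of "\<ominus> \<one>" "h \<otimes> x"] h x by (auto simp: E_def)
      then show ?thesis using c by (simp add: l_minus)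
    qed
    then show "\<ominus> h \<in> E" using h by (auto simp: E_def)
  next
    fix h1 h2 assume h: "h1 \<in> E" "h2 \<in> E"
    then show "h1 \<otimes> h2 \<in> E" using sc by (auto simp: E_def m_assoc subset_iff)
    show "h1 \<oplus> h2 \<in> E" using h sc saturation_add[OF N] by (auto simp: E_def l_distr subset_iff)
  qed
  moreover have "H \<union> Y \<subseteq> E"
    using saturation_smult[OF N] saturation_gen[OF N] H_carrier Y_carrier by (auto simp: E_def)
  ultimately have "generate_ring R (H \<union> Y) \<subseteq> E"
    using H_carrier Y_carrier by (intro generate_ring_min_subring1) auto
  then show ?thesis using r x generated by (auto simp: E_def)
qed

lemma ideal_subset_saturation:
  assumes N: "H_ideal N" shows "N \<subseteq> saturation N"
proof
  fix n assume n: "n \<in> N"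
  then have [simp]: "n \<in> carrier R" using N H_carrier by (auto simp: H_ideal_def)
  have "n \<otimes> a \<in> lin_span es N" using span_ideal_mult[OF N n a_one] .
  then have "horner [a \<otimes> n] s \<in> poly_lattice N"
    unfolding poly_lattice_def by (intro CollectI exI[of _ "[a \<otimes> n]"]) (auto simp: m_comm)
  then have "a [^] (1::nat) \<otimes> n \<in> poly_lattice N" by simp
  then show "n \<in> saturation N" unfolding saturation_def using \<open>n \<in> carrier R\<close> by blast
qed

text \<open>The decisive upper bound on the ideal generated by \<open>N\<close>: up to a power of
  \<open>a\<close>, its elements have all their coordinates in \<open>N\<close>. It prevents
  relations in the fibre that are not already visible over \<open>H\<close>.\<close>

lemma genideal_subset_saturation:
  assumes N: "H_ideal N" shows "Idl N \<subseteq> saturation N"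
proof -
  have sc: "saturation N \<subseteq> carrier R" by (auto simp: saturation_def)
  have z: "\<zero> \<in> saturation N" using N ideal_subset_saturation[OF N] by (auto simp: H_ideal_def)
  have "ideal (saturation N) R"
  proof (rule idealI)
    show "subgroup (saturation N) (add_monoid R)"
    proof (rule add.subgroupI)
      fix x assume x: "x \<in> saturation N"
      have "(\<ominus> \<one>) \<otimes> x \<in> saturation N" using saturation_mult[OF N _ x] by simp
      then show "\<ominus> x \<in> saturation N" using x sc by (auto simp: l_minus)
    qed (use sc z saturation_add[OF N] in auto)
    fix r x assume r: "r \<in> saturation N" "x \<in> carrier R"
    then show "x \<otimes> r \<in> saturation N" using saturation_mult[OF N] by blast
    then show "r \<otimes> x \<in> saturation N" using r sc m_comm by auto
  qed (rule ring_axioms)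
  then show ?thesis using genideal_minimal ideal_subset_saturation[OF N] by blast
qed

text \<open>The saturation absorbs multiplication and contains 1, so inverting \<open>a\<close>
  turns the lattice into the whole ring.\<close>

lemma saturation_H: "saturation H = carrier R"
proof -
  have "\<one> \<in> saturation H" using ideal_subset_saturation[OF H_ideal_H] H_props by auto
  then show ?thesis using saturation_mult[OF H_ideal_H, of _ \<one>] by (auto simp: saturation_def)
qed

text \<open>Subtracting the two expansions reduces this to the transcendence of \<open>s\<close>.
  The lists may differ in length, hence coefficients are compared up to an additional zero.\<close>

lemma horner_coeffs_unique:
  assumes "set us \<subseteq> Ker" "set vs \<subseteq> Ker" "horner us s = horner vs s"
  shows "set us \<subseteq> set vs \<union> {\<zero>}"
proof -
  have c: "set us \<subseteq> carrier R" "set vs \<subseteq> carrier R" "set (map (\<lambda>x. \<ominus> x) vs) \<subseteq> carrier R" using assms Ker_carrier by auto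
  have neg: "horner (map (\<lambda>x. \<ominus> x) vs) s = \<ominus> horner vs s" using c(2)
    by (induct vs) (auto simp: minus_add r_minus)
  define ws where "ws = list_add us (map (\<lambda>x. \<ominus> x) vs)"
  have "horner ws s = \<zero>"
    unfolding ws_def using horner_list_add[OF c(1,3) s_closed] neg c assms(3) by (simp add: r_neg)
  moreover have "set ws \<subseteq> Ker" unfolding ws_def
    by (rule set_list_add) (use assms subringE[OF Ker_subring] in auto)
  ultimately have "set ws \<subseteq> {\<zero>}" using transcendental_over_Ker[OF s_closed Ds] by blast
  then show ?thesis using c(1,2) unfolding ws_def
  proof (induct us vs rule: list_add.induct)
    case (3 u us v vs)
    then have "u = v" using r_right_minus_eq[of u v] by (auto simp: minus_eq)
    then show ?case using 3 by auto
  qed auto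
qed

end

section \<open>The fibre over a closed point where \<open>a\<close> does not vanish\<close>

locale lnd_fibre = lnd_lattice R D H Y es s a + k: algebraically_closed k
  for R (structure) and D and H and Y and es and s and a and k :: "('f, 'g) ring_scheme" +
  fixes \<sigma> :: "'f \<Rightarrow> 'a" and N :: "'a set"
  assumes \<sigma>_hom: "\<sigma> \<in> ring_hom k R"
    and \<sigma>_H: "c \<in> carrier k \<Longrightarrow> \<sigma> c \<in> H"
    and N_ideal: "H_ideal N"
    and N_prime: "x \<in> H \<Longrightarrow> y \<in> H \<Longrightarrow> x \<otimes> y \<in> N \<Longrightarrow> x \<in> N \<or> y \<in> N"
    and a_N: "a \<notin> N"
    and residue: "x \<in> H \<Longrightarrow> \<exists>c\<in>carrier k. x \<ominus> \<sigma> c \<in> N"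
begin

sublocale \<sigma>: ring_hom_cring k R \<sigma>
  by unfold_locales (rule \<sigma>_hom)

text \<open>\<open>N\<close> will be the image in \<open>H\<close> of a maximal ideal
  \<open>M\<close> of \<open>A\<close>, so that dividing by \<open>J\<close> writes the fibre ring
  \<open>B / MB\<close> as a quotient of \<open>B / \<alpha> B\<close>.\<close>

definition "J = Idl N"
abbreviation "q \<equiv> (+>) J"
abbreviation "S \<equiv> R Quot J"

lemma N_carrier: "N \<subseteq> carrier R"
  using N_ideal H_carrier by (auto simp: H_ideal_def)

lemma J_ideal: "ideal J R"
  unfolding J_def by (rule genideal_ideal[OF N_carrier])

sublocale q: ring_hom_cring R S q
  by (rule ideal.rcos_ring_hom_cring[OF J_ideal is_cring])

lemma q_eq: "x \<in> carrier R \<Longrightarrow> y \<in> carrier R \<Longrightarrow> q x = q y \<longleftrightarrow> x \<ominus> y \<in> J"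
  using quotient_eq_iff_same_a_r_cos[OF J_ideal] by simp

lemma q_zero: "x \<in> carrier R \<Longrightarrow> q x = \<zero>\<^bsub>S\<^esub> \<longleftrightarrow> x \<in> J"
  using q_eq[of x \<zero>] by (simp add: minus_eq)

lemma N_J: "N \<subseteq> J"
  unfolding J_def by (rule genideal_self[OF N_carrier])

lemma \<sigma>_N: assumes "c \<in> carrier k" "\<sigma> c \<in> N" shows "c = \<zero>\<^bsub>k\<^esub>"
proof (rule ccontr)
  assume "c \<noteq> \<zero>\<^bsub>k\<^esub>"
  then have u: "c \<in> Units k" using assms k.field_Units by auto
  have "a \<otimes> \<sigma> (inv\<^bsub>k\<^esub> c) \<in> H" using u a_H \<sigma>_H H_props by auto
  then have "(a \<otimes> \<sigma> (inv\<^bsub>k\<^esub> c)) \<otimes> \<sigma> c \<in> N" using assms N_ideal by (auto simp: H_ideal_def)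
  moreover have "\<sigma> (inv\<^bsub>k\<^esub> c) \<otimes> \<sigma> c = \<sigma> (inv\<^bsub>k\<^esub> c \<otimes>\<^bsub>k\<^esub> c)"
    using u assms by (intro \<sigma>.hom_mult[symmetric]) auto
  then have "(a \<otimes> \<sigma> (inv\<^bsub>k\<^esub> c)) \<otimes> \<sigma> c = a"
    using u assms by (simp add: m_assoc del: \<sigma>.hom_mult)
  ultimately show False using a_N by simp
qed

lemma pow_N: assumes "x \<in> H" "a [^] (n::nat) \<otimes> x \<in> N" shows "x \<in> N"
  using assms(2)
proof (induct n)
  case 0
  then show ?case using assms H_carrier by auto
next
  case (Suc n)
  have "x \<in> carrier R" using assms H_carrier by auto
  then have "a \<otimes> (a [^] n \<otimes> x) \<in> N" using Suc by (simp add: m_ac)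
  then have "a [^] n \<otimes> x \<in> N" using N_prime[of a "a [^] n \<otimes> x"] a_N a_H a_pow_H assms H_props by blast
  then show ?case by (rule Suc.hyps)
qed

text \<open>One statement covers both that the basis stays independent over \<open>k\<close>, by
  lists of length one, and that \<open>s\<close> stays transcendental. An expression in
  \<open>J\<close> has, up to a power of \<open>a\<close>, its coordinates in \<open>N\<close>.
  Comparing coefficients first over \<open>Ker\<close> and then over \<open>H\<close> puts
  \<open>a [^] n \<otimes> \<sigma> c\<close> in \<open>N\<close>, and primality removes the power
  of \<open>a\<close>.\<close>

lemma coeffs_zero:
  assumes kss: "\<And>cs. cs \<in> set kss \<Longrightarrow> set cs \<subseteq> carrier k \<and> length cs = length es"
    and J: "horner (map (\<lambda>cs. combine (map \<sigma> cs) es) kss) s \<in> J"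
    and cs: "cs \<in> set kss"
  shows "set cs \<subseteq> {\<zero>\<^bsub>k\<^esub>}"
proof -
  define us where "us = map (\<lambda>cs. combine (map \<sigma> cs) es) kss"
  have us: "set us \<subseteq> lin_span es H"
  proof
    fix u assume "u \<in> set us"
    then obtain ds where ds: "ds \<in> set kss" "u = combine (map \<sigma> ds) es" by (auto simp: us_def)
    then have "set (map \<sigma> ds) \<subseteq> H" "length (map \<sigma> ds) = length es" using kss[OF ds(1)] \<sigma>_H by auto
    then show "u \<in> lin_span es H" unfolding lin_span_def ds(2) by blast
  qed
  have usc: "set us \<subseteq> carrier R" using span_coeffs_carrier[OF H_ideal_H us] .
  have "horner us s \<in> saturation N"
    using J genideal_subset_saturation[OF N_ideal] by (auto simp: us_def J_def)
  then obtain n :: nat and vs where vs: "set vs \<subseteq> lin_span es N" "a [^] n \<otimes> horner us s = horner vs s"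
    by (auto simp: saturation_def poly_lattice_def)
  have "horner (map ((\<otimes>) (a [^] n)) us) s = horner vs s"
    using vs usc by (simp add: horner_smult)
  moreover have "set (map ((\<otimes>) (a [^] n)) us) \<subseteq> Ker"
    using span_smult[OF H_ideal_H a_pow_H] us span_Ker[OF H_ideal_H] by auto
  moreover have "set vs \<subseteq> Ker" using vs span_Ker[OF N_ideal] by auto
  ultimately have "set (map ((\<otimes>) (a [^] n)) us) \<subseteq> set vs \<union> {\<zero>}" by (intro horner_coeffs_unique)
  then have sub: "set (map ((\<otimes>) (a [^] n)) us) \<subseteq> lin_span es N" using vs span_zero[OF N_ideal] by auto
  have "combine (map \<sigma> cs) es \<in> set us" using cs by (auto simp: us_def)
  then have "a [^] n \<otimes> combine (map \<sigma> cs) es \<in> lin_span es N" using sub by auto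
  then obtain bs where bs: "set bs \<subseteq> N" "length bs = length es" "a [^] n \<otimes> combine (map \<sigma> cs) es = combine bs es"
    by (auto simp: lin_span_def)
  have csk: "set cs \<subseteq> carrier k" "length cs = length es" using kss[OF cs] by auto
  then have sc: "set (map \<sigma> cs) \<subseteq> H" using \<sigma>_H by auto
  have "combine (map ((\<otimes>) (a [^] n)) (map \<sigma> cs)) es = combine bs es"
    unfolding bs(3)[symmetric] by (rule combine_r_distr[symmetric]) (use sc H_carrier es_carrier in auto)
  moreover have "set (map ((\<otimes>) (a [^] n)) (map \<sigma> cs)) \<subseteq> H" using sc a_pow_H H_props by auto
  moreover have "set bs \<subseteq> H" using bs N_ideal by (auto simp: H_ideal_def)
  ultimately have "map ((\<otimes>) (a [^] n)) (map \<sigma> cs) = bs"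
    using indep_over_unique[OF H_subring es_indep] bs(2) csk(2) by simp
  then have "a [^] n \<otimes> \<sigma> c \<in> N" if "c \<in> set cs" for c using bs(1) that by auto
  then have "\<sigma> c \<in> N" if "c \<in> set cs" for c using pow_N[of "\<sigma> c" n] that csk \<sigma>_H by auto
  then show ?thesis using \<sigma>_N csk by auto
qed

end

lemma set_subset_image_iff_map: "set ks \<subseteq> f ` A \<longleftrightarrow> (\<exists>cs. set cs \<subseteq> A \<and> ks = map f cs)"
proof -
  have "set ks \<subseteq> f ` A \<longleftrightarrow> ks \<in> map f ` lists A"
    unfolding lists_image[symmetric] by (simp add: lists_eq_set)
  then show ?thesis by (auto simp: lists_eq_set)
qed

context lnd_fibre
begin

definition "\<tau> = q \<circ> \<sigma>"

lemma \<tau>_hom: "\<tau> \<in> ring_hom k S"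
  unfolding \<tau>_def by (rule ring_hom_trans[OF \<sigma>_hom q.homh])

lemma q_ring_hom_ring: "ring_hom_ring R S q"
  by (rule ideal.rcos_ring_hom_ring[OF J_ideal])

lemma q_surj: assumes "x \<in> carrier S" shows "\<exists>r\<in>carrier R. x = q r"
  using assms unfolding FactRing_def A_RCOSETS_def RCOSETS_def a_r_coset_def by auto

lemma q_H: assumes "x \<in> H" shows "\<exists>c\<in>carrier k. q x = \<tau> c"
proof -
  obtain c where "c \<in> carrier k" "x \<ominus> \<sigma> c \<in> N" using residue[OF assms] by blast
  then show ?thesis using q_eq[of x "\<sigma> c"] N_J assms H_carrier by (auto simp: \<tau>_def)
qed

lemma q_H_list:
  assumes "set as \<subseteq> H"
  shows "\<exists>cs. set cs \<subseteq> carrier k \<and> length cs = length as \<and> map q as = map \<tau> cs"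
  using assms
proof (induct as)
  case (Cons x as)
  obtain c where "c \<in> carrier k" "q x = \<tau> c" using q_H[of x] Cons by auto
  moreover obtain cs where "set cs \<subseteq> carrier k \<and> length cs = length as \<and> map q as = map \<tau> cs"
    using Cons by auto
  ultimately show ?case by (intro exI[of _ "c # cs"]) simp
qed simp

lemma q_a_inverse: "\<exists>b\<in>carrier k. \<tau> b \<otimes>\<^bsub>S\<^esub> q a = \<one>\<^bsub>S\<^esub>"
proof -
  obtain c where c: "c \<in> carrier k" "a \<ominus> \<sigma> c \<in> N" using residue[OF a_H] by blast
  then have qa: "q a = \<tau> c" using q_eq[of a "\<sigma> c"] N_J by (auto simp: \<tau>_def)
  have "c \<noteq> \<zero>\<^bsub>k\<^esub>" using c a_N by (auto simp: minus_eq)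
  then have u: "c \<in> Units k" using c k.field_Units by auto
  then have "\<tau> (inv\<^bsub>k\<^esub> c) \<otimes>\<^bsub>S\<^esub> q a = \<tau> (inv\<^bsub>k\<^esub> c \<otimes>\<^bsub>k\<^esub> c)"
    using c ring_hom_mult[OF \<tau>_hom, of "inv\<^bsub>k\<^esub> c" c] by (simp add: qa)
  also have "\<dots> = \<one>\<^bsub>S\<^esub>" using u ring_hom_one[OF \<tau>_hom] by simp
  finally show ?thesis using u by auto
qed

lemma es_nonempty: "es \<noteq> []"
  using a_one a_nonzero by (auto simp: lin_span_def)

text \<open>In the zero ring the constant polynomial with all coordinates 1 would vanish, against
  \<open>coeffs_zero\<close>; the basis is nonempty because \<open>a\<close> is a nonzero element of
  its span.\<close>

lemma S_one_neq_zero: "\<one>\<^bsub>S\<^esub> \<noteq> \<zero>\<^bsub>S\<^esub>"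
proof
  assume e: "\<one>\<^bsub>S\<^esub> = \<zero>\<^bsub>S\<^esub>"
  have all: "x \<in> J" if x: "x \<in> carrier R" for x
  proof -
    have "q x = q x \<otimes>\<^bsub>S\<^esub> \<one>\<^bsub>S\<^esub>" using x by simp
    also have "\<dots> = \<zero>\<^bsub>S\<^esub>" unfolding e using x by simp
    finally show ?thesis using q_zero[OF x] by simp
  qed
  define cs where "cs = replicate (length es) \<one>\<^bsub>k\<^esub>"
  have "set (map \<sigma> cs) \<subseteq> carrier R" by (auto simp: cs_def)
  then have "combine (map \<sigma> cs) es \<in> carrier R" using es_carrier by auto
  then have "horner (map (\<lambda>cs. combine (map \<sigma> cs) es) [cs]) s \<in> J" by (intro all) auto
  then have "set cs \<subseteq> {\<zero>\<^bsub>k\<^esub>}"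
    using coeffs_zero[of "[cs]" cs] by (auto simp: cs_def)
  then show False using es_nonempty k.one_not_zero by (simp add: cs_def)
qed

definition "C = q.S.Span (\<tau> ` carrier k) (map q es)"

lemma K_subfield: "subfield (\<tau> ` carrier k) S"
  using ring_hom_ring.img_is_subfield[OF _ k.carrier_is_subfield S_one_neq_zero]
    ring_hom_ringI2[OF k.ring_axioms q.S.ring_axioms \<tau>_hom] by blast

lemma q_es_carrier: "set (map q es) \<subseteq> carrier S"
  using es_carrier by auto

lemma q_combine:
  assumes "set as \<subseteq> carrier R"
  shows "q.S.combine (map q as) (map q es) = q (combine as es)"
  by (rule ring_hom_ring.combine_hom[OF q_ring_hom_ring assms es_carrier])

lemma \<sigma>_list: "set cs \<subseteq> carrier k \<Longrightarrow> set (map \<sigma> cs) \<subseteq> H"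
  using \<sigma>_H by auto

lemma C_mem_iff: "x \<in> C \<longleftrightarrow> (\<exists>cs. set cs \<subseteq> carrier k \<and> length cs = length es \<and> x = q (combine (map \<sigma> cs) es))"
proof -
  have eq: "q.S.combine (map \<tau> cs) (map q es) = q (combine (map \<sigma> cs) es)" if "set cs \<subseteq> carrier k" for cs
    using q_combine[of "map \<sigma> cs"] \<sigma>_list[OF that] H_carrier by (simp add: \<tau>_def)
  note span = q.S.Span_mem_iff_length_version[OF K_subfield q_es_carrier, of x, folded C_def]
  show ?thesis
  proof
    assume "x \<in> C"
    then obtain ks where ks: "set ks \<subseteq> \<tau> ` carrier k" "length ks = length es" "x = q.S.combine ks (map q es)"
      unfolding span by auto
    obtain cs where "set cs \<subseteq> carrier k" "ks = map \<tau> cs"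
      using ks(1) unfolding set_subset_image_iff_map by blast
    then show "\<exists>cs. set cs \<subseteq> carrier k \<and> length cs = length es \<and> x = q (combine (map \<sigma> cs) es)"
      using ks(2,3) eq by (intro exI[of _ cs]) auto
  next
    assume "\<exists>cs. set cs \<subseteq> carrier k \<and> length cs = length es \<and> x = q (combine (map \<sigma> cs) es)"
    then obtain cs where cs: "set cs \<subseteq> carrier k" "length cs = length es" "x = q.S.combine (map \<tau> cs) (map q es)"
      using eq by auto
    then show "x \<in> C" unfolding span by (intro exI[of _ "map \<tau> cs"]) auto
  qed
qed

lemma q_span_C: assumes "v \<in> lin_span es H" shows "q v \<in> C"
proof -
  obtain as where as: "set as \<subseteq> H" "length as = length es" "v = combine as es"
    using assms by (auto simp: lin_span_def)
  obtain cs where cs: "set cs \<subseteq> carrier k" "length cs = length as" "map q as = map \<tau> cs"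
    using q_H_list[OF as(1)] by blast
  have "q v = q.S.combine (map q as) (map q es)" using q_combine as H_carrier by auto
  also have "\<dots> = q.S.combine (map q (map \<sigma> cs)) (map q es)" using cs by (simp add: \<tau>_def)
  also have "\<dots> = q (combine (map \<sigma> cs) es)"
    using q_combine[of "map \<sigma> cs"] \<sigma>_list[OF cs(1)] H_carrier by blast
  finally show ?thesis unfolding C_mem_iff using cs as by auto
qed

lemma C_lift: assumes "x \<in> C" obtains v where "v \<in> lin_span es H" "x = q v"
proof -
  obtain cs where cs: "set cs \<subseteq> carrier k" "length cs = length es" "x = q (combine (map \<sigma> cs) es)"
    using assms unfolding C_mem_iff by blast
  have "combine (map \<sigma> cs) es \<in> lin_span es H"
    unfolding lin_span_def using \<sigma>_list[OF cs(1)] cs(2) by (intro CollectI exI[of _ "map \<sigma> cs"]) auto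
  then show thesis using that cs by blast
qed

lemma span_carrier: "lin_span es H \<subseteq> carrier R"
  using span_Ker[OF H_ideal_H] Ker_carrier by blast

lemma C_carrier: "C \<subseteq> carrier S"
  by (rule subsetI, erule C_lift) (use span_carrier in auto)

lemma C_smult: "c \<in> carrier k \<Longrightarrow> x \<in> C \<Longrightarrow> \<tau> c \<otimes>\<^bsub>S\<^esub> x \<in> C"
  unfolding C_def using q.S.Span_smult_closed[OF K_subfield q_es_carrier] by blast

text \<open>In the fibre \<open>a\<close> becomes a nonzero constant of \<open>k\<close>, so an
  inclusion that held only up to the factor \<open>a\<close> holds outright.\<close>

lemma C_cancel_a:
  assumes "x \<in> carrier S" "q a \<otimes>\<^bsub>S\<^esub> x \<in> C" shows "x \<in> C"
proof -
  obtain b where b: "b \<in> carrier k" "\<tau> b \<otimes>\<^bsub>S\<^esub> q a = \<one>\<^bsub>S\<^esub>" using q_a_inverse by blast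
  have "\<tau> b \<in> carrier S" using ring_hom_closed[OF \<tau>_hom b(1)] .
  then have "\<tau> b \<otimes>\<^bsub>S\<^esub> (q a \<otimes>\<^bsub>S\<^esub> x) = x"
    using b assms(1) by (simp add: q.S.m_assoc[symmetric])
  then show ?thesis using C_smult[OF b(1) assms(2)] by simp
qed

lemma C_subring: "subring C S"
proof (rule q.S.subringI)
  show "C \<subseteq> carrier S" by (rule C_carrier)
  have "q a \<otimes>\<^bsub>S\<^esub> \<one>\<^bsub>S\<^esub> \<in> C" using q_span_C[OF a_one] by simp
  then show "\<one>\<^bsub>S\<^esub> \<in> C" by (rule C_cancel_a[rotated]) simp
next
  fix x assume "x \<in> C"
  then show "\<ominus>\<^bsub>S\<^esub> x \<in> C"
    unfolding C_def using q.S.Span_subgroup_props(4)[OF K_subfield q_es_carrier] by blast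
next
  fix x y assume xy: "x \<in> C" "y \<in> C"
  then show "x \<oplus>\<^bsub>S\<^esub> y \<in> C"
    unfolding C_def using q.S.Span_subgroup_props(3)[OF K_subfield q_es_carrier] by blast
  obtain u v where uv: "u \<in> lin_span es H" "x = q u" "v \<in> lin_span es H" "y = q v"
    using xy C_lift by metis
  have [simp]: "u \<in> carrier R" "v \<in> carrier R" using uv span_carrier by auto
  \<comment> \<open>\<open>a_mult\<close> concerns two basis elements; linearity extends it to
    \<open>u\<close> in one factor, and after an exchange by commutativity to \<open>v\<close> in
    the other.\<close>
  have "(a \<otimes> u) \<otimes> e \<in> lin_span es H" if e: "e \<in> set es" for e
  proof -
    have ec: "e \<in> carrier R" using e es_carrier by auto
    have "(a \<otimes> e) \<otimes> u \<in> lin_span es H"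
      using span_gen_mult[OF H_ideal_H ec a_mult[OF e] uv(1)] by simp
    then show ?thesis using ec by (simp add: m_ac)
  qed
  then have "(a \<otimes> u) \<otimes> v \<in> lin_span es H" by (intro span_gen_mult[OF H_ideal_H _ _ uv(3)]) auto
  then have "q ((a \<otimes> u) \<otimes> v) \<in> C" by (rule q_span_C)
  then have "q a \<otimes>\<^bsub>S\<^esub> (x \<otimes>\<^bsub>S\<^esub> y) \<in> C" using uv by (simp add: q.S.m_assoc)
  moreover have "x \<otimes>\<^bsub>S\<^esub> y \<in> carrier S" using uv by simp
  ultimately show "x \<otimes>\<^bsub>S\<^esub> y \<in> C" by (rule C_cancel_a[rotated])
qed

lemma C_list_lift:
  assumes "set ws \<subseteq> C"
  shows "\<exists>kss. (\<forall>cs\<in>set kss. set cs \<subseteq> carrier k \<and> length cs = length es)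
     \<and> ws = map q (map (\<lambda>cs. combine (map \<sigma> cs) es) kss)"
  using assms
proof (induct ws)
  case (Cons w ws)
  obtain cs where "set cs \<subseteq> carrier k" "length cs = length es" "w = q (combine (map \<sigma> cs) es)"
    using Cons C_mem_iff by auto
  moreover obtain kss where "(\<forall>cs\<in>set kss. set cs \<subseteq> carrier k \<and> length cs = length es)
     \<and> ws = map q (map (\<lambda>cs. combine (map \<sigma> cs) es) kss)" using Cons by auto
  ultimately show ?case by (intro exI[of _ "cs # kss"]) auto
qed simp

lemma combine_zero_coeffs:
  assumes "set cs \<subseteq> {\<zero>\<^bsub>k\<^esub>}" shows "combine (map \<sigma> cs) es = \<zero>"
proof -
  have "combine ks us = \<zero>" if "set ks \<subseteq> {\<zero>}" "set us \<subseteq> carrier R" for ks us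
    using that by (induct ks us rule: combine.induct) auto
  moreover have "set (map \<sigma> cs) \<subseteq> {\<zero>}" using assms by auto
  ultimately show ?thesis using es_carrier by blast
qed

lemma lifted_horner:
  assumes kss: "\<And>cs. cs \<in> set kss \<Longrightarrow> set cs \<subseteq> carrier k \<and> length cs = length es"
    and z: "q.S.horner (map q (map (\<lambda>cs. combine (map \<sigma> cs) es) kss)) (q s) = \<zero>\<^bsub>S\<^esub>"
    and cs: "cs \<in> set kss"
  shows "set cs \<subseteq> {\<zero>\<^bsub>k\<^esub>}"
proof -
  define us where "us = map (\<lambda>cs. combine (map \<sigma> cs) es) kss"
  have us: "set us \<subseteq> carrier R"
  proof
    fix u assume "u \<in> set us"
    then obtain ds where "ds \<in> set kss" "u = combine (map \<sigma> ds) es" by (auto simp: us_def)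
    then show "u \<in> carrier R" using \<sigma>_list[of ds] kss[of ds] H_carrier es_carrier by auto
  qed
  have "q (horner us s) = \<zero>\<^bsub>S\<^esub>" using q.horner_hom[OF us s_closed] z by (simp add: us_def)
  then have "horner us s \<in> J" using q_zero us by auto
  then show ?thesis using coeffs_zero[OF kss _ cs] by (simp add: us_def)
qed

lemma q_es_independent: "q.S.independent (\<tau> ` carrier k) (map q es)"
proof (rule ccontr)
  assume "\<not> q.S.independent (\<tau> ` carrier k) (map q es)"
  then obtain Ks where Ks: "length Ks = length (map q es)" "q.S.combine Ks (map q es) = \<zero>\<^bsub>S\<^esub>"
    "set Ks \<subseteq> \<tau> ` carrier k" "set Ks \<noteq> {\<zero>\<^bsub>S\<^esub>}"
    using q.S.dependent_imp_non_trivial_combine[OF K_subfield q_es_carrier] by blast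
  obtain cs where cs: "set cs \<subseteq> carrier k" "Ks = map \<tau> cs"
    using Ks(3) unfolding set_subset_image_iff_map by blast
  have len: "length cs = length es" using cs Ks by simp
  have sc: "set (map \<sigma> cs) \<subseteq> carrier R" using \<sigma>_list[OF cs(1)] H_carrier by blast
  have qz: "q (combine (map \<sigma> cs) es) = \<zero>\<^bsub>S\<^esub>"
    using q_combine[OF sc] Ks(2) cs by (simp add: \<tau>_def)
  have cc: "combine (map \<sigma> cs) es \<in> carrier R" using sc es_carrier by auto
  \<comment> \<open>Independence is the case of a constant polynomial in
    \<open>lifted_horner\<close>.\<close>
  have "q.S.horner (map q (map (\<lambda>cs. combine (map \<sigma> cs) es) [cs])) (q s) = \<zero>\<^bsub>S\<^esub>"
    using qz by simp
  then have "set cs \<subseteq> {\<zero>\<^bsub>k\<^esub>}" using lifted_horner[where kss = "[cs]" and cs = cs] cs len by auto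
  then have "set Ks \<subseteq> {\<zero>\<^bsub>S\<^esub>}" using cs ring_hom_zero[OF \<tau>_hom k.ring_axioms q.S.ring_axioms] by auto
  moreover have "Ks \<noteq> []" using Ks(1) es_nonempty by auto
  ultimately show False using Ks(4) by (cases Ks) auto
qed

lemma q_a_pow_inverse: "\<exists>b\<in>carrier k. \<tau> b \<otimes>\<^bsub>S\<^esub> q (a [^] (n::nat)) = \<one>\<^bsub>S\<^esub>"
proof (induct n)
  case 0
  then show ?case using ring_hom_one[OF \<tau>_hom] by (intro bexI[of _ "\<one>\<^bsub>k\<^esub>"]) auto
next
  case (Suc n)
  then obtain b where b: "b \<in> carrier k" "\<tau> b \<otimes>\<^bsub>S\<^esub> q (a [^] n) = \<one>\<^bsub>S\<^esub>" by blast
  obtain c where c: "c \<in> carrier k" "\<tau> c \<otimes>\<^bsub>S\<^esub> q a = \<one>\<^bsub>S\<^esub>" using q_a_inverse by blast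
  have [simp]: "\<tau> b \<in> carrier S" "\<tau> c \<in> carrier S" using ring_hom_closed[OF \<tau>_hom] b c by auto
  have "q (a [^] Suc n) = q (a [^] n) \<otimes>\<^bsub>S\<^esub> q a" using q.hom_mult[of "a [^] n" a] by simp
  then have "\<tau> (b \<otimes>\<^bsub>k\<^esub> c) \<otimes>\<^bsub>S\<^esub> q (a [^] Suc n)
      = (\<tau> b \<otimes>\<^bsub>S\<^esub> \<tau> c) \<otimes>\<^bsub>S\<^esub> (q (a [^] n) \<otimes>\<^bsub>S\<^esub> q a)"
    using ring_hom_mult[OF \<tau>_hom b(1) c(1)] by simp
  also have "\<dots> = (\<tau> b \<otimes>\<^bsub>S\<^esub> q (a [^] n)) \<otimes>\<^bsub>S\<^esub> (\<tau> c \<otimes>\<^bsub>S\<^esub> q a)"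
    by (simp add: q.S.m_ac)
  also have "\<dots> = \<one>\<^bsub>S\<^esub>" using b c by simp
  finally show ?case using b c by blast
qed

text \<open>Generation comes from \<open>saturation_H\<close>, freeness from
  \<open>coeffs_zero\<close>; separability holds because the value of the derivative divides
  \<open>a\<close>, which is a unit in the fibre.\<close>

theorem fibre_lines: "disjoint_union_of_affine_lines k \<tau> S (length es)"
proof -
  have "separable_fibre S k \<tau> C (map q es) (q s)"
  proof (intro separable_fibre.intro closed_field_hom.intro closed_field_hom_axioms.intro separable_fibre_axioms.intro)
    show "cring S" by (rule q.S.is_cring)
    show "algebraically_closed k" by (rule k.algebraically_closed_axioms)
    show "\<tau> \<in> ring_hom k S" by (rule \<tau>_hom)
    show "\<one>\<^bsub>S\<^esub> \<noteq> \<zero>\<^bsub>S\<^esub>" by (rule S_one_neq_zero)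
    show "subring C S" by (rule C_subring)
    show "C = q.S.Span (\<tau> ` carrier k) (map q es)" by (rule C_def)
    show "q.S.independent (\<tau> ` carrier k) (map q es)" by (rule q_es_independent)
    show "q s \<in> carrier S" by simp
  next
    fix x assume "x \<in> carrier S"
    then obtain r where r: "r \<in> carrier R" "x = q r" using q_surj by blast
    obtain n :: nat and ws where ws: "set ws \<subseteq> lin_span es H" "a [^] n \<otimes> r = horner ws s"
    proof -
      have "r \<in> saturation H" using r(1) saturation_H by simp
      then show thesis using that by (auto simp: saturation_def poly_lattice_def)
    qed
    obtain b where b: "b \<in> carrier k" "\<tau> b \<otimes>\<^bsub>S\<^esub> q (a [^] n) = \<one>\<^bsub>S\<^esub>" using q_a_pow_inverse by blast
    have bc: "\<tau> b \<in> carrier S" using ring_hom_closed[OF \<tau>_hom b(1)] .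
    have wc: "set ws \<subseteq> carrier R" using ws span_carrier by auto
    then have qwc: "set (map q ws) \<subseteq> carrier S" by auto
    have "x = \<tau> b \<otimes>\<^bsub>S\<^esub> (q (a [^] n) \<otimes>\<^bsub>S\<^esub> q r)"
    proof -
      have "q (a [^] n) \<in> carrier S" "q r \<in> carrier S" using r by auto
      then show ?thesis using b(2) bc r(2) q.S.m_assoc q.S.l_one by metis
    qed
    also have "q (a [^] n) \<otimes>\<^bsub>S\<^esub> q r = q (horner ws s)" using ws(2) r q.hom_mult[of "a [^] n" r] by simp
    also have "q (horner ws s) = q.S.horner (map q ws) (q s)" by (rule q.horner_hom[OF wc s_closed])
    also have "\<tau> b \<otimes>\<^bsub>S\<^esub> q.S.horner (map q ws) (q s) = q.S.horner (map ((\<otimes>\<^bsub>S\<^esub>) (\<tau> b)) (map q ws)) (q s)"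
      using q.S.horner_smult[OF qwc bc, of "q s"] by simp
    finally have "x = q.S.horner (map ((\<otimes>\<^bsub>S\<^esub>) (\<tau> b)) (map q ws)) (q s)" .
    moreover have "set (map ((\<otimes>\<^bsub>S\<^esub>) (\<tau> b)) (map q ws)) \<subseteq> C"
      using ws(1) q_span_C C_smult[OF b(1)] by auto
    ultimately show "\<exists>ws. set ws \<subseteq> C \<and> x = q.S.horner ws (q s)" by blast
  next
    fix ws assume ws: "set ws \<subseteq> C" "q.S.horner ws (q s) = \<zero>\<^bsub>S\<^esub>"
    obtain kss where kss: "\<And>cs. cs \<in> set kss \<Longrightarrow> set cs \<subseteq> carrier k \<and> length cs = length es"
      and wk: "ws = map q (map (\<lambda>cs. combine (map \<sigma> cs) es) kss)"
      using C_list_lift[OF ws(1)] by blast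
    have "set cs \<subseteq> {\<zero>\<^bsub>k\<^esub>}" if "cs \<in> set kss" for cs
      using lifted_horner[OF kss _ that] ws(2) wk by simp
    then show "set ws \<subseteq> {\<zero>\<^bsub>S\<^esub>}" unfolding wk using combine_zero_coeffs q.hom_zero by auto
  next
    fix e assume "e \<in> set (map q es)"
    then obtain f where f: "f \<in> set es" "e = q f" by auto
    have fc: "f \<in> carrier R" using f es_carrier by auto
    obtain hs c where hs: "set hs \<subseteq> H" "horner hs f = \<zero>" "c \<in> carrier R" "c \<otimes> horner_deriv hs f = a"
      using a_sep[OF f(1)] by blast
    have hc: "set hs \<subseteq> carrier R" using hs H_carrier by auto
    obtain cs where cs: "set cs \<subseteq> carrier k" "map q hs = map \<tau> cs" using q_H_list[OF hs(1)] by blast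
    have 1: "q.S.horner (map \<tau> cs) e = \<zero>\<^bsub>S\<^esub>"
      using q.horner_hom[OF hc fc] hs(2) cs f by simp
    have d: "q (horner_deriv hs f) = q.S.horner_deriv (map \<tau> cs) e"
      using q.horner_deriv_hom[OF hc fc] cs f by simp
    have dc: "horner_deriv hs f \<in> carrier R" using hc fc by auto
    obtain b where b: "b \<in> carrier k" "\<tau> b \<otimes>\<^bsub>S\<^esub> q a = \<one>\<^bsub>S\<^esub>" using q_a_inverse by blast
    have bc: "\<tau> b \<in> carrier S" using ring_hom_closed[OF \<tau>_hom b(1)] .
    have "q a = q c \<otimes>\<^bsub>S\<^esub> q (horner_deriv hs f)" using hs(3,4) dc q.hom_mult by metis
    then have "(\<tau> b \<otimes>\<^bsub>S\<^esub> q c) \<otimes>\<^bsub>S\<^esub> q (horner_deriv hs f) = \<one>\<^bsub>S\<^esub>"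
      using b bc hs(3) dc by (simp add: q.S.m_assoc)
    moreover have "\<tau> b \<otimes>\<^bsub>S\<^esub> q c \<in> carrier S" "q (horner_deriv hs f) \<in> carrier S"
      using bc hs(3) dc by auto
    moreover from calculation have "q (horner_deriv hs f) \<otimes>\<^bsub>S\<^esub> (\<tau> b \<otimes>\<^bsub>S\<^esub> q c) = \<one>\<^bsub>S\<^esub>"
      using q.S.m_comm by metis
    ultimately have "q (horner_deriv hs f) \<in> Units S"
      unfolding Units_def by blast
    then show "\<exists>hs. set hs \<subseteq> carrier k \<and> q.S.horner (map \<tau> hs) e = \<zero>\<^bsub>S\<^esub> \<and> q.S.horner_deriv (map \<tau> hs) e \<in> Units S"
      using cs 1 d by metis
  qed
  from separable_fibre.disjoint_union_of_lines[OF this] show ?thesis by simp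
qed

end

section \<open>Zariski's lemma\<close>

context field
begin

text \<open>The fraction field of \<open>H\<close>, realised inside the given field by the elements
  that have a denominator in \<open>H\<close>.\<close>

lemma fractions_subfield:
  assumes H: "subring H R"
  shows "subfield {f \<in> carrier R. \<exists>v\<in>H - {\<zero>}. v \<otimes> f \<in> H} R" (is "subfield ?F R")
proof (rule subfieldI')
  note Hp = subringE[OF H]
  have Hc: "x \<in> carrier R" if "x \<in> H" for x using Hp(1) that by auto
  show "subring ?F R"
  proof (rule subringI)
    show "\<one> \<in> ?F" using Hp(3) one_not_zero by (auto intro!: bexI[of _ \<one>])
  next
    fix f assume "f \<in> ?F"
    then obtain v where v: "v \<in> H - {\<zero>}" "v \<otimes> f \<in> H" "f \<in> carrier R" by blast
    then have "v \<otimes> (\<ominus> f) \<in> H" using Hp(5) Hc by (simp add: r_minus)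
    then show "\<ominus> f \<in> ?F" using v by blast
  next
    fix f g assume "f \<in> ?F" "g \<in> ?F"
    then obtain u v where uv: "u \<in> H - {\<zero>}" "u \<otimes> f \<in> H" "f \<in> carrier R" "v \<in> H - {\<zero>}" "v \<otimes> g \<in> H" "g \<in> carrier R"
      by blast
    have c [simp]: "u \<in> carrier R" "v \<in> carrier R" "f \<in> carrier R" "g \<in> carrier R" using uv Hc by auto
    have nz: "u \<otimes> v \<in> H - {\<zero>}" using uv Hp(6) by (auto simp: integral_iff)
    have "(u \<otimes> v) \<otimes> (f \<otimes> g) = (u \<otimes> f) \<otimes> (v \<otimes> g)" by (simp add: m_ac)
    then have 1: "(u \<otimes> v) \<otimes> (f \<otimes> g) \<in> H" using Hp(6)[OF uv(2,5)] by simp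
    have "(u \<otimes> v) \<otimes> (f \<oplus> g) = v \<otimes> (u \<otimes> f) \<oplus> u \<otimes> (v \<otimes> g)" by (simp add: r_distr m_ac)
    then have 2: "(u \<otimes> v) \<otimes> (f \<oplus> g) \<in> H" using Hp(6,7) uv by simp
    show "f \<otimes> g \<in> ?F" "f \<oplus> g \<in> ?F" using nz 1 2 c by blast+
  qed auto
  fix f assume "f \<in> ?F - {\<zero>}"
  then obtain v where v: "v \<in> H - {\<zero>}" "v \<otimes> f \<in> H" "f \<in> carrier R" "f \<noteq> \<zero>" by blast
  then have fU: "f \<in> Units R" by (simp add: field_Units)
  have vc: "v \<in> carrier R" using v Hc by auto
  have "(v \<otimes> f) \<otimes> inv f = v" using v vc fU by (simp add: m_assoc)
  moreover have "v \<otimes> f \<noteq> \<zero>" using v vc by (auto simp: integral_iff)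
  ultimately show "inv f \<in> ?F" using v fU by (auto intro!: bexI[of _ "v \<otimes> f"])
qed

text \<open>If \<open>x\<close> were transcendental, the ring would be contained in a finite free module over some
  \<open>K[x, 1/a]\<close>, so that \<open>1 + x a\<close> would divide a power of \<open>a\<close> in \<open>K[x]\<close>.\<close>

lemma finitely_generated_imp_algebraic:
  assumes K: "subfield K R" and x: "x \<in> carrier R" and S: "finite S" "S \<subseteq> carrier R"
    and gen: "carrier R = generate_ring R (simple_extension K x \<union> S)"
    and dim: "\<And>F. subfield F R \<Longrightarrow> simple_extension K x \<subseteq> F \<Longrightarrow> \<exists>n. dimension n F (carrier R)"
  shows "(algebraic over K) x"
proof (rule ccontr)
  assume "\<not> (algebraic over K) x"
  then have inj: "inj_on (\<lambda>p. eval p x) (carrier (K[X]))"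
    by (simp add: transcendental_def over_def)
  have Ksub: "subring K R" using subfieldE(1)[OF K] .
  define H where "H = simple_extension K x"
  have H: "subring H R" unfolding H_def by (rule simple_extension_is_subring[OF Ksub x])
  note Hp = subringE[OF H]
  have Hc: "y \<in> carrier R" if "y \<in> H" for y using Hp(1) that by auto
  have xH: "x \<in> H" unfolding H_def by (rule simple_extension_mem[OF Ksub x])
  define F where "F = {f \<in> carrier R. \<exists>v\<in>H - {\<zero>}. v \<otimes> f \<in> H}"
  have F: "subfield F R" unfolding F_def by (rule fractions_subfield[OF H])
  have HF: "H \<subseteq> F" using Hp(1,3) one_not_zero by (auto simp: F_def intro!: bexI[of _ \<one>])
  have Fc: "F \<subseteq> carrier R" by (auto simp: F_def)
  obtain n where "dimension n F (carrier R)" using dim[OF F] HF by (auto simp: H_def)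
  then obtain es where es: "set es \<subseteq> carrier R" "independent F es" "Span F es = carrier R"
    using exists_base[OF F] by blast
  \<comment> \<open>A common denominator for the matrices of all generators in the basis
    \<open>es\<close>.\<close>
  have "\<exists>a\<in>H - {\<zero>}. \<forall>(g, e)\<in>S \<times> set es. a \<otimes> (g \<otimes> e) \<in> lin_span es H"
  proof (rule common_multiple[OF H])
    show "finite (S \<times> set es)" using S by simp
  next
    fix i assume "i \<in> S \<times> set es"
    then obtain g e where i: "i = (g, e)" "g \<in> carrier R" "e \<in> carrier R" using S es by auto
    then have "g \<otimes> e \<in> Span F es" using es by simp
    then obtain fs where fs: "set fs \<subseteq> F" "length fs = length es" "g \<otimes> e = combine fs es"
      using Span_mem_iff_length_version[OF F es(1)] by auto
    have "\<exists>a\<in>H - {\<zero>}. \<forall>f\<in>set fs. a \<otimes> f \<in> H"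
    proof (rule common_multiple[OF H])
      fix f assume "f \<in> set fs"
      then show "\<exists>a\<in>H - {\<zero>}. a \<otimes> f \<in> H" using fs by (auto simp: F_def)
    next
      fix f a b assume "f \<in> set fs" "a \<otimes> f \<in> H" "a \<in> H - {\<zero>}" "b \<in> H - {\<zero>}"
      moreover have "f \<in> carrier R" using \<open>f \<in> set fs\<close> fs Fc by auto
      ultimately show "(b \<otimes> a) \<otimes> f \<in> H" using Hp(6) Hc by (simp add: m_assoc)
    qed auto
    then obtain a where a: "a \<in> H - {\<zero>}" "\<And>f. f \<in> set fs \<Longrightarrow> a \<otimes> f \<in> H" by blast
    have "a \<otimes> (g \<otimes> e) = combine (map ((\<otimes>) a) fs) es"
      unfolding fs(3) by (rule combine_r_distr) (use fs Fc es a Hc in auto)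
    then have "a \<otimes> (g \<otimes> e) \<in> lin_span es H"
      unfolding lin_span_def using a(2) fs(2) by (intro CollectI exI[of _ "map ((\<otimes>) a) fs"]) auto
    then show "\<exists>a\<in>H - {\<zero>}. case i of (g, e) \<Rightarrow> a \<otimes> (g \<otimes> e) \<in> lin_span es H"
      unfolding i(1) prod.case using a(1) by blast
  next
    fix i a b assume i: "i \<in> S \<times> set es" "case i of (g, e) \<Rightarrow> a \<otimes> (g \<otimes> e) \<in> lin_span es H"
      and ab: "a \<in> H - {\<zero>}" "b \<in> H - {\<zero>}"
    obtain g e where ge: "i = (g, e)" by (cases i)
    have "g \<in> carrier R" "e \<in> carrier R" "a \<in> carrier R" "b \<in> carrier R" using i ge S es ab Hc by auto
    moreover have "b \<otimes> (a \<otimes> (g \<otimes> e)) \<in> lin_span es H"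
      using lin_span_smult[OF es(1) Hp(1), of b "a \<otimes> (g \<otimes> e)"] i(2) ab Hc Hp(6)
      unfolding ge prod.case by auto
    ultimately show "case i of (g, e) \<Rightarrow> (b \<otimes> a) \<otimes> (g \<otimes> e) \<in> lin_span es H"
      unfolding ge prod.case by (simp add: m_assoc)
  qed
  then obtain a where a: "a \<in> H - {\<zero>}" "\<And>g e. g \<in> S \<Longrightarrow> e \<in> set es \<Longrightarrow> a \<otimes> (g \<otimes> e) \<in> lin_span es H"
    by blast
  have [simp]: "a \<in> carrier R" using a Hc by auto
  have apH: "a [^] (i::nat) \<in> H" for i
    by (induct i) (use a Hp in auto)
  define V where "V = lin_span es H"
  have Vc: "v \<in> carrier R" if "v \<in> V" for v
    using that Hp(1) es(1) by (auto simp: V_def lin_span_def intro!: combine_in_carrier)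
  have Vs: "b \<otimes> v \<in> V" if "b \<in> H" "v \<in> V" for b v
    using that lin_span_smult[OF es(1) Hp(1), of b v] Hp(6) Hc by (auto simp: V_def)
  have Va: "u \<oplus> v \<in> V" if "u \<in> V" "v \<in> V" for u v
    using that lin_span_add[OF es(1) Hp(1), of u v] Hp(7) by (auto simp: V_def)
  have Vz: "\<zero> \<in> V"
    using combine_replicate[OF es(1)] Hp(2) unfolding V_def lin_span_def
    by (intro CollectI exI[of _ "replicate (length es) \<zero>"]) (auto dest: in_set_replicate[THEN iffD1])
  have Vg: "a \<otimes> (g \<otimes> v) \<in> V" if g: "g \<in> S" and v: "v \<in> V" for g v
  proof -
    have gc: "g \<in> carrier R" using g S by auto
    obtain bs where bs: "set bs \<subseteq> H" "v = combine bs es" using v by (auto simp: V_def lin_span_def)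
    have "a \<otimes> (g \<otimes> combine bs fs) \<in> V" if "set fs \<subseteq> set es" for fs
      using bs(1) that
    proof (induct bs fs rule: combine.induct)
      case (1 b bs f fs)
      have c: "b \<in> carrier R" "f \<in> carrier R" "set bs \<subseteq> carrier R" "set fs \<subseteq> carrier R"
        using 1 Hp(1) es(1) by auto
      then have c': "combine bs fs \<in> carrier R" by auto
      have "a \<otimes> (g \<otimes> combine (b # bs) (f # fs)) = b \<otimes> (a \<otimes> (g \<otimes> f)) \<oplus> a \<otimes> (g \<otimes> combine bs fs)"
        using c c' gc by (simp add: r_distr m_ac)
      moreover have "b \<otimes> (a \<otimes> (g \<otimes> f)) \<in> V"
        using 1 a(2)[OF g, of f] Vs[of b "a \<otimes> (g \<otimes> f)"] by (auto simp: V_def)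
      ultimately show ?case using 1 Va by simp
    qed (use gc Vz in auto)
    then show ?thesis using bs by simp
  qed
  \<comment> \<open>The localized module V[1/a] seen inside the field. It is stable under the
    generators, hence under the whole field.\<close>
  define T where "T = {r \<in> carrier R. \<exists>n::nat. a [^] n \<otimes> r \<in> V}"
  have Tc: "r \<in> carrier R" if "r \<in> T" for r using that by (simp add: T_def)
  have Ts: "b \<otimes> r \<in> T" if b: "b \<in> H" and r: "r \<in> T" for b r
  proof -
    obtain n :: nat where n: "a [^] n \<otimes> r \<in> V" using r by (auto simp: T_def)
    have "a [^] n \<otimes> (b \<otimes> r) = b \<otimes> (a [^] n \<otimes> r)" using Tc[OF r] Hc[OF b] by (simp add: m_ac)
    then have "a [^] n \<otimes> (b \<otimes> r) \<in> V" using Vs[OF b n] by simp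
    then show ?thesis using Tc[OF r] Hc[OF b] unfolding T_def by blast
  qed
  have Ta: "r \<oplus> t \<in> T" if r: "r \<in> T" and t: "t \<in> T" for r t
  proof -
    obtain n m :: nat where nm: "a [^] n \<otimes> r \<in> V" "a [^] m \<otimes> t \<in> V" using r t by (auto simp: T_def)
    have "a [^] (n + m) \<otimes> (r \<oplus> t) = a [^] m \<otimes> (a [^] n \<otimes> r) \<oplus> a [^] n \<otimes> (a [^] m \<otimes> t)"
      using Tc[OF r] Tc[OF t] by (simp add: nat_pow_mult[symmetric] r_distr m_ac)
    then have "a [^] (n + m) \<otimes> (r \<oplus> t) \<in> V"
      using Va[OF Vs[OF apH nm(1)] Vs[OF apH nm(2)]] by simp
    then show ?thesis using Tc[OF r] Tc[OF t] unfolding T_def by blast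
  qed
  have Tg: "g \<otimes> r \<in> T" if g: "g \<in> S" and r: "r \<in> T" for g r
  proof -
    have gc: "g \<in> carrier R" using g S by auto
    obtain n :: nat where n: "a [^] n \<otimes> r \<in> V" using r by (auto simp: T_def)
    have "a [^] Suc n \<otimes> (g \<otimes> r) = a \<otimes> (g \<otimes> (a [^] n \<otimes> r))" using Tc[OF r] gc by (simp add: m_ac)
    then have "a [^] Suc n \<otimes> (g \<otimes> r) \<in> V" using Vg[OF g n] by simp
    moreover have "g \<otimes> r \<in> carrier R" using Tc[OF r] gc by simp
    ultimately show ?thesis unfolding T_def by blast
  qed
  define E where "E = {r \<in> carrier R. \<forall>t\<in>T. r \<otimes> t \<in> T}"
  have "subring E R"
  proof (rule subringI)
    fix h assume h: "h \<in> E"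
    have "(\<ominus> h) \<otimes> t \<in> T" if t: "t \<in> T" for t
    proof -
      have "\<ominus> \<one> \<in> H" using Hp(3,5) by auto
      then have "(\<ominus> \<one>) \<otimes> (h \<otimes> t) \<in> T" using h t Ts by (auto simp: E_def)
      then show ?thesis using Tc[OF t] h by (simp add: l_minus E_def)
    qed
    then show "\<ominus> h \<in> E" using h by (auto simp: E_def)
  next
    fix h1 h2 assume h: "h1 \<in> E" "h2 \<in> E"
    then show "h1 \<otimes> h2 \<in> E" using Tc by (auto simp: E_def m_assoc)
    show "h1 \<oplus> h2 \<in> E" using h Tc Ta by (auto simp: E_def l_distr)
  qed (use Tc in \<open>auto simp: E_def\<close>)
  moreover have "H \<union> S \<subseteq> E" using Ts Tg Hc S by (auto simp: E_def)
  ultimately have "carrier R \<subseteq> E"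
    unfolding gen H_def[symmetric] using Hp(1) S by (intro generate_ring_min_subring1) auto
  have "es \<noteq> []"
  proof
    assume "es = []"
    then have "carrier R = {\<zero>}" using es(3) by simp
    then show False using one_not_zero one_closed by blast
  qed
  then obtain e es' where e: "es = e # es'" by (cases es) auto
  have ec: "e \<in> carrier R" "set es' \<subseteq> carrier R" using es(1) e by auto
  have e1: "combine (b # replicate (length es') \<zero>) es = b \<otimes> e" if "b \<in> carrier R" for b
    using combine_replicate[OF ec(2)] ec that e by simp
  have rz: "set (b # replicate m \<zero>) \<subseteq> H" if "b \<in> H" for b m
    using that Hp(2) by auto
  have "\<one> \<otimes> e \<in> V"
    using e1[of \<one>] rz[OF Hp(3), of "length es'"] e unfolding V_def lin_span_def
    by (intro CollectI exI[of _ "\<one> # replicate (length es') \<zero>"]) auto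
  then have eT: "e \<in> T" using ec unfolding T_def by (auto intro!: exI[of _ "0::nat"])
  \<comment> \<open>Euclid's choice: \<open>u\<close> is coprime to \<open>a\<close> and not
    constant, so it is no unit of K[x] with 1/a adjoined, although it is invertible in the
    field.\<close>
  define u where "u = \<one> \<oplus> x \<otimes> a"
  have uH: "u \<in> H" using xH a Hp(3,6,7) by (auto simp: u_def)
  have uc [simp]: "u \<in> carrier R" "x \<in> carrier R" using uH Hc x by auto
  obtain p where p: "p \<in> carrier (K[X])" "a = eval p x"
    using a simple_extension_as_eval_img[OF subringE(1)[OF Ksub] x] by (auto simp: H_def)
  have pn: "p \<noteq> []" using p a by auto
  have pK: "set p \<subseteq> K" using p(1) polynomial_incl by (simp add: univ_poly_carrier[symmetric])
  have pc: "set p \<subseteq> carrier R" using pK subringE(1)[OF Ksub] by auto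
  \<comment> \<open>Coefficients are listed from the top, so this is X p + 1, of positive
    degree.\<close>
  define P where "P = p @ [\<one>]"
  have P: "P \<in> carrier (K[X])"
    using p(1) pn subringE(3)[OF Ksub] by (auto simp: P_def univ_poly_carrier[symmetric] polynomial_def)
  have Pu: "eval P x = u"
    using eval_append[OF pc _ x, of "[\<one>]"] p(2)[symmetric] m_comm[of a x] a_comm[of "x \<otimes> a" \<one>]
    by (simp add: P_def u_def)
  have noinv: False if w: "w \<in> H" "u \<otimes> w = \<one>" for w
  proof -
    obtain r where r: "r \<in> carrier (K[X])" "w = eval r x"
      using w simple_extension_as_eval_img[OF subringE(1)[OF Ksub] x] by (auto simp: H_def)
    interpret UP: domain "K[X]" by (rule univ_poly_is_domain[OF Ksub])
    have "eval (P \<otimes>\<^bsub>K[X]\<^esub> r) x = \<one>"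
      using ring_hom_mult[OF eval_is_hom[OF Ksub x] P r(1)] Pu r w by simp
    moreover have "eval \<one>\<^bsub>K[X]\<^esub> x = \<one>" using x by (simp add: univ_poly_one)
    ultimately have one: "P \<otimes>\<^bsub>K[X]\<^esub> r = \<one>\<^bsub>K[X]\<^esub>"
      using inj P r by (intro inj_onD[OF inj]) auto
    have rn: "r \<noteq> []"
    proof
      assume "r = []"
      then have "w = \<zero>" using r by simp
      then show False using w by simp
    qed
    have "degree (P \<otimes>\<^bsub>K[X]\<^esub> r) = degree P + degree r"
      using poly_mult_degree_eq[OF Ksub, of P r] P r rn by (simp add: univ_poly_mult univ_poly_carrier P_def)
    then show False using one pn by (simp add: univ_poly_one P_def)
  qed
  have "u \<noteq> \<zero>"
  proof
    assume "u = \<zero>"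
    then have "eval P x = eval [] x" using Pu by simp
    then have "P = []" using inj_onD[OF inj _ P, of "[]"] by (auto simp: univ_poly_zero_closed)
    then show False by (simp add: P_def)
  qed
  then have uU: "u \<in> Units R" by (simp add: field_Units)
  then have "inv u \<otimes> e \<in> T" using \<open>carrier R \<subseteq> E\<close> eT by (auto simp: E_def)
  then obtain n :: nat where "a [^] n \<otimes> (inv u \<otimes> e) \<in> V" by (auto simp: T_def)
  then obtain cs where cs: "set cs \<subseteq> H" "length cs = length es" "a [^] n \<otimes> (inv u \<otimes> e) = combine cs es"
    by (auto simp: V_def lin_span_def)
  \<comment> \<open>The quotient of a power of \<open>a\<close> by \<open>u\<close>. Comparing
    coordinates at the first basis element shows that it lies in \<open>H\<close>, so
    \<open>u\<close> divides \<open>a [^] n\<close> in \<open>H\<close>.\<close>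
  define b where "b = a [^] n \<otimes> inv u"
  have bc: "b \<in> carrier R" using uU by (simp add: b_def)
  have ub: "u \<otimes> b = a [^] n" using uU m_lcomm[of u "a [^] n" "inv u"] by (simp add: b_def)
  have bF: "b \<in> F"
    using uH \<open>u \<noteq> \<zero>\<close> ub apH bc unfolding F_def by (auto intro!: bexI[of _ u])
  have "combine (b # replicate (length es') \<zero>) es = combine cs es"
    using e1[OF bc] cs(3) ec uU by (simp add: b_def m_assoc)
  have bH: "b \<in> H"
  proof -
    obtain c cs' where c: "cs = c # cs'" using cs(2) e by (cases cs) auto
    have cc: "c \<in> H" "c \<in> carrier R" "set cs' \<subseteq> carrier R" "set cs' \<subseteq> F" using cs(1) c Hp(1) HF by auto
    have ce: "combine cs' es' \<in> carrier R" using cc ec by auto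
    have eq: "b \<otimes> e = c \<otimes> e \<oplus> combine cs' es'" using e1[OF bc] \<open>combine (b # replicate (length es') \<zero>) es = combine cs es\<close> c e by simp
    have "(b \<ominus> c) \<otimes> e = combine cs' es'"
    proof -
      have "(b \<ominus> c) \<otimes> e = (c \<otimes> e \<oplus> combine cs' es') \<ominus> c \<otimes> e"
        using bc cc ec by (simp add: minus_eq l_distr l_minus eq)
      also have "\<dots> = combine cs' es'" using ce cc ec by (simp add: minus_eq a_ac r_neg1 r_neg)
      finally show ?thesis .
    qed
    then have "combine ((b \<ominus> c) # map (\<lambda>x. \<ominus> x) cs') es = \<zero>"
      using combine_uminus[OF cc(3) ec(2)] e ce by (simp add: r_neg)
    moreover have "set ((b \<ominus> c) # map (\<lambda>x. \<ominus> x) cs') \<subseteq> F"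
      using bF cc HF subringE(5,7)[OF subfieldE(1)[OF F]] by (auto simp: minus_eq)
    ultimately have "set (take (length es) ((b \<ominus> c) # map (\<lambda>x. \<ominus> x) cs')) \<subseteq> {\<zero>}"
      using independent_imp_trivial_combine[OF F es(2)] by blast
    then have "b \<ominus> c = \<zero>" using e by simp
    then show ?thesis using bc cc r_right_minus_eq by simp
  qed
  \<comment> \<open>All powers of \<open>v\<close> are 1 modulo \<open>u\<close>, because
    \<open>v\<close> is 1 - u; but \<open>v [^] n\<close> is a multiple of \<open>a [^] n\<close>,
    hence of \<open>u\<close>. So \<open>u\<close> divides 1 in \<open>H\<close>, contrary to
    \<open>noinv\<close>.\<close>
  define v where "v = \<ominus> (x \<otimes> a)"
  have vH: "v \<in> H" using xH a Hp(5,6) by (auto simp: v_def)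
  have vc [simp]: "v \<in> carrier R" using vH Hc by auto
  have uv: "u = \<one> \<ominus> v" by (simp add: u_def v_def minus_eq)
  have "\<exists>t\<in>H. v [^] m \<oplus> u \<otimes> t = \<one>" for m :: nat
  proof (induct m)
    case 0
    then show ?case using Hp(2) by (intro bexI[of _ \<zero>]) auto
  next
    case (Suc m)
    then obtain t where t: "t \<in> H" "v [^] m \<oplus> u \<otimes> t = \<one>" by blast
    have tc [simp]: "t \<in> carrier R" using t Hc by auto
    have "v [^] Suc m \<oplus> u \<otimes> (\<one> \<oplus> t \<otimes> v) = (v [^] m \<oplus> u \<otimes> t) \<otimes> v \<oplus> u"
      by (simp add: l_distr r_distr m_ac a_ac)
    also have "\<dots> = v \<oplus> u" using t by simp
    also have "\<dots> = \<one>" using a_lcomm[of v \<one> "\<ominus> v"] by (simp add: uv minus_eq r_neg)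
    finally show ?case using t vH Hp(3,6,7) by (intro bexI[of _ "\<one> \<oplus> t \<otimes> v"]) auto
  qed
  then obtain t where t: "t \<in> H" "v [^] n \<oplus> u \<otimes> t = \<one>" by blast
  have tc [simp]: "t \<in> carrier R" using t Hc by auto
  have "v = (\<ominus> x) \<otimes> a" by (simp add: v_def l_minus)
  then have "v [^] n = (\<ominus> x) [^] n \<otimes> (u \<otimes> b)"
    unfolding ub by (simp add: nat_pow_distrib)
  then have "u \<otimes> ((\<ominus> x) [^] n \<otimes> b \<oplus> t) = \<one>"
    using t(2) bc by (simp add: r_distr m_ac)
  moreover have "(\<ominus> x) [^] n \<in> H"
    by (induct n) (use xH Hp in auto)
  then have "(\<ominus> x) [^] n \<otimes> b \<oplus> t \<in> H" using bH t(1) Hp(6,7) by simp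
  ultimately show False using noinv by blast
qed

text \<open>Induction on the generators with the subfield kept general: the field is finite over
  every subfield containing K[x], which by \<open>finitely_generated_imp_algebraic\<close> forces
  \<open>x\<close> to be algebraic. Then K[x] is a field and the dimensions multiply.\<close>

theorem zariski_lemma:
  assumes "finite S" "S \<subseteq> carrier R" "subfield K R" "carrier R = generate_ring R (K \<union> S)"
  shows "\<exists>n. dimension n K (carrier R)"
  using assms
proof (induct S arbitrary: K)
  case empty
  have "generate_ring R (K \<union> {}) \<subseteq> K"
    using subfieldE(1,3)[OF empty(2)] by (intro generate_ring_min_subring1) auto
  then have "carrier R = K" using empty subfieldE(3)[OF empty(2)] by auto
  then show ?case using dimension_one[OF empty(2)] by auto
next
  case (insert x S)
  have x: "x \<in> carrier R" and S: "S \<subseteq> carrier R" using insert by auto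
  have Ksub: "subring K R" using subfieldE(1)[OF insert(5)] .
  define H where "H = simple_extension K x"
  have Hsub: "subring H R" unfolding H_def by (rule simple_extension_is_subring[OF Ksub x])
  have KH: "insert x K \<subseteq> H"
    using simple_extension_mem[OF Ksub x] simple_extension_incl[OF subringE(1)[OF Ksub] x] by (auto simp: H_def)
  have gen: "carrier R = generate_ring R (H' \<union> S)" if "H \<subseteq> H'" "H' \<subseteq> carrier R" for H'
  proof
    show "generate_ring R (H' \<union> S) \<subseteq> carrier R" using that S by (intro generate_ring_incl) auto
    have "K \<union> insert x S \<subseteq> H' \<union> S" using KH that by auto
    then show "carrier R \<subseteq> generate_ring R (H' \<union> S)"
      using insert(6) mono_generate_ring[of "K \<union> insert x S" "H' \<union> S"] that S by auto
  qed
  have dim: "\<exists>n. dimension n F (carrier R)" if "subfield F R" "H \<subseteq> F" for F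
    using insert.hyps(3)[OF S that(1) gen[OF that(2) subfieldE(3)[OF that(1)]]] .
  have alg: "(algebraic over K) x"
    by (rule finitely_generated_imp_algebraic[OF insert(5) x insert(1) S])
      (use gen[OF subset_refl subringE(1)[OF Hsub]] dim in \<open>auto simp: H_def\<close>)
  have "subfield H R"
  proof -
    have "Rupt K (Irr K x) \<simeq> R \<lparr> carrier := H \<rparr>"
      unfolding H_def by (rule simple_extension_of_algebraic[OF insert(5) x alg])
    then obtain h where "h \<in> ring_iso (Rupt K (Irr K x)) (R \<lparr> carrier := H \<rparr>)" by (auto simp: is_ring_iso_def)
    note h = this
    interpret Q: field "Rupt K (Irr K x)" by (rule rupture_of_Irr[OF insert(5) x alg])
    have "h \<zero>\<^bsub>Rupt K (Irr K x)\<^esub> = \<zero>"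
      using ring_hom_zero[of h "Rupt K (Irr K x)" "R \<lparr> carrier := H \<rparr>"] h Q.ring_axioms
        subring_is_ring[OF Hsub] by (simp add: ring_iso_def)
    then have "field (R \<lparr> carrier := H \<rparr>)"
      using Q.ring_iso_imp_img_field[OF h] by simp
    then show ?thesis using subfield_iff(1)[of H] subringE(1)[OF Hsub] by auto
  qed
  from dim[OF this subset_refl] obtain n where n: "dimension n H (carrier R)" by blast
  show ?case
    using telescopic_base[OF insert(5) \<open>subfield H R\<close> dimension_simple_extension[OF insert(5) x alg, folded H_def] n]
    by blast
qed

end

section \<open>Closed points of affine varieties\<close>

text \<open>Zorn's lemma, where the noetherian condition makes the union of a chain of ideals a
  member of the chain.\<close>

lemma (in noetherian_ring) exists_maximal_ideal:
  assumes I: "ideal I R" "I \<noteq> carrier R"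
  shows "\<exists>J. maximalideal J R \<and> I \<subseteq> J"
proof -
  define P where "P = {J. ideal J R \<and> I \<subseteq> J \<and> J \<noteq> carrier R}"
  have "\<exists>M\<in>P. \<forall>U\<in>P. M \<subseteq> U \<longrightarrow> U = M"
  proof (rule subset_Zorn_nonempty)
    show "P \<noteq> {}" using I by (auto simp: P_def)
    fix C assume C: "C \<noteq> {}" "subset.chain P C"
    then have "subset.chain {I. ideal I R} C" by (auto simp: subset.chain_def P_def)
    from ideal_chain_is_trivial[OF C(1) this] show "\<Union> C \<in> P"
      using C(2) by (auto simp: subset.chain_def)
  qed
  then obtain M where M: "M \<in> P" "\<And>U. U \<in> P \<Longrightarrow> M \<subseteq> U \<Longrightarrow> U = M" by blast
  have "maximalideal M R"
  proof (rule maximalidealI)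
    show "ideal M R" "carrier R \<noteq> M" using M(1) by (auto simp: P_def)
    fix J assume "ideal J R" "M \<subseteq> J" "J \<subseteq> carrier R"
    moreover have "I \<subseteq> M" using M(1) by (simp add: P_def)
    ultimately have "J \<in> P" if "J \<noteq> carrier R" using that by (auto simp: P_def)
    then show "J = M \<or> J = carrier R" using M(2) \<open>M \<subseteq> J\<close> by blast
  qed
  then show ?thesis using M(1) by (auto simp: P_def)
qed

text \<open>Closedness is a topological condition on a prime, from which maximality has to be
  derived: a maximal ideal above \<open>quot_point R I y\<close> gives a prime of the quotient that
  contains \<open>y\<close>, hence lies in every closed set through \<open>y\<close>, and so equals
  \<open>y\<close>.\<close>

lemma closed_point_maximal:
  fixes R (structure)
  assumes "noetherian_ring R" "cring R" and I: "ideal I R" and y: "y \<in> closed_points (R Quot I)"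
  shows "maximalideal (quot_point R I y) R" and "I \<subseteq> quot_point R I y"
proof -
  interpret noetherian_ring R by fact
  interpret cring R by fact
  interpret q: ring_hom_ring R "R Quot I" "(+>) I" by (rule ideal.rcos_ring_hom_ring[OF I])
  define M where "M = quot_point R I y"
  have yP: "primeideal y (R Quot I)" using y by (auto simp: closed_points_def Spec_def)
  interpret y: primeideal y "R Quot I" by (rule yP)
  have surj: "\<exists>r\<in>carrier R. U = I +> r" if "U \<in> carrier (R Quot I)" for U
    using that unfolding FactRing_def A_RCOSETS_def' by auto
  have Mid: "ideal M R" unfolding M_def quot_point_def by (rule q.ideal_vimage[OF y.is_ideal])
  have IM: "I \<subseteq> M"
  proof
    fix i assume i: "i \<in> I"
    have e: "I +> i = \<zero>\<^bsub>R Quot I\<^esub>" unfolding FactRing_def using a_rcos_zero[OF I i] by simp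
    have "I +> i \<in> y" unfolding e by (rule y.zero_closed)
    then show "i \<in> M" using ideal.Icarr[OF I i] unfolding M_def quot_point_def by blast
  qed
  then show "I \<subseteq> quot_point R I y" by (simp add: M_def)
  have Mn: "M \<noteq> carrier R"
  proof
    assume "M = carrier R"
    then have "\<one> \<in> M" by simp
    then have "\<one>\<^bsub>R Quot I\<^esub> \<in> y" by (simp add: M_def quot_point_def)
    then show False using y.one_imp_carrier y.I_notcarr by auto
  qed
  have "maximalideal M R"
  proof (rule maximalidealI)
    show "ideal M R" "carrier R \<noteq> M" using Mid Mn by auto
    fix J assume J: "ideal J R" "M \<subseteq> J" "J \<subseteq> carrier R"
    show "J = M \<or> J = carrier R"
    proof (cases "J = carrier R")
      case False
      obtain Q where Q: "maximalideal Q R" "J \<subseteq> Q" using exists_maximal_ideal[OF J(1) False] by blast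
      then interpret Q: primeideal Q R using maximalideal_prime by blast
      have IQ: "I \<subseteq> Q" using IM J Q by auto
      define z where "z = (+>) I ` Q"
      have mem: "I +> r \<in> z \<longleftrightarrow> r \<in> Q" if r: "r \<in> carrier R" for r
      proof
        assume "I +> r \<in> z"
        then obtain j where j: "j \<in> Q" "I +> r = I +> j" by (auto simp: z_def)
        have jc: "j \<in> carrier R" using j(1) Q.Icarr by auto
        have "r \<ominus> j \<in> Q" using j(2) quotient_eq_iff_same_a_r_cos[OF I r jc] IQ by auto
        then have "(r \<ominus> j) \<oplus> j \<in> Q" using j(1) by (rule Q.a_closed)
        then show "r \<in> Q" using r jc by (simp add: minus_eq a_assoc l_neg)
      qed (auto simp: z_def)
      have "primeideal z (R Quot I)"
      proof (rule primeidealI)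
        show "ideal z (R Quot I)" unfolding z_def by (rule ring_ideal_imp_quot_ideal[OF I Q.is_ideal])
        show "cring (R Quot I)" by (rule ideal.quotient_is_cring[OF I is_cring])
        have "\<one>\<^bsub>R Quot I\<^esub> \<notin> z" using mem[of \<one>] Q.one_imp_carrier Q.I_notcarr by auto
        then show "carrier (R Quot I) \<noteq> z" using q.S.one_closed by blast
      next
        fix U V assume UV: "U \<in> carrier (R Quot I)" "V \<in> carrier (R Quot I)" "U \<otimes>\<^bsub>R Quot I\<^esub> V \<in> z"
        obtain a b where ab: "a \<in> carrier R" "U = I +> a" "b \<in> carrier R" "V = I +> b"
          using surj UV by metis
        have "I +> (a \<otimes> b) = U \<otimes>\<^bsub>R Quot I\<^esub> V" using q.hom_mult[OF ab(1,3)] ab by simp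
        then have "a \<otimes> b \<in> Q" using mem[OF m_closed[OF ab(1,3)]] UV(3) by metis
        then show "U \<in> z \<or> V \<in> z" using Q.I_prime ab mem by auto
      qed
      moreover have yz: "y \<subseteq> z"
      proof
        fix U assume U: "U \<in> y"
        then obtain r where r: "r \<in> carrier R" "U = I +> r" using surj y.Icarr by blast
        then have "r \<in> M" using U by (simp add: M_def quot_point_def)
        then show "U \<in> z" using r mem J Q by auto
      qed
      moreover obtain E where "E \<subseteq> carrier (R Quot I)" "{y} = {P \<in> Spec (R Quot I). E \<subseteq> P}"
        using y unfolding closed_points_def zariski_closed_def by blast
      ultimately have "z = y" unfolding Spec_def by blast
      then have "Q \<subseteq> M" using mem Q.Icarr by (auto simp: M_def quot_point_def)
      then show ?thesis using J Q by auto
    qed simp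
  qed
  then show "maximalideal (quot_point R I y) R" by (simp add: M_def)
qed

text \<open>Zariski's lemma makes the residue field algebraic over \<open>k\<close>. Its elements
  are scalars by \<open>exists_eigenvector\<close> applied to 1, since an eigenvector in a field can
  be cancelled.\<close>

lemma residue_field_of_closed_point:
  fixes R (structure)
  assumes aff: "affine_domain k R" and alg: "algebraically_closed (R \<lparr> carrier := k \<rparr>)"
    and M: "maximalideal M R" and x: "x \<in> carrier R"
  shows "\<exists>c\<in>k. x \<ominus> c \<in> M"
proof -
  have dom: "domain R" and k: "subfield k R" using aff by (auto simp: affine_domain_def)
  obtain S where S: "finite S" "S \<subseteq> carrier R" "carrier R = generate_ring R (k \<union> S)"
    using aff by (auto simp: affine_domain_def)
  interpret domain R by (rule dom)
  interpret M: maximalideal M R by (rule M)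
  define L where "L = R Quot M"
  interpret L: field L unfolding L_def by (rule M.quotient_is_field[OF is_cring])
  define h where "h = (+>) M"
  interpret h: ring_hom_ring R L h unfolding h_def L_def by (rule M.rcos_ring_hom_ring)
  have kc: "k \<subseteq> carrier R" using subfieldE(3)[OF k] .
  have hk: "subfield (h ` k) L" using h.img_is_subfield[OF k L.one_not_zero[folded]] by simp
  have hS: "h ` S \<subseteq> carrier L" using S by auto
  have surj: "carrier L = h ` carrier R"
    unfolding L_def h_def FactRing_def A_RCOSETS_def' by auto
  have "carrier L = generate_ring L (h ` k \<union> h ` S)"
  proof
    show "generate_ring L (h ` k \<union> h ` S) \<subseteq> carrier L"
      using hS subfieldE(3)[OF hk] by (intro L.generate_ring_incl) auto
    define E where "E = {r \<in> carrier R. h r \<in> generate_ring L (h ` k \<union> h ` S)}"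
    have "subring E R"
      by (rule subringI) (auto simp: E_def h.hom_a_inv intro: generate_ring.intros)
    moreover have "k \<union> S \<subseteq> E" using kc S by (auto simp: E_def intro: generate_ring.incl)
    ultimately have "carrier R \<subseteq> E"
      unfolding S(3) using kc S(2) by (intro generate_ring_min_subring1) auto
    then show "carrier L \<subseteq> generate_ring L (h ` k \<union> h ` S)" unfolding surj by (auto simp: E_def)
  qed
  then obtain n where "L.dimension n (h ` k) (carrier L)"
    using L.zariski_lemma[OF _ hS hk] S(1) by auto
  then have fin: "L.finite_dimension (h ` k) (carrier L)" by (rule L.finite_dimensionI)
  have hx: "h x \<in> carrier L" using x by simp
  have "(L.algebraic over (h ` k)) (h x)"
    by (rule L.finite_dimension_imp_algebraic[OF hk L.carrier_is_subring fin hx])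
  then obtain p where p: "p \<in> carrier ((h ` k)[X]\<^bsub>L\<^esub>)" "p \<noteq> []" "L.eval p (h x) = \<zero>\<^bsub>L\<^esub>"
    using L.algebraicE[OF subfieldE(1)[OF hk] hx] by blast
  have "set p \<subseteq> h ` k" using p(1) L.polynomial_incl by (simp add: univ_poly_carrier[symmetric])
  then obtain cs where cs: "set cs \<subseteq> k" "p = map h cs" unfolding set_subset_image_iff_map by blast
  define F where "F = R \<lparr> carrier := k \<rparr>"
  interpret F: algebraically_closed F unfolding F_def by (rule alg)
  have hF: "h \<in> ring_hom F L" by (rule ring_hom_memI) (use kc in \<open>auto simp: F_def subset_iff\<close>)
  interpret hF: closed_field_hom L F h
    by (intro closed_field_hom.intro closed_field_hom_axioms.intro hF L.is_cring F.algebraically_closed_axioms)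
  have "hd cs \<noteq> \<zero>"
  proof
    assume "hd cs = \<zero>"
    then have "hd p = \<zero>\<^bsub>L\<^esub>" using cs p(2) by (cases cs) auto
    then show False using p(1,2) by (simp add: univ_poly_carrier[symmetric] polynomial_def)
  qed
  then have "cs \<in> carrier (poly_ring F)"
    using cs(1) by (simp add: F_def univ_poly_carrier[symmetric] polynomial_def)
  moreover have "cs \<noteq> []" using p cs by auto
  moreover have "L.eval (map h cs) (h x) \<otimes>\<^bsub>L\<^esub> \<one>\<^bsub>L\<^esub> = \<zero>\<^bsub>L\<^esub>" using p cs by simp
  ultimately obtain c w where c: "c \<in> carrier F" and w: "w \<in> carrier L" "w \<otimes>\<^bsub>L\<^esub> \<one>\<^bsub>L\<^esub> \<noteq> \<zero>\<^bsub>L\<^esub>"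
    "h x \<otimes>\<^bsub>L\<^esub> (w \<otimes>\<^bsub>L\<^esub> \<one>\<^bsub>L\<^esub>) = h c \<otimes>\<^bsub>L\<^esub> (w \<otimes>\<^bsub>L\<^esub> \<one>\<^bsub>L\<^esub>)"
    using hF.exists_eigenvector[OF hx, of cs "\<one>\<^bsub>L\<^esub>"] by auto
  have ck: "c \<in> k" "c \<in> carrier R" using c kc by (auto simp: F_def)
  have "h x = h c"
    using w ck hx L.m_rcancel[of w "h x" "h c"] by simp
  then have "x \<ominus> c \<in> M"
    using quotient_eq_iff_same_a_r_cos[OF M.is_ideal x ck(2)] by (simp add: h_def)
  then show ?thesis using ck by blast
qed

section \<open>Reduction modulo a prime element of the kernel\<close>

context lnd_domain
begin

text \<open>The products t^j u for j < n. The nested form makes a linear combination of them unfold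
  as a Horner expression in \<open>t\<close>.\<close>

primrec product_family :: "'a list \<Rightarrow> 'a \<Rightarrow> nat \<Rightarrow> 'a list" where
  "product_family us t 0 = []"
| "product_family us t (Suc n) = us @ map ((\<otimes>) t) (product_family us t n)"

lemma length_product_family [simp]: "length (product_family us t n) = n * length us"
  by (induct n) auto

lemma product_family_carrier:
  assumes "set us \<subseteq> carrier R" "t \<in> carrier R"
  shows "set (product_family us t n) \<subseteq> carrier R"
  using assms by (induct n) auto

lemma product_family_nilpotent:
  assumes us: "set us \<subseteq> carrier R" "\<And>u. u \<in> set us \<Longrightarrow> (D ^^ b) u = \<zero>"
    and t: "t \<in> carrier R" "(D ^^ c) t = \<zero>"
  shows "u \<in> set (product_family us t n) \<Longrightarrow> (D ^^ (b + n * c)) u = \<zero>"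
proof (induct n arbitrary: u)
  case (Suc n)
  show ?case
  proof (cases "u \<in> set us")
    case True
    then show ?thesis using Dn_mono[OF us(2)] by simp
  next
    case False
    then obtain v where v: "v \<in> set (product_family us t n)" "u = t \<otimes> v" using Suc.prems by auto
    have "v \<in> carrier R" using product_family_carrier[OF us(1) t(1)] v by blast
    then have "(D ^^ (c + (b + n * c))) (t \<otimes> v) = \<zero>"
      using Dn_mult_zero t Suc.hyps[OF v(1)] by blast
    then show ?thesis using v by (simp add: add.left_commute add.commute)
  qed
qed simp

text \<open>A combination is a polynomial in \<open>t\<close> whose coefficients are combinations of
  \<open>us\<close>: transcendence of \<open>t\<close> over the kernel kills the outer layer,
  independence of \<open>us\<close> the inner one.\<close>

lemma product_family_independent:
  assumes us: "set us \<subseteq> Ker" "indep_over H us" and H: "H \<subseteq> Ker"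
    and t: "t \<in> carrier R" "D t \<noteq> \<zero>"
  shows "indep_over H (product_family us t n)"
proof -
  have usc: "set us \<subseteq> carrier R" using us Ker_carrier by auto
  have cK: "combine as vs \<in> Ker" if "set as \<subseteq> Ker" "set vs \<subseteq> Ker" for as vs
    using that by (induct as vs rule: combine.induct) (use subringE[OF Ker_subring] in auto)
  have "\<exists>ws. set ws \<subseteq> Ker \<and> combine as (product_family us t n) = horner ws t
      \<and> (horner ws t = \<zero> \<longrightarrow> set as \<subseteq> {\<zero>})"
    if "set as \<subseteq> H" "length as = n * length us" for as
    using that
  proof (induct n arbitrary: as)
    case 0
    then show ?case by (intro exI[of _ "[]"]) simp
  next
    case (Suc n)
    define bs where "bs = take (length us) as"
    define cs where "cs = drop (length us) as"
    have as: "as = bs @ cs" "length bs = length us" "length cs = n * length us"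
      using Suc.prems by (auto simp: bs_def cs_def)
    have H': "set bs \<subseteq> H" "set cs \<subseteq> H" using Suc.prems as(1) by auto
    have c: "set bs \<subseteq> carrier R" "set cs \<subseteq> carrier R" using H' H Ker_carrier by auto
    obtain ws where ws: "set ws \<subseteq> Ker" "combine cs (product_family us t n) = horner ws t"
      "horner ws t = \<zero> \<longrightarrow> set cs \<subseteq> {\<zero>}" using Suc.hyps[OF H'(2) as(3)] by blast
    define b where "b = combine bs us"
    have b: "b \<in> Ker" unfolding b_def using H' H us by (intro cK) auto
    have pc: "set (map ((\<otimes>) t) (product_family us t n)) \<subseteq> carrier R"
      using product_family_carrier[OF usc t(1)] t(1) by (auto simp: subset_iff)
    have "combine as (product_family us t (Suc n)) = b \<oplus> combine cs (map ((\<otimes>) t) (product_family us t n))"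
      unfolding as(1) b_def product_family.simps
      by (rule combine_append[symmetric]) (use as c usc pc in auto)
    also have "combine cs (map ((\<otimes>) t) (product_family us t n)) = t \<otimes> combine cs (product_family us t n)"
      by (rule combine_l_mult_right) (use c t product_family_carrier[OF usc t(1)] in auto)
    finally have eq: "combine as (product_family us t (Suc n)) = horner (b # ws) t"
      using ws by simp
    have "set as \<subseteq> {\<zero>}" if z: "horner (b # ws) t = \<zero>"
    proof -
      have "set (b # ws) \<subseteq> {\<zero>}"
        by (rule transcendental_over_Ker[OF t]) (use b ws z in auto)
      then have bz: "b = \<zero>" and wz: "set ws \<subseteq> {\<zero>}" by auto
      have "set bs \<subseteq> {\<zero>}" using us(2) H' as bz unfolding indep_over_def b_def by blast
      moreover have "set cs \<subseteq> {\<zero>}" using ws(3) horner_zeros[OF wz t(1)] by blast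
      ultimately show ?thesis using as(1) by auto
    qed
    then show ?case using eq b ws(1) by (intro exI[of _ "b # ws"]) auto
  qed
  then show ?thesis
    using product_family_carrier[OF usc t(1)] unfolding indep_over_def by fastforce
qed

end

text \<open>The last two assumptions bring \<open>B / \<alpha> B\<close> under the general theory:
  its characteristic is 0 and the induced derivation is not zero. They will follow from \<alpha>
  being a nonunit and from the irreducibility of \<delta>.\<close>

locale lnd_reduction = lnd_domain B \<delta> for B :: "('a, 'b) ring_scheme" (structure) and \<delta> +
  fixes \<alpha> :: 'a
  assumes factorial: "factorial_domain B"
    and \<alpha>_Ker: "\<alpha> \<in> Ker"
    and \<alpha>_nonzero: "\<alpha> \<noteq> \<zero>"
    and \<alpha>_prime: "primeideal (PIdl \<alpha>) B"
    and char0_mod: "0 < (n::nat) \<Longrightarrow> [n] \<cdot> \<one> \<notin> PIdl \<alpha>"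
    and nontrivial_mod: "\<exists>t\<in>carrier B. \<delta> t \<notin> PIdl \<alpha>"
begin

sublocale I: primeideal "PIdl \<alpha>" B by (rule \<alpha>_prime)

lemma \<alpha>_carrier [simp]: "\<alpha> \<in> carrier B" using \<alpha>_Ker by auto

abbreviation "R \<equiv> B Quot PIdl \<alpha>"
definition "\<pi> = (+>) (PIdl \<alpha>)"

sublocale R: domain R by (rule I.quotient_is_domain)

sublocale \<pi>: ring_hom_cring B R \<pi>
  unfolding \<pi>_def by (rule I.rcos_ring_hom_cring)

lemma \<pi>_ring_hom_ring: "ring_hom_ring B R \<pi>"
  unfolding \<pi>_def by (rule I.rcos_ring_hom_ring)

lemma \<pi>_surj: "carrier R = \<pi> ` carrier B"
  unfolding \<pi>_def FactRing_def A_RCOSETS_def' by auto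

lemma \<pi>_eq: "x \<in> carrier B \<Longrightarrow> y \<in> carrier B \<Longrightarrow> \<pi> x = \<pi> y \<longleftrightarrow> x \<ominus> y \<in> PIdl \<alpha>"
  unfolding \<pi>_def using quotient_eq_iff_same_a_r_cos[OF I.is_ideal] by blast

lemma \<pi>_zero: "x \<in> carrier B \<Longrightarrow> \<pi> x = \<zero>\<^bsub>R\<^esub> \<longleftrightarrow> x \<in> PIdl \<alpha>"
  using \<pi>_eq[of x \<zero>] by (simp add: minus_eq)

lemma PIdl_iff: "x \<in> PIdl \<alpha> \<longleftrightarrow> (\<exists>c\<in>carrier B. x = \<alpha> \<otimes> c)"
  unfolding cgenideal_def mem_Collect_eq using m_comm[OF \<alpha>_carrier] by metis

text \<open>As \<delta> commutes with multiplication by \<alpha>, that factor cancels. Hence the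
  image of \<open>A\<close> in the reduction is \<open>A / \<alpha> A\<close>.\<close>

lemma Ker_divide: assumes "c \<in> carrier B" "\<alpha> \<otimes> c \<in> Ker" shows "c \<in> Ker"
proof -
  have "\<alpha> \<otimes> \<delta> c = \<zero>"
    using assms \<alpha>_Ker Dn_Ker_mult[OF \<alpha>_Ker assms(1), of 1] by auto
  then show ?thesis using assms \<alpha>_nonzero by (auto simp: Ker_def integral_iff)
qed

lemma \<delta>_PIdl: assumes "x \<in> PIdl \<alpha>" shows "\<delta> x \<in> PIdl \<alpha>"
proof -
  obtain c where c: "c \<in> carrier B" "x = \<alpha> \<otimes> c" using assms by (auto simp: PIdl_iff)
  then have "\<delta> x = \<alpha> \<otimes> \<delta> c" using Dn_Ker_mult[OF \<alpha>_Ker, of c 1] by simp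
  then show ?thesis using c by (auto simp: PIdl_iff)
qed

definition "\<Delta> z = \<pi> (\<delta> (SOME b. b \<in> carrier B \<and> \<pi> b = z))"

text \<open>Two representatives differ by a multiple of \<alpha>, which \<delta> sends to a multiple
  of \<alpha>; so the choice made in \<open>\<Delta>\<close> does not matter.\<close>

lemma \<Delta>_\<pi>: assumes b: "b \<in> carrier B" shows "\<Delta> (\<pi> b) = \<pi> (\<delta> b)"
proof -
  define c where "c = (SOME c. c \<in> carrier B \<and> \<pi> c = \<pi> b)"
  have c: "c \<in> carrier B" "\<pi> c = \<pi> b"
    using someI[of "\<lambda>c. c \<in> carrier B \<and> \<pi> c = \<pi> b" b] b unfolding c_def by auto
  then have "c \<ominus> b \<in> PIdl \<alpha>" using \<pi>_eq b by blast
  then have "\<delta> (c \<ominus> b) \<in> PIdl \<alpha>" by (rule \<delta>_PIdl)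
  then have "\<delta> c \<ominus> \<delta> b \<in> PIdl \<alpha>" using b c by (simp add: minus_eq D_add D_minus)
  then have "\<pi> (\<delta> c) = \<pi> (\<delta> b)" using \<pi>_eq b c by simp
  then show ?thesis by (simp add: \<Delta>_def c_def)
qed

lemma \<Delta>n_\<pi>: "b \<in> carrier B \<Longrightarrow> (\<Delta> ^^ n) (\<pi> b) = \<pi> ((\<delta> ^^ n) b)"
  by (induct n) (auto simp: \<Delta>_\<pi>)

lemma \<pi>_natmult: "x \<in> carrier B \<Longrightarrow> \<pi> ([(n::nat)] \<cdot> x) = [n] \<cdot>\<^bsub>R\<^esub> \<pi> x"
  by (induct n) auto

sublocale R: lnd_domain R \<Delta>
proof (unfold_locales)
  fix z assume "z \<in> carrier R"
  then obtain x where x: "x \<in> carrier B" "z = \<pi> x" unfolding \<pi>_surj by blast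
  then show "\<Delta> z \<in> carrier R" by (simp add: \<Delta>_\<pi>)
  obtain n where "(\<delta> ^^ n) x = \<zero>" using D_nilpotent x by blast
  then show "\<exists>n. (\<Delta> ^^ n) z = \<zero>\<^bsub>R\<^esub>" using x \<Delta>n_\<pi> \<pi>.hom_zero by metis
  fix w assume "w \<in> carrier R"
  then obtain y where y: "y \<in> carrier B" "w = \<pi> y" unfolding \<pi>_surj by blast
  have "\<Delta> (\<pi> (x \<oplus> y)) = \<pi> (\<delta> (x \<oplus> y))" using x y by (intro \<Delta>_\<pi>) auto
  then show "\<Delta> (z \<oplus>\<^bsub>R\<^esub> w) = \<Delta> z \<oplus>\<^bsub>R\<^esub> \<Delta> w" using x y by (simp add: D_add \<Delta>_\<pi>)
  have "\<Delta> (\<pi> (x \<otimes> y)) = \<pi> (\<delta> (x \<otimes> y))" using x y by (intro \<Delta>_\<pi>) auto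
  then show "\<Delta> (z \<otimes>\<^bsub>R\<^esub> w) = z \<otimes>\<^bsub>R\<^esub> \<Delta> w \<oplus>\<^bsub>R\<^esub> w \<otimes>\<^bsub>R\<^esub> \<Delta> z" using x y by (simp add: D_mult \<Delta>_\<pi>)
next
  fix n :: nat assume n: "0 < n"
  have "\<pi> ([n] \<cdot> \<one>) \<noteq> \<zero>\<^bsub>R\<^esub>" using char0_mod[OF n] \<pi>_zero by simp
  then show "[n] \<cdot>\<^bsub>R\<^esub> \<one>\<^bsub>R\<^esub> \<noteq> \<zero>\<^bsub>R\<^esub>" by (simp add: \<pi>_natmult)
qed

text \<open>Dividing by \<open>\<alpha>\<close> as often as possible, a relation survives the reduction.\<close>

lemma primitive_relation:
  assumes as: "set as \<subseteq> Ker" "length as = length us" "combine as us = \<zero>" "\<not> set as \<subseteq> {\<zero>}"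
    and us: "set us \<subseteq> carrier B"
  shows "\<exists>bs. set bs \<subseteq> Ker \<and> length bs = length us \<and> combine bs us = \<zero> \<and> \<not> set bs \<subseteq> PIdl \<alpha>"
proof -
  interpret M: factorial_monoid "mult_of B" using factorial by (simp add: factorial_domain_def)
  obtain a where a: "a \<in> set as" "a \<noteq> \<zero>" using as(4) by auto
  \<comment> \<open>Proper divisibility is well founded in a factorial monoid. One nonzero
    coefficient \<open>a\<close> serves as the measure: each division by \<alpha> replaces it by a
    proper divisor.\<close>
  define W where "W = {(x, y). x \<in> carrier (mult_of B) \<and> y \<in> carrier (mult_of B) \<and> properfactor (mult_of B) x y}"
  have "wf W" unfolding W_def by (rule M.division_wellfounded)
  then show ?thesis using as a
  proof (induct a arbitrary: as rule: wf_induct_rule)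
    case (less a)
    show ?case
    proof (cases "set as \<subseteq> PIdl \<alpha>")
      case False
      then show ?thesis using less by blast
    next
      case True
      have "\<exists>bs. set bs \<subseteq> Ker \<and> as = map ((\<otimes>) \<alpha>) bs"
        using True less.prems(1)
      proof (induct as)
        case (Cons x as)
        then obtain bs where bs: "set bs \<subseteq> Ker" "as = map ((\<otimes>) \<alpha>) bs" by auto
        obtain c where c: "c \<in> carrier B" "x = \<alpha> \<otimes> c" using Cons PIdl_iff by auto
        then have "c \<in> Ker" using Ker_divide Cons by auto
        then show ?case using bs c by (intro exI[of _ "c # bs"]) auto
      qed simp
      then obtain bs where bs: "set bs \<subseteq> Ker" "as = map ((\<otimes>) \<alpha>) bs" by blast
      have bc: "set bs \<subseteq> carrier B" using bs Ker_carrier by auto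
      have "\<alpha> \<otimes> combine bs us = \<zero>"
        using less.prems(3) combine_r_distr[OF bc us \<alpha>_carrier] bs by simp
      then have z: "combine bs us = \<zero>"
        using \<alpha>_nonzero bc us by (simp add: integral_iff combine_in_carrier)
      obtain b where b: "b \<in> set bs" "a = \<alpha> \<otimes> b" using less.prems(5) bs by auto
      have bcar: "b \<in> carrier B" "b \<noteq> \<zero>" using b bc less.prems(6) by auto
      have acar: "a \<in> carrier (mult_of B)" using b bcar less.prems(6) by auto
      have "properfactor (mult_of B) b a"
      proof (rule properfactorI)
        show "b divides\<^bsub>mult_of B\<^esub> a"
          using b bcar \<alpha>_nonzero m_comm[of \<alpha> b] by (auto simp: factor_def)
        show "\<not> a divides\<^bsub>mult_of B\<^esub> b"
        proof
          assume "a divides\<^bsub>mult_of B\<^esub> b"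
          then obtain c where c: "c \<in> carrier B" "b = a \<otimes> c" by (auto simp: factor_def)
          then have "b \<otimes> \<one> = b \<otimes> (\<alpha> \<otimes> c)" using b bcar by (simp add: m_ac)
          then have "\<one> = \<alpha> \<otimes> c" using bcar c m_lcancel[of b \<one> "\<alpha> \<otimes> c"] by simp
          then have "\<one> \<in> PIdl \<alpha>" using c by (auto simp: PIdl_iff)
          then show False using I.one_imp_carrier I.I_notcarr by auto
        qed
      qed
      then have "(b, a) \<in> W" using acar bcar by (auto simp: W_def)
      moreover have "\<not> set bs \<subseteq> {\<zero>}" using b bcar by auto
      moreover have "length bs = length us" using less.prems(2) bs by simp
      ultimately show ?thesis using less.hyps[of b bs] bs(1) z b bcar by blast
    qed
  qed
qed

definition "H = \<pi> ` Ker"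

lemma H_subring: "subring H R"
  unfolding H_def by (rule ring_hom_ring.img_is_subring[OF \<pi>_ring_hom_ring Ker_subring])

lemma H_Ker: "H \<subseteq> R.Ker"
  unfolding H_def R.Ker_def by (auto simp: \<Delta>_\<pi> Ker_def)

lemma map_lift: "set xs \<subseteq> \<pi> ` C \<Longrightarrow> \<exists>ys. set ys \<subseteq> C \<and> xs = map \<pi> ys"
  using set_subset_image_iff_map by blast

lemma \<pi>_product_family:
  assumes "set us \<subseteq> carrier B" "t \<in> carrier B"
  shows "map \<pi> (product_family us t n) = R.product_family (map \<pi> us) (\<pi> t) n"
proof (induct n)
  case (Suc n)
  have "\<pi> (t \<otimes> x) = \<pi> t \<otimes>\<^bsub>R\<^esub> \<pi> x" if "x \<in> set (product_family us t n)" for x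
  proof -
    have "x \<in> carrier B" using that product_family_carrier[OF assms] by blast
    then show ?thesis by (rule \<pi>.hom_mult[OF assms(2)])
  qed
  then show ?case by (simp add: Suc[symmetric])
qed simp

text \<open>The rank of \<open>R.Ker\<close> over \<open>H\<close> is at most the degree in which \<open>\<delta>\<close> kills a lift of a
  local slice: compare the growth of the products \<open>c * t^j\<close> with that of the kernels of powers
  of \<open>\<delta>\<close>.\<close>

lemma finite_rank: "\<exists>r. \<forall>us. set us \<subseteq> R.Ker \<and> R.indep_over H us \<longrightarrow> length us \<le> r"
proof -
  obtain t where t: "t \<in> carrier B" "\<delta> t \<notin> PIdl \<alpha>" using nontrivial_mod by blast
  obtain c where c: "(\<delta> ^^ c) t = \<zero>" using D_nilpotent t by blast
  have \<pi>t: "\<pi> t \<in> carrier R" "\<Delta> (\<pi> t) \<noteq> \<zero>\<^bsub>R\<^esub>" using t \<pi>_zero by (auto simp: \<Delta>_\<pi>)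
  have "length us \<le> c" if us: "set us \<subseteq> R.Ker" "R.indep_over H us" for us
  proof (rule ccontr)
    assume "\<not> length us \<le> c"
    then have len: "Suc c \<le> length us" by simp
    have "set us \<subseteq> \<pi> ` carrier B" using us R.Ker_carrier \<pi>_surj by auto
    then obtain xs where xs: "set xs \<subseteq> carrier B" "us = map \<pi> xs" using map_lift by blast
    have "\<exists>b. \<forall>x\<in>set xs. (\<delta> ^^ b) x = \<zero>"
      using xs(1)
    proof (induct xs)
      case (Cons x xs)
      then obtain b where b: "\<forall>x\<in>set xs. (\<delta> ^^ b) x = \<zero>" by auto
      have "x \<in> carrier B" using Cons.prems by simp
      then obtain b' where b': "(\<delta> ^^ b') x = \<zero>" using D_nilpotent by blast
      have "(\<delta> ^^ (b + b')) y = \<zero>" if "y \<in> set (x # xs)" for y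
        using that b b' Dn_mono[of b y "b + b'"] Dn_mono[of b' y "b + b'"] by auto
      then show ?case by blast
    qed simp
    then obtain b where b: "\<And>x. x \<in> set xs \<Longrightarrow> (\<delta> ^^ b) x = \<zero>" by blast
    \<comment> \<open>With at least c + 1 independent elements the family has at least n (c + 1) = n
      + n c members, which exceeds the bound b + n c on the rank as soon as n > b.\<close>
    define n where "n = Suc b"
    define fs where "fs = product_family xs t n"
    have fc: "set fs \<subseteq> carrier B" unfolding fs_def by (rule product_family_carrier[OF xs(1) t(1)])
    have "n * Suc c \<le> n * length us" using len by (rule mult_le_mono2)
    then have long: "b + n * c < length fs" using xs by (simp add: fs_def n_def)
    have nil: "(\<delta> ^^ (b + n * c)) u = \<zero>" if "u \<in> set fs" for u
      using product_family_nilpotent[OF xs(1) b t(1) c] that by (simp add: fs_def)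
    obtain as where as: "set as \<subseteq> Ker" "length as = length fs" "combine as fs = \<zero>" "\<not> set as \<subseteq> {\<zero>}"
      using nilpotent_dependent[OF fc nil long] by blast
    \<comment> \<open>A relation with a coefficient outside \<alpha>B stays nontrivial in the
      reduction, where the family is independent.\<close>
    obtain bs where bs: "set bs \<subseteq> Ker" "length bs = length fs" "combine bs fs = \<zero>" "\<not> set bs \<subseteq> PIdl \<alpha>"
      using primitive_relation[OF as fc] by blast
    have bc: "set bs \<subseteq> carrier B" using bs Ker_carrier by auto
    have "R.combine (map \<pi> bs) (map \<pi> fs) = \<pi> (combine bs fs)"
      by (rule ring_hom_ring.combine_hom[OF \<pi>_ring_hom_ring bc fc])
    then have "R.combine (map \<pi> bs) (map \<pi> fs) = \<zero>\<^bsub>R\<^esub>" using bs(3) by simp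
    moreover have "R.indep_over H (map \<pi> fs)"
      unfolding fs_def \<pi>_product_family[OF xs(1) t(1)] xs(2)[symmetric]
      by (rule R.product_family_independent[OF us H_Ker \<pi>t])
    moreover have "set (map \<pi> bs) \<subseteq> H" using bs(1) by (auto simp: H_def)
    moreover have "length (map \<pi> bs) = length (map \<pi> fs)" using bs by simp
    ultimately have "set (map \<pi> bs) \<subseteq> {\<zero>\<^bsub>R\<^esub>}" unfolding R.indep_over_def by blast
    then have "\<pi> x = \<zero>\<^bsub>R\<^esub>" if "x \<in> set bs" for x using that by (simp add: image_subset_iff)
    then have "set bs \<subseteq> PIdl \<alpha>" using \<pi>_zero bc by blast
    then show False using bs(4) by blast
  qed
  then show ?thesis by blast
qed

sublocale R: lnd_family R \<Delta> H
proof (intro lnd_family.intro lnd_family_axioms.intro R.lnd_domain_axioms)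
  show "subring H R" by (rule H_subring)
  show "H \<subseteq> R.Ker" by (rule H_Ker)
  obtain t where "t \<in> carrier B" "\<delta> t \<notin> PIdl \<alpha>" using nontrivial_mod by blast
  then show "\<exists>x\<in>carrier R. \<Delta> x \<noteq> \<zero>\<^bsub>R\<^esub>"
    using \<pi>_zero by (intro bexI[of _ "\<pi> t"]) (auto simp: \<Delta>_\<pi>)
  show "\<exists>r. \<forall>us. set us \<subseteq> R.Ker \<and> R.indep_over H us \<longrightarrow> length us \<le> r" by (rule finite_rank)
qed

end

text \<open>The fibre is met as a quotient of \<open>B / \<alpha> B\<close>, but has to be presented
  as a quotient of \<open>B\<close>; the first isomorphism theorem transports the isomorphism
  together with the constants.\<close>

lemma disjoint_union_of_affine_lines_quotient:
  assumes h: "ring_hom_ring B S h" "h ` carrier B = carrier S"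
    and F: "carrier F \<subseteq> carrier B"
    and lines: "disjoint_union_of_affine_lines F h S m"
  shows "disjoint_union_of_affine_lines F (\<lambda>c. a_kernel B S h +>\<^bsub>B\<^esub> c) (B Quot a_kernel B S h) m"
proof -
  interpret h: ring_hom_ring B S h by (rule h(1))
  obtain \<phi> where \<phi>: "\<phi> \<in> ring_iso S (RDirProd_list (replicate m (poly_ring F)))"
    "\<And>c. c \<in> carrier F \<Longrightarrow> \<phi> (h c) = replicate m (ring.poly_of_const F c)"
    using lines unfolding disjoint_union_of_affine_lines_def by blast
  define \<psi> where "\<psi> = \<phi> \<circ> (\<lambda>Z. the_elem (h ` Z))"
  have "\<psi> \<in> ring_iso (B Quot a_kernel B S h) (RDirProd_list (replicate m (poly_ring F)))"
    unfolding \<psi>_def by (rule ring_iso_set_trans[OF h.FactRing_iso_set[OF h(2)] \<phi>(1)])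
  moreover have "\<psi> (a_kernel B S h +>\<^bsub>B\<^esub> c) = replicate m (ring.poly_of_const F c)" if "c \<in> carrier F" for c
    using that F \<phi>(2) by (auto simp: \<psi>_def)
  ultimately show ?thesis unfolding disjoint_union_of_affine_lines_def by blast
qed

context lnd_reduction
begin

text \<open>The open set is where a lift \<open>a'\<close> of the lattice denominator does not
  vanish. A closed point in it is a maximal ideal of \<open>A\<close> with residue field
  \<open>k\<close>, and its image in \<open>H\<close> meets the assumptions of
  \<open>lnd_fibre\<close>.\<close>

lemma general_fibre:
  assumes alg: "algebraically_closed (B \<lparr> carrier := k \<rparr>)"
    and affB: "affine_domain k B" and kK: "k \<subseteq> Ker"
    and A: "A = B \<lparr> carrier := Ker \<rparr>" and noeth: "noetherian_ring A" and affA: "affine_domain k A"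
  shows "for_general_closed_point (A Quot PIdl\<^bsub>A\<^esub> \<alpha>)
    (\<lambda>y. let M = quot_point A (PIdl\<^bsub>A\<^esub> \<alpha>) y in
       disjoint_union_of_affine_lines (B \<lparr> carrier := k \<rparr>) (\<lambda>c. fiber_ideal B M +>\<^bsub>B\<^esub> c) (fiber_ring B M) R.rank)"
proof -
  define F where "F = B \<lparr> carrier := k \<rparr>"
  interpret F: algebraically_closed F unfolding F_def by (rule alg)
  have kc: "k \<subseteq> carrier B" using kK Ker_carrier by auto
  interpret A: domain A using affA by (simp add: affine_domain_def)
  have A_simps [simp]: "carrier A = Ker" "monoid.mult A = monoid.mult B" "ring.add A = ring.add B" "\<one>\<^bsub>A\<^esub> = \<one>" "\<zero>\<^bsub>A\<^esub> = \<zero>"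
    by (auto simp: A)
  have minusA: "x \<ominus>\<^bsub>A\<^esub> y = x \<ominus> y" if "x \<in> Ker" "y \<in> Ker" for x y
  proof -
    have "\<ominus>\<^bsub>A\<^esub> y = \<ominus> y"
    proof (rule A.minus_equality[symmetric, THEN sym])
      show "\<ominus> y \<oplus>\<^bsub>A\<^esub> y = \<zero>\<^bsub>A\<^esub>" using that by (auto simp: l_neg)
    qed (use that subringE(5)[OF Ker_subring] in auto)
    then show ?thesis by (simp add: a_minus_def)
  qed
  define I where "I = PIdl\<^bsub>A\<^esub> \<alpha>"
  have I_mem: "x \<in> I \<longleftrightarrow> x \<in> PIdl \<alpha>" if x: "x \<in> Ker" for x
  proof
    assume "x \<in> I"
    then obtain c where c: "c \<in> Ker" "x = c \<otimes> \<alpha>" unfolding I_def cgenideal_def by auto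
    then have "c \<in> carrier B" by auto
    then show "x \<in> PIdl \<alpha>" unfolding cgenideal_def using c(2) by blast
  next
    assume "x \<in> PIdl \<alpha>"
    then obtain c where c: "c \<in> carrier B" "x = \<alpha> \<otimes> c" by (auto simp: PIdl_iff)
    then have "c \<in> Ker" using Ker_divide x by auto
    moreover have "x = c \<otimes>\<^bsub>A\<^esub> \<alpha>" using c m_comm[of \<alpha> c] by simp
    ultimately show "x \<in> I" unfolding I_def cgenideal_def A_simps(1) by blast
  qed
  have \<alpha>A: "\<alpha> \<in> carrier A" using \<alpha>_Ker by simp
  have I_ideal: "ideal I A" unfolding I_def by (rule A.cgenideal_ideal[OF \<alpha>A])
  have \<alpha>I: "\<alpha> \<in> I" unfolding I_def by (rule A.cgenideal_self[OF \<alpha>A])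
  have I_prime: "primeideal I A"
  proof (rule primeidealI[OF I_ideal A.is_cring])
    have "\<one> \<notin> I" using I_mem[of \<one>] I.one_imp_carrier I.I_notcarr subringE(3)[OF Ker_subring] by blast
    then show "carrier A \<noteq> I" using A.one_closed by auto
    fix a b assume ab: "a \<in> carrier A" "b \<in> carrier A" "a \<otimes>\<^bsub>A\<^esub> b \<in> I"
    then have "a \<otimes> b \<in> PIdl \<alpha>" using I_mem[of "a \<otimes> b"] subringE(6)[OF Ker_subring] by simp
    then show "a \<in> I \<or> b \<in> I" using I.I_prime[of a b] ab I_mem by auto
  qed
  interpret Q: domain "A Quot I" by (rule primeideal.quotient_is_domain[OF I_prime])
  obtain S where S: "finite S" "S \<subseteq> carrier B" "carrier B = generate_ring B (k \<union> S)"
    using affB by (auto simp: affine_domain_def)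
  define Y where "Y = \<pi> ` S"
  have Yc: "Y \<subseteq> carrier R" "finite Y" using S by (auto simp: Y_def)
  have gen: "carrier R = generate_ring R (H \<union> Y)"
  proof
    have Hc: "H \<subseteq> carrier R" by (rule R.H_carrier)
    show "generate_ring R (H \<union> Y) \<subseteq> carrier R" using Hc Yc by (intro R.generate_ring_incl) auto
    define E where "E = {b \<in> carrier B. \<pi> b \<in> generate_ring R (H \<union> Y)}"
    have neg: "\<pi> (\<ominus> b) = \<ominus>\<^bsub>R\<^esub> \<pi> b" if "b \<in> carrier B" for b
      using that ring_hom_ring.homh[OF \<pi>_ring_hom_ring] \<pi>.hom_a_inv by blast
    have "subring E B"
      by (rule subringI) (auto simp: E_def neg intro: generate_ring.intros)
    moreover have "k \<union> S \<subseteq> E" using kc kK S by (auto simp: E_def Y_def H_def intro!: generate_ring.incl)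
    ultimately have "carrier B \<subseteq> E"
      unfolding S(3) using kc S(2) by (intro generate_ring_min_subring1) auto
    then show "carrier R \<subseteq> generate_ring R (H \<union> Y)" unfolding \<pi>_surj by (auto simp: E_def)
  qed
  obtain es s a where lat: "lnd_lattice R \<Delta> H Y es s a" and len: "length es = R.rank"
    using R.exists_lattice[OF Yc gen] by blast
  interpret L: lnd_lattice R \<Delta> H Y es s a by (rule lat)
  obtain a' where a': "a' \<in> Ker" "a = \<pi> a'" using L.a_H by (auto simp: H_def)
  have a'I: "a' \<notin> I"
    using L.a_nonzero a' I_mem[of a'] \<pi>_zero[of a'] by auto
  define U where "U = {P \<in> Spec (A Quot I). I +>\<^bsub>A\<^esub> a' \<notin> P}"
  have coset: "I +>\<^bsub>A\<^esub> x \<in> carrier (A Quot I)" if "x \<in> Ker" for x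
    using that unfolding FactRing_def A_RCOSETS_def' by auto
  have Uopen: "zariski_open (A Quot I) U"
  proof -
    have "Spec (A Quot I) - U = {P \<in> Spec (A Quot I). {I +>\<^bsub>A\<^esub> a'} \<subseteq> P}" by (auto simp: U_def)
    then show ?thesis
      unfolding zariski_open_def zariski_closed_def using coset[OF a'(1)] by (auto simp: U_def)
  qed
  \<comment> \<open>The generic point: \<open>A / \<alpha> A\<close> is a domain and
    \<open>a'\<close> is nonzero in it, so \<open>U\<close> is nonempty.\<close>
  have "{\<zero>\<^bsub>A Quot I\<^esub>} \<in> U"
  proof -
    have "I +>\<^bsub>A\<^esub> a' \<noteq> I"
      using ideal.rcos_const_imp_mem[OF I_ideal, of a'] a'(1) a'I by auto
    then have "I +>\<^bsub>A\<^esub> a' \<noteq> \<zero>\<^bsub>A Quot I\<^esub>" by (simp add: FactRing_def)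
    then show ?thesis using Q.zeroprimeideal by (simp add: U_def Spec_def)
  qed
  moreover have "disjoint_union_of_affine_lines F (\<lambda>c. fiber_ideal B M +>\<^bsub>B\<^esub> c) (fiber_ring B M) R.rank"
    if y: "y \<in> U" "y \<in> closed_points (A Quot I)" and M: "M = quot_point A I y" for y M
  proof -
    have Mmax: "maximalideal M A" and IM: "I \<subseteq> M"
      using closed_point_maximal[OF noeth A.is_cring I_ideal y(2)] M by auto
    interpret M: maximalideal M A by (rule Mmax)
    have Mprime: "primeideal M A" by (rule A.maximalideal_prime[OF Mmax])
    have MK: "M \<subseteq> Ker" using M.Icarr by auto
    have Mc: "M \<subseteq> carrier B" using MK Ker_carrier by auto
    define N where "N = \<pi> ` M"
    \<comment> \<open>Since \<open>M\<close> contains \<alpha>, membership in \<open>M\<close> can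
      be tested after reduction.\<close>
    have \<pi>M: "\<pi> x \<in> N \<longleftrightarrow> x \<in> M" if x: "x \<in> Ker" for x
    proof
      assume "\<pi> x \<in> N"
      then obtain m where m: "m \<in> M" "\<pi> x = \<pi> m" by (auto simp: N_def)
      have mK: "m \<in> Ker" using m MK by auto
      then have "x \<ominus> m \<in> PIdl \<alpha>" using \<pi>_eq[of x m] m x by auto
      then have "x \<ominus> m \<in> I" using I_mem[of "x \<ominus> m"] x mK subringE(5,7)[OF Ker_subring] by (simp add: minus_eq)
      then have "(x \<ominus> m) \<oplus> m \<in> M" using IM m(1) M.a_closed[of "x \<ominus> m" m] by auto
      moreover have "(x \<ominus> m) \<oplus> m = x"
        using KerD(1)[OF x] KerD(1)[OF mK] by (simp add: minus_eq a_assoc l_neg)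
      ultimately show "x \<in> M" by simp
    qed (auto simp: N_def)
    have a'M: "a' \<notin> M" using y(1) a'(1) by (simp add: U_def M quot_point_def)
    have "lnd_fibre R \<Delta> H Y es s a F \<pi> N"
    proof (intro lnd_fibre.intro lnd_fibre_axioms.intro lat F.algebraically_closed_axioms)
      show "\<pi> \<in> ring_hom F R"
        by (rule ring_hom_memI) (use kc in \<open>auto simp: F_def subset_iff\<close>)
      show "\<pi> c \<in> H" if "c \<in> carrier F" for c using that kK by (auto simp: F_def H_def)
      have sub: "N \<subseteq> H" using MK by (auto simp: N_def H_def)
      have zero: "\<zero>\<^bsub>R\<^esub> \<in> N" using \<pi>M[of \<zero>] M.zero_closed subringE(2)[OF Ker_subring] by simp
      have add: "u \<oplus>\<^bsub>R\<^esub> v \<in> N" if "u \<in> N" "v \<in> N" for u v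
      proof -
        obtain m n where mn: "m \<in> M" "u = \<pi> m" "n \<in> M" "v = \<pi> n" using \<open>u \<in> N\<close> \<open>v \<in> N\<close> by (auto simp: N_def)
        have "m \<oplus> n \<in> M" using M.a_closed mn by auto
        moreover have "m \<in> carrier B" "n \<in> carrier B" using mn Mc by auto
        then have "u \<oplus>\<^bsub>R\<^esub> v = \<pi> (m \<oplus> n)" using mn by simp
        ultimately show ?thesis by (simp add: N_def)
      qed
      have mul: "u \<otimes>\<^bsub>R\<^esub> v \<in> N" if "u \<in> H" "v \<in> N" for u v
      proof -
        obtain m n where mn: "m \<in> Ker" "u = \<pi> m" "n \<in> M" "v = \<pi> n" using \<open>u \<in> H\<close> \<open>v \<in> N\<close> by (auto simp: N_def H_def)
        have "m \<otimes> n \<in> M" using M.I_l_closed[of n m] mn by auto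
        moreover have "m \<in> carrier B" "n \<in> carrier B" using mn Mc by auto
        then have "u \<otimes>\<^bsub>R\<^esub> v = \<pi> (m \<otimes> n)" using mn by simp
        ultimately show ?thesis by (simp add: N_def)
      qed
      show "L.H_ideal N" unfolding L.H_ideal_def using sub zero add mul by blast
      show "u \<in> N \<or> v \<in> N" if uv: "u \<in> H" "v \<in> H" "u \<otimes>\<^bsub>R\<^esub> v \<in> N" for u v
      proof -
        obtain m n where mn: "m \<in> Ker" "u = \<pi> m" "n \<in> Ker" "v = \<pi> n" using uv by (auto simp: H_def)
        have "u \<otimes>\<^bsub>R\<^esub> v = \<pi> (m \<otimes> n)"
          using mn KerD(1)[OF mn(1)] KerD(1)[OF mn(3)] by simp
        then have "m \<otimes> n \<in> M" using \<pi>M[of "m \<otimes> n"] uv mn subringE(6)[OF Ker_subring] by simp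
        then have "m \<in> M \<or> n \<in> M" using primeideal.I_prime[OF Mprime, of m n] mn by simp
        then show ?thesis using mn by (auto simp: N_def)
      qed
      show "a \<notin> N" using \<pi>M[OF a'(1)] a'M a'(2) by simp
      show "\<exists>c\<in>carrier F. u \<ominus>\<^bsub>R\<^esub> \<pi> c \<in> N" if u: "u \<in> H" for u
      proof -
        obtain x where x: "x \<in> Ker" "u = \<pi> x" using u by (auto simp: H_def)
        have "algebraically_closed (A \<lparr> carrier := k \<rparr>)" using alg by (simp add: A)
        then obtain c where c: "c \<in> k" "x \<ominus>\<^bsub>A\<^esub> c \<in> M"
          using residue_field_of_closed_point[OF affA _ Mmax, of x] x by auto
        have cK: "c \<in> Ker" using c kK by auto
        have "x \<ominus> c \<in> M" using c(2) minusA[OF x(1) cK] by simp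
        moreover have "u \<ominus>\<^bsub>R\<^esub> \<pi> c = \<pi> (x \<ominus> c)"
          using x(2) \<pi>.hom_a_inv[of c] KerD(1)[OF x(1)] KerD(1)[OF cK] by (simp add: a_minus_def)
        ultimately show ?thesis using c by (auto simp: F_def N_def)
      qed
    qed
    then interpret G: lnd_fibre R \<Delta> H Y es s a F \<pi> N .
    define h where "h = G.q \<circ> \<pi>"
    have h_hom: "h \<in> ring_hom B G.S"
      unfolding h_def by (rule ring_hom_trans[OF ring_hom_ring.homh[OF \<pi>_ring_hom_ring] ring_hom_ring.homh[OF G.q_ring_hom_ring]])
    have Sring: "ring G.S" by (rule ideal.quotient_is_ring[OF G.J_ideal])
    interpret h: ring_hom_ring B G.S h
      by (rule ring_hom_ringI2[OF ring_axioms Sring h_hom])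
    have hsurj: "h ` carrier B = carrier G.S"
    proof
      show "h ` carrier B \<subseteq> carrier G.S" by auto
      show "carrier G.S \<subseteq> h ` carrier B" using G.q_surj unfolding \<pi>_surj h_def by fastforce
    qed
    \<comment> \<open>This identifies the two-step quotient with the fibre: the ideal generated by
      \<open>M\<close> contains \<alpha>, and its image modulo \<alpha> is generated by
      \<open>N\<close>.\<close>
    have ker: "a_kernel B G.S h = Idl M"
    proof -
      have IdM: "ideal (Idl M) B" by (rule genideal_ideal[OF Mc])
      have MI: "M \<subseteq> Idl M" by (rule genideal_self[OF Mc])
      have \<alpha>M: "PIdl \<alpha> \<subseteq> Idl M"
        using MI IM \<alpha>I by (intro cgenideal_minimal[OF IdM]) auto
      have hz: "h b = \<zero>\<^bsub>G.S\<^esub> \<longleftrightarrow> \<pi> b \<in> G.J" if "b \<in> carrier B" for b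
        using G.q_zero[of "\<pi> b"] that by (simp add: h_def)
      have "G.J \<subseteq> \<pi> ` (Idl M)"
      proof -
        have "ideal (\<pi> ` (Idl M)) R"
          unfolding \<pi>_def by (rule ring_ideal_imp_quot_ideal[OF I.is_ideal IdM])
        moreover have "N \<subseteq> \<pi> ` (Idl M)" using MI by (auto simp: N_def)
        ultimately show ?thesis unfolding G.J_def by (rule R.genideal_minimal)
      qed
      then have 1: "b \<in> Idl M" if b: "b \<in> carrier B" "\<pi> b \<in> G.J" for b
      proof -
        obtain c where c: "c \<in> Idl M" "\<pi> b = \<pi> c" using b \<open>G.J \<subseteq> \<pi> ` (Idl M)\<close> by auto
        have cc: "c \<in> carrier B" using c ideal.Icarr[OF IdM] by auto
        have "b \<ominus> c \<in> Idl M" using \<pi>_eq[OF b(1) cc] c \<alpha>M by auto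
        then have "(b \<ominus> c) \<oplus> c \<in> Idl M" using c(1) additive_subgroup.a_closed[OF ideal.axioms(1)[OF IdM]] by blast
        then show ?thesis using b cc by (simp add: minus_eq a_assoc l_neg)
      qed
      have "Idl M \<subseteq> {b \<in> carrier B. \<pi> b \<in> G.J}"
        using ring_hom_ring.ideal_vimage[OF \<pi>_ring_hom_ring G.J_ideal] G.N_J Mc
        by (intro genideal_minimal) (auto simp: N_def)
      then show ?thesis unfolding a_kernel_def' using 1 hz by blast
    qed
    have "disjoint_union_of_affine_lines F h G.S R.rank"
      using G.fibre_lines unfolding G.\<tau>_def h_def[symmetric] len .
    from disjoint_union_of_affine_lines_quotient[OF h.ring_hom_ring_axioms hsurj _ this]
    show ?thesis using kc by (simp add: ker fiber_ideal_def fiber_ring_def F_def)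
  qed
  ultimately show ?thesis
    unfolding for_general_closed_point_def Let_def F_def[symmetric] I_def[symmetric]
    using Uopen by blast
qed

end

section \<open>The degree of the reduced polynomial\<close>

lemma (in ring) normalize_eq_Nil: "normalize p = [] \<Longrightarrow> set p \<subseteq> {\<zero>}"
  by (induct p) (auto split: if_splits)

context lnd_reduction
begin

text \<open>The relation of length \<open>R.rank + 1\<close> for the class of \<open>z\<close> is
  lifted to an element \<open>f\<close> of \<open>I1\<close>. Some coefficient of the lift is not
  divisible by \<alpha>, so the reduction of \<open>f\<close> is a nonzero multiple of the generator
  over the field \<open>K\<close>, where degrees add.\<close>

lemma degree_bar_poly_le_rank:
  assumes A: "A = B \<lparr> carrier := Ker \<rparr>" and domA: "domain A"
    and z: "z \<in> carrier B" "\<delta> z \<in> PIdl \<alpha>" "\<delta> z \<noteq> \<zero>"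
    and K: "fraction_field (A Quot PIdl\<^bsub>A\<^esub> \<alpha>) K \<iota>"
    and g: "I1_generator B A \<alpha> z K \<iota> g"
  shows "degree (bar_poly B A \<alpha> z g) \<le> R.rank"
proof -
  interpret A: domain A by (rule domA)
  have cA: "carrier A = Ker" by (simp add: A)
  define I where "I = PIdl\<^bsub>A\<^esub> \<alpha>"
  have I_ideal: "ideal I A" unfolding I_def by (rule A.cgenideal_ideal) (simp add: cA \<alpha>_Ker)
  define Q where "Q = A Quot I"
  interpret Q: cring Q unfolding Q_def by (rule ideal.quotient_is_cring[OF I_ideal A.is_cring])
  interpret K: field K using K by (simp add: fraction_field_def)
  have \<iota>: "\<iota> \<in> ring_hom Q K" "inj_on \<iota> (carrier Q)" using K by (auto simp: fraction_field_def Q_def I_def)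
  have red: "set (map (\<lambda>a. I +>\<^bsub>A\<^esub> a) q) \<subseteq> carrier Q" if "set q \<subseteq> Ker" for q
    using that unfolding Q_def FactRing_def A_RCOSETS_def' by (auto simp: cA)
  have PA: "poly_ring A = Ker[X]\<^bsub>B\<^esub>"
    unfolding A using univ_poly_consistent[OF Ker_subring] by simp
  interpret ev: ring_hom_ring "Ker[X]\<^bsub>B\<^esub>" B "\<lambda>p. eval p z" by (rule eval_ring_hom[OF Ker_subring z(1)])
  have coeffs: "set q \<subseteq> Ker" if "q \<in> carrier (Ker[X]\<^bsub>B\<^esub>)" for q
    using that polynomial_incl by (simp add: univ_poly_carrier[symmetric])
  \<comment> \<open>\<open>z\<close> is transcendental over \<open>A\<close> because
    \<open>\<delta> z\<close> is nonzero; so \<open>poly_in\<close> selects the expected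
    polynomial.\<close>
  have inj: "inj_on (\<lambda>p. eval p z) (carrier (Ker[X]\<^bsub>B\<^esub>))"
  proof (rule ev.trivial_ker_imp_inj)
    have "q = []" if q: "q \<in> carrier (Ker[X]\<^bsub>B\<^esub>)" "eval q z = \<zero>" for q
    proof -
      have "horner (rev q) z = \<zero>"
        using q(2) eval_eq_horner[of q z] coeffs[OF q(1)] Ker_carrier z(1) by simp
      then have "set (rev q) \<subseteq> {\<zero>}"
        using transcendental_over_Ker[OF z(1,3), of "rev q"] coeffs[OF q(1)] by simp
      then show "q = []" using q(1) by (cases q) (auto simp: univ_poly_carrier[symmetric] polynomial_def)
    qed
    then show "a_kernel (Ker[X]\<^bsub>B\<^esub>) B (\<lambda>p. eval p z) = {\<zero>\<^bsub>Ker[X]\<^bsub>B\<^esub>\<^esub>}"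
      unfolding a_kernel_def' univ_poly_zero using univ_poly_zero_closed by auto
  qed
  have poly_in_eq: "poly_in B A z (eval q z) = q" if q: "q \<in> carrier (Ker[X]\<^bsub>B\<^esub>)" for q
    unfolding poly_in_def PA by (rule the_equality) (use q inj_onD[OF inj] in auto)
  have I1_eq: "I1 B A \<alpha> z = (\<lambda>p. eval p z) ` carrier (Ker[X]\<^bsub>B\<^esub>) \<inter> PIdl \<alpha>"
    unfolding I1_def cA simple_extension_as_eval_img[OF Ker_carrier z(1)] ..
  have bar_eq: "bar_poly B A \<alpha> z (eval q z) = Q.normalize (map (\<lambda>a. I +>\<^bsub>A\<^esub> a) q)"
    if q: "q \<in> carrier (Ker[X]\<^bsub>B\<^esub>)" for q
    unfolding bar_poly_def poly_in_eq[OF q] reduce_poly_def Q_def I_def ..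
  have "\<pi> z \<in> R.Ker" using z \<pi>_zero[of "\<delta> z"] by (simp add: R.Ker_def \<Delta>_\<pi>)
  then obtain hs where hs: "set hs \<subseteq> H" "length hs = Suc R.rank" "R.horner hs (\<pi> z) = \<zero>\<^bsub>R\<^esub>" "\<not> set hs \<subseteq> {\<zero>\<^bsub>R\<^esub>}"
    using R.algebraic_relation by blast
  obtain as where as: "set as \<subseteq> Ker" "hs = map \<pi> as" using hs(1) map_lift unfolding H_def by blast
  have asc: "set as \<subseteq> carrier B" using as Ker_carrier by auto
  define f where "f = horner as z"
  have fc: "f \<in> carrier B" using asc z by (auto simp: f_def)
  have fI: "f \<in> PIdl \<alpha>"
    using hs(3) as \<pi>.horner_hom[OF asc z(1)] \<pi>_zero[OF fc] by (simp add: f_def)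
  \<comment> \<open>Horner lists start with the constant term, library polynomials with a nonzero
    leading coefficient.\<close>
  define p where "p = normalize (rev as)"
  have p: "p \<in> carrier (Ker[X]\<^bsub>B\<^esub>)"
    using normalize_gives_polynomial[of "rev as"] as by (simp add: p_def univ_poly_carrier)
  have evp: "eval p z = f"
    using eval_normalize[of "rev as" z] eval_eq_horner[of "rev as" z] asc z by (simp add: p_def f_def)
  have f_bar: "bar_poly B A \<alpha> z f = Q.normalize (map (\<lambda>a. I +>\<^bsub>A\<^esub> a) p)"
    using bar_eq[OF p] evp by simp
  have len: "length (bar_poly B A \<alpha> z f) \<le> Suc R.rank"
    using Q.normalize_length_le[of "map (\<lambda>a. I +>\<^bsub>A\<^esub> a) p"] normalize_length_le[of "rev as"] hs(2) as(2)
    by (simp add: f_bar p_def)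
  have nonzero: "bar_poly B A \<alpha> z f \<noteq> []"
  proof
    assume "bar_poly B A \<alpha> z f = []"
    then have pz: "set (map (\<lambda>a. I +>\<^bsub>A\<^esub> a) p) \<subseteq> {\<zero>\<^bsub>Q\<^esub>}"
      unfolding f_bar by (rule Q.normalize_eq_Nil)
    have pI: "c \<in> PIdl \<alpha>" if c: "c \<in> set p" for c
    proof -
      have cK: "c \<in> carrier A" using c coeffs[OF p] cA by auto
      have "I +>\<^bsub>A\<^esub> c \<in> set (map (\<lambda>a. I +>\<^bsub>A\<^esub> a) p)" using c unfolding set_map by (rule imageI)
      then have "I +>\<^bsub>A\<^esub> c \<in> {\<zero>\<^bsub>Q\<^esub>}" using pz by (rule subsetD[rotated])
      then have "I +>\<^bsub>A\<^esub> c = I" by (simp add: Q_def FactRing_def)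
      then have "c \<in> I" by (rule ideal.rcos_const_imp_mem[OF I_ideal cK])
      then obtain b where "b \<in> Ker" "c = b \<otimes> \<alpha>" unfolding I_def cgenideal_def by (auto simp: A)
      then show ?thesis unfolding cgenideal_def by blast
    qed
    obtain n where n: "rev as = replicate n \<zero> @ p"
      unfolding p_def using normalize_def'[of "rev as"] by metis
    have "c \<in> PIdl \<alpha>" if "c \<in> set as" for c
    proof -
      have "c \<in> set (rev as)" using that by simp
      then have "c = \<zero> \<or> c \<in> set p" unfolding n by auto
      then show ?thesis using pI I.zero_closed by auto
    qed
    then have "\<pi> c = \<zero>\<^bsub>R\<^esub>" if "c \<in> set as" for c using that \<pi>_zero asc by blast
    then show False using hs(4) as(2) by auto
  qed
  define P where "P = poly_ring K"
  define bar where "bar = (\<lambda>f. map \<iota> (bar_poly B A \<alpha> z f))"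
  have gI: "g \<in> I1 B A \<alpha> z" and gen: "Idl\<^bsub>P\<^esub> (bar ` I1 B A \<alpha> z) = PIdl\<^bsub>P\<^esub> (bar g)"
    using g by (auto simp: I1_generator_def P_def bar_def)
  have "f \<in> I1 B A \<alpha> z" unfolding I1_eq using p evp fI by blast
  then have "bar f \<in> Idl\<^bsub>P\<^esub> (bar ` I1 B A \<alpha> z)" unfolding genideal_def by blast
  then obtain h where h: "h \<in> carrier P" "bar f = h \<otimes>\<^bsub>P\<^esub> bar g"
    unfolding gen cgenideal_def by blast
  obtain q where q: "q \<in> carrier (Ker[X]\<^bsub>B\<^esub>)" "g = eval q z" using gI unfolding I1_eq by blast
  have "polynomial\<^bsub>Q\<^esub> (carrier Q) (bar_poly B A \<alpha> z g)"
    unfolding q(2) bar_eq[OF q(1)] by (rule Q.normalize_gives_polynomial[OF red[OF coeffs[OF q(1)]]])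
  \<comment> \<open>The embedding \<iota> is injective, so the leading coefficient survives and the
    mapped list is still normalized.\<close>
  then have bg: "polynomial\<^bsub>K\<^esub> (carrier K) (bar g)"
  proof -
    assume bp: "polynomial\<^bsub>Q\<^esub> (carrier Q) (bar_poly B A \<alpha> z g)"
    have \<iota>0: "\<iota> \<zero>\<^bsub>Q\<^esub> = \<zero>\<^bsub>K\<^esub>" by (rule ring_hom_zero[OF \<iota>(1) Q.ring_axioms K.ring_axioms])
    show ?thesis
    proof (cases "bar_poly B A \<alpha> z g")
      case (Cons c cs)
      have c: "c \<in> carrier Q" "set cs \<subseteq> carrier Q" "c \<noteq> \<zero>\<^bsub>Q\<^esub>"
        using bp Cons by (auto simp: polynomial_def)
      have "\<iota> c \<noteq> \<zero>\<^bsub>K\<^esub>" using inj_onD[OF \<iota>(2), of c "\<zero>\<^bsub>Q\<^esub>"] c \<iota>0 by auto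
      moreover have "\<iota> ` carrier Q \<subseteq> carrier K" using ring_hom_closed[OF \<iota>(1)] by auto
      ultimately show ?thesis using Cons c by (auto simp: bar_def polynomial_def subset_iff)
    qed (simp add: bar_def polynomial_def)
  qed
  have hp: "polynomial\<^bsub>K\<^esub> (carrier K) h" using h(1) by (simp add: P_def univ_poly_carrier)
  have prod: "bar f = K.poly_mult h (bar g)" using h(2) by (simp add: P_def univ_poly_mult)
  have "bar f \<noteq> []" using nonzero by (simp add: bar_def)
  then have "h \<noteq> []" "bar g \<noteq> []"
    using prod K.poly_mult_zero[of h] K.polynomial_incl[OF hp] by auto
  then have "degree (bar f) = degree h + degree (bar g)"
    using K.poly_mult_degree_eq[OF K.carrier_is_subring hp bg] prod by simp
  then have "degree (bar g) \<le> degree (bar f)" by simp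
  also have "\<dots> \<le> R.rank" using len by (simp add: bar_def)
  finally show ?thesis by (simp add: bar_def)
qed

end

section \<open>Verification of the reduction hypotheses for the given data\<close>

theorem theorem3p9:
  fixes B A :: "('a, 'b) ring_scheme"
    and k :: "'a set"
    and \<delta> :: "'a \<Rightarrow> 'a"
    and \<alpha> \<beta> z g :: 'a
    and p :: nat
    and K :: "('c, 'd) ring_scheme"
    and \<iota> :: "'a set \<Rightarrow> 'c"
  assumes "algebraically_closed (B \<lparr> carrier := k \<rparr>)"
    and "char_zero (B \<lparr> carrier := k \<rparr>)"
    and "affine_domain k B"
    and "factorial_domain B"
    and "locally_nilpotent_derivation k B \<delta>"
    and "nontrivial_derivation B \<delta>"
    and "irreducible_derivation B \<delta>"
    and "A = kernel_ring B \<delta>"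
    and "noetherian_ring A"
    and "p > 0"
    and "\<alpha> \<in> carrier A"
    and "ring_prime\<^bsub>A\<^esub> \<alpha>"
    and "\<beta> \<in> carrier A"
    and "\<one>\<^bsub>A\<^esub> gcdof\<^bsub>A\<^esub> \<alpha> \<beta>"
    and "plinth_ideal B \<delta> = PIdl\<^bsub>A\<^esub> (\<alpha> [^]\<^bsub>A\<^esub> p \<otimes>\<^bsub>A\<^esub> \<beta>)"
    and "affine_domain k A"
    and "z \<in> carrier B"
    and "\<delta> z = \<alpha> [^]\<^bsub>A\<^esub> p \<otimes>\<^bsub>A\<^esub> \<beta>"
    and "fraction_field (A Quot PIdl\<^bsub>A\<^esub> \<alpha>) K \<iota>"
    and "I1_generator B A \<alpha> z K \<iota> g"
  shows "\<exists>m \<ge> degree (bar_poly B A \<alpha> z g).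
    for_general_closed_point (A Quot PIdl\<^bsub>A\<^esub> \<alpha>)
      (\<lambda>y. let M = quot_point A (PIdl\<^bsub>A\<^esub> \<alpha>) y in
        disjoint_union_of_affine_lines
          (B \<lparr> carrier := k \<rparr>) (\<lambda>c. fiber_ideal B M +>\<^bsub>B\<^esub> c) (fiber_ring B M) m)"
proof -
  interpret B: factorial_domain B by (rule assms(4))
  have k: "subfield k B" using assms(3) by (simp add: affine_domain_def)
  have natmult: "[(n::nat)] \<cdot>\<^bsub>B\<^esub> \<one>\<^bsub>B\<^esub> \<in> k - {\<zero>\<^bsub>B\<^esub>}" if "0 < n" for n
  proof -
    have "[n] \<cdot>\<^bsub>B\<^esub> \<one>\<^bsub>B\<^esub> \<in> k"
      by (induct n) (use subringE[OF subfieldE(1)[OF k]] in auto)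
    moreover have "[n] \<cdot>\<^bsub>B \<lparr> carrier := k \<rparr>\<^esub> \<one>\<^bsub>B \<lparr> carrier := k \<rparr>\<^esub> = [n] \<cdot>\<^bsub>B\<^esub> \<one>\<^bsub>B\<^esub>"
      by (simp add: add_pow_def nat_pow_def)
    ultimately show ?thesis using assms(2) that by (auto simp: char_zero_def)
  qed
  have lnd: "lnd_domain B \<delta>"
    using assms(5) natmult B.domain_axioms
    by (auto simp: locally_nilpotent_derivation_def intro!: lnd_domain.intro lnd_domain_axioms.intro)
  interpret B: lnd_domain B \<delta> by (rule lnd)
  have A: "A = B \<lparr> carrier := B.Ker \<rparr>"
    by (simp add: assms(8) kernel_ring_def B.Ker_def)
  interpret A: domain A using assms(16) by (simp add: affine_domain_def)
  have A_simps [simp]: "carrier A = B.Ker" "monoid.mult A = monoid.mult B" "\<one>\<^bsub>A\<^esub> = \<one>\<^bsub>B\<^esub>" "\<zero>\<^bsub>A\<^esub> = \<zero>\<^bsub>B\<^esub>"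
    by (auto simp: A)
  have A_pow: "x [^]\<^bsub>A\<^esub> (n::nat) = x [^]\<^bsub>B\<^esub> n" for x n by (simp add: nat_pow_def)
  have kK: "k \<subseteq> B.Ker"
    using assms(5) subfieldE(3)[OF k] by (auto simp: locally_nilpotent_derivation_def B.Ker_def)
  have \<alpha>K: "\<alpha> \<in> B.Ker" and \<beta>K: "\<beta> \<in> B.Ker" using assms(11,13) by auto
  then have [simp]: "\<alpha> \<in> carrier B" "\<beta> \<in> carrier B" by auto
  have \<alpha>0: "\<alpha> \<noteq> \<zero>\<^bsub>B\<^esub>" and prA: "prime A \<alpha>" using assms(12) by (auto simp: ring_prime_def)
  \<comment> \<open>An inverse of \<alpha> in \<open>B\<close> would lie in \<open>A\<close> by
    factorial closedness, making \<alpha> a unit of \<open>A\<close>.\<close>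
  have \<alpha>U: "\<alpha> \<notin> Units B"
  proof
    assume "\<alpha> \<in> Units B"
    then obtain u where u: "u \<in> carrier B" "\<alpha> \<otimes>\<^bsub>B\<^esub> u = \<one>\<^bsub>B\<^esub>" "u \<otimes>\<^bsub>B\<^esub> \<alpha> = \<one>\<^bsub>B\<^esub>" unfolding Units_def by blast
    have "u \<noteq> \<zero>\<^bsub>B\<^esub>" using u by auto
    then have "\<delta> u = \<zero>\<^bsub>B\<^esub>" using B.Ker_factorially_closed[of u \<alpha>] u \<alpha>0 by simp
    then have "\<alpha> \<in> Units A" using u \<alpha>K unfolding Units_def by (auto simp: B.Ker_def)
    then show False using prA by (simp add: prime_def)
  qed
  \<comment> \<open>Primality is given only in \<open>A\<close>. The factors of \<alpha> in
    \<open>B\<close> belong to \<open>A\<close>, so \<alpha> is irreducible in \<open>B\<close>, and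
    in a factorial ring this means prime.\<close>
  have "irreducible (mult_of B) \<alpha>"
  proof (rule irreducibleI)
    show "\<alpha> \<notin> Units (mult_of B)" using \<alpha>U by simp
    fix b assume b: "b \<in> carrier (mult_of B)" "properfactor (mult_of B) b \<alpha>"
    then obtain c where c: "c \<in> carrier B" "c \<noteq> \<zero>\<^bsub>B\<^esub>" "\<alpha> = b \<otimes>\<^bsub>B\<^esub> c" and nd: "\<not> \<alpha> divides\<^bsub>mult_of B\<^esub> b"
      by (auto simp: properfactor_def factor_def)
    have bB: "b \<in> carrier B" "b \<noteq> \<zero>\<^bsub>B\<^esub>" using b by auto
    have "\<delta> (b \<otimes>\<^bsub>B\<^esub> c) = \<zero>\<^bsub>B\<^esub>" using \<alpha>K c by auto
    then have bcK: "b \<in> B.Ker" "c \<in> B.Ker"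
      using B.Ker_factorially_closed[OF bB(1) c(1) bB(2) c(2)] B.Ker_factorially_closed[OF c(1) bB(1) c(2) bB(2)]
        bB c B.m_comm[of b c] by (auto simp: B.Ker_def)
    have "\<alpha> divides\<^bsub>A\<^esub> b \<otimes>\<^bsub>A\<^esub> c" using c(3) B.Ker_subring \<alpha>K subringE(3)[OF B.Ker_subring]
      unfolding factor_def by (auto intro!: bexI[of _ "\<one>\<^bsub>B\<^esub>"])
    then have "\<alpha> divides\<^bsub>A\<^esub> b \<or> \<alpha> divides\<^bsub>A\<^esub> c"
      using prA bcK unfolding prime_def by simp
    then show "b \<in> Units (mult_of B)"
    proof
      assume "\<alpha> divides\<^bsub>A\<^esub> b"
      then obtain d where "d \<in> B.Ker" "b = \<alpha> \<otimes>\<^bsub>B\<^esub> d" unfolding factor_def by auto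
      moreover then have "d \<noteq> \<zero>\<^bsub>B\<^esub>" using bB by auto
      ultimately have "\<alpha> divides\<^bsub>mult_of B\<^esub> b" unfolding factor_def by auto
      then show ?thesis using nd by simp
    next
      assume "\<alpha> divides\<^bsub>A\<^esub> c"
      then obtain d where d: "d \<in> B.Ker" "c = \<alpha> \<otimes>\<^bsub>B\<^esub> d" unfolding factor_def by auto
      have dB: "d \<in> carrier B" using d by auto
      have "\<alpha> \<otimes>\<^bsub>B\<^esub> \<one>\<^bsub>B\<^esub> = \<alpha> \<otimes>\<^bsub>B\<^esub> (b \<otimes>\<^bsub>B\<^esub> d)"
        using c(3) d dB bB B.m_lcomm[of b \<alpha> d] by simp
      then have "\<one>\<^bsub>B\<^esub> = b \<otimes>\<^bsub>B\<^esub> d" using B.m_lcancel[of \<alpha> "\<one>\<^bsub>B\<^esub>" "b \<otimes>\<^bsub>B\<^esub> d"] \<alpha>0 bB dB by simp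
      then have "b \<in> Units B" using bB dB B.m_comm[of b d] unfolding Units_def by auto
      then show ?thesis by simp
    qed
  qed
  then have "prime (mult_of B) \<alpha>"
    using factorial_monoid.irreducible_prime[of "mult_of B" \<alpha>] \<alpha>0 assms(4) by (simp add: factorial_domain_def)
  then have prime: "primeideal (PIdl\<^bsub>B\<^esub> \<alpha>) B"
    using B.primeideal_iff_prime[of \<alpha>] B.ring_primeI'[of \<alpha>] \<alpha>0 by simp
  have red: "lnd_reduction B \<delta> \<alpha>"
  proof (intro lnd_reduction.intro lnd_reduction_axioms.intro lnd assms(4) \<alpha>K \<alpha>0 prime)
    fix n :: nat assume "0 < n"
    then have nk: "[n] \<cdot>\<^bsub>B\<^esub> \<one>\<^bsub>B\<^esub> \<in> k - {\<zero>\<^bsub>B\<^esub>}" by (rule natmult)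
    \<comment> \<open>A positive integer is a unit of \<open>k\<close>, and a unit in \<alpha>B
      would make \<alpha> a unit.\<close>
    show "[n] \<cdot>\<^bsub>B\<^esub> \<one>\<^bsub>B\<^esub> \<notin> PIdl\<^bsub>B\<^esub> \<alpha>"
    proof
      assume "[n] \<cdot>\<^bsub>B\<^esub> \<one>\<^bsub>B\<^esub> \<in> PIdl\<^bsub>B\<^esub> \<alpha>"
      then obtain c where c: "c \<in> carrier B" "[n] \<cdot>\<^bsub>B\<^esub> \<one>\<^bsub>B\<^esub> = c \<otimes>\<^bsub>B\<^esub> \<alpha>" unfolding cgenideal_def by blast
      have u: "[n] \<cdot>\<^bsub>B\<^esub> \<one>\<^bsub>B\<^esub> \<in> Units B" using B.subfield_m_inv(1)[OF k nk] B.subfield_m_inv(2,3)[OF k nk] nk subfieldE(3)[OF k]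
        unfolding Units_def by blast
      have "\<alpha> \<otimes>\<^bsub>B\<^esub> c \<in> Units B" using u c B.m_comm[of c \<alpha>] by simp
      then have "\<alpha> \<in> Units B" by (rule B.unit_factor) (rule \<open>\<alpha> \<in> carrier B\<close>, rule c(1))
      then show False using \<alpha>U by (rule notE[rotated])
    qed
  next
    show "\<exists>t\<in>carrier B. \<delta> t \<notin> PIdl\<^bsub>B\<^esub> \<alpha>"
    proof (rule ccontr)
      assume "\<not> (\<exists>t\<in>carrier B. \<delta> t \<notin> PIdl\<^bsub>B\<^esub> \<alpha>)"
      then have "\<delta> ` carrier B \<subseteq> PIdl\<^bsub>B\<^esub> \<alpha>" by blast
      then have "\<alpha> \<in> Units B" using assms(7) \<open>\<alpha> \<in> carrier B\<close> unfolding irreducible_derivation_def by blast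
      then show False using \<alpha>U by (rule notE[rotated])
    qed
  qed
  interpret lnd_reduction B \<delta> \<alpha> by (rule red)
  have \<delta>z: "\<delta> z = \<alpha> [^]\<^bsub>B\<^esub> p \<otimes>\<^bsub>B\<^esub> \<beta>" using assms(18) A_pow by simp
  \<comment> \<open>If \<beta> were zero, \<alpha> would be a common divisor of \<alpha> and
    \<beta>, hence a unit by coprimality.\<close>
  have \<beta>0: "\<beta> \<noteq> \<zero>\<^bsub>B\<^esub>"
  proof
    assume \<beta>: "\<beta> = \<zero>\<^bsub>B\<^esub>"
    have "\<alpha> divides\<^bsub>A\<^esub> \<alpha>" by (rule A.divides_refl) (simp add: \<alpha>K)
    moreover have "\<alpha> divides\<^bsub>A\<^esub> \<beta>" using A.divides_zero[of \<alpha>] \<alpha>K \<beta> by simp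
    ultimately have "\<alpha> divides\<^bsub>A\<^esub> \<one>\<^bsub>A\<^esub>" using assms(14) \<alpha>K unfolding isgcd_def by simp
    then have "\<alpha> \<in> Units A" using A.divides_one[of \<alpha>] \<alpha>K by simp
    then show False using prA by (simp add: prime_def)
  qed
  have "\<alpha> [^]\<^bsub>B\<^esub> p \<noteq> \<zero>\<^bsub>B\<^esub>" using \<alpha>0 by (induct p) (auto simp: B.integral_iff)
  then have \<delta>z0: "\<delta> z \<noteq> \<zero>\<^bsub>B\<^esub>" using \<delta>z \<beta>0 by (simp add: B.integral_iff)
  \<comment> \<open>\<open>p > 0\<close> supplies at least one factor \<alpha>, which puts the class
    of \<open>z\<close> in the kernel of \<Delta>.\<close>
  have \<delta>zI: "\<delta> z \<in> PIdl\<^bsub>B\<^esub> \<alpha>"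
  proof -
    obtain n where n: "p = Suc n" using assms(10) by (cases p) auto
    have "\<delta> z = (\<alpha> [^]\<^bsub>B\<^esub> n \<otimes>\<^bsub>B\<^esub> \<beta>) \<otimes>\<^bsub>B\<^esub> \<alpha>"
      unfolding \<delta>z n using B.m_comm[of \<alpha> \<beta>] by (simp add: B.m_assoc)
    moreover have "\<alpha> [^]\<^bsub>B\<^esub> n \<otimes>\<^bsub>B\<^esub> \<beta> \<in> carrier B" by simp
    ultimately show ?thesis unfolding cgenideal_def by (intro CollectI exI conjI)
  qed
  have "degree (bar_poly B A \<alpha> z g) \<le> R.rank"
    by (rule degree_bar_poly_le_rank[OF A A.domain_axioms assms(17) \<delta>zI \<delta>z0 assms(19,20)])
  then show ?thesis
    by (intro exI[of _ R.rank] conjI general_fibre[OF assms(1,3) kK A assms(9,16)])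
qed

end
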